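(* Let $1\le p\le q$ be integers, $d=p+q$, and let $R\in\mathbb{S}^d_>$ be a correlation matrix (all diagonal elements equal to $1$) whose upper left $p\times p$ diagonal block $R_1$ has $p$ distinct eigenvalues and whose lower right $q\times q$ diagonal block $R_2$ has $q$ distinct eigenvalues. Let $H_t\in\mathbb{S}^d$ for $t>0$ and $H\in\mathbb{S}^d$ be such that $H_t\to H$ element-wise as $t\downarrow0$. Then, for $r\in\{1,2\}$, $$\lim_{t\downarrow0}t^{-1}\bigl(\mathfrak{D}_r(\varphi(R+tH_t))-\mathfrak{D}_r(R)\bigr)=\operatorname{tr}\bigl((M_{R,r}-D_{M_{R,r}R})H\bigr),$$ where $\varphi$, $D_{(\cdot)}$, $\mathfrak{D}_r$ and $M_{R,r}$ are defined in the context.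
   Context: $\mathbb{S}^m$, $\mathbb{S}^m_\ge$, $\mathbb{S}^m_>$: real symmetric / positive semi-definite / positive definite $m\times m$ matrices. For a square matrix $A$, $D_A$ is the diagonal matrix with the same diagonal as $A$. For $\Sigma\in\mathbb{S}^d_\ge$ with positive diagonal elements, $\varphi(\Sigma)=D_\Sigma^{-1/2}\Sigma D_\Sigma^{-1/2}$. Dependence coefficients: for $A\in\mathbb{S}^d_\ge$ with non-zero diagonal blocks $A_1$ ($p\times p$) and $A_2$ ($q\times q$), $A_0=\begin{bmatrix}A_1&0\\0&A_2\end{bmatrix}$, $\Gamma(A_1,A_2)$ the set of all matrices in $\mathbb{S}^d_\ge$ with diagonal blocks $A_1,A_2$, and $d_W^2(A,B)=\operatorname{tr}(A)+\operatorname{tr}(B)-2\operatorname{tr}\bigl((A^{1/2}BA^{1/2})^{1/2}\bigr)$, $$\mathfrak{D}_1(A)=\frac{d_W^2(A,I_d)-d_W^2(A_1,I_p)-d_W^2(A_2,I_q)}{\sup_{\tilde A\in\Gamma(A_1,A_2)}d_W^2(\tilde A,I_d)-d_W^2(A_1,I_p)-d_W^2(A_2,I_q)},\qquad \mathfrak{D}_2(A)=\frac{d_W^2(A,A_0)}{\sup_{\tilde A\in\Gamma(A_1,A_2)}d_W^2(\tilde A,A_0)}.$$ Matrices $M_{R,r}$: let $R_j=U_j\Lambda_jU_j^\top$, $j\in\{1,2\}$, with $U_j$ orthogonal and $\Lambda_j$ diagonal with the eigenvalues of $R_j$ in decreasing order; $R_0=\begin{bmatrix}R_1&0\\0&R_2\end{bmatrix}$;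 $R_m=\begin{bmatrix}R_1&\Psi_m\\ \Psi_m^\top&R_2\end{bmatrix}$, $\Psi_m=U_1\Lambda_1^{1/2}\Pi\Lambda_2^{1/2}U_2^\top$, $\Pi$ the $p\times q$ upper left block of $I_d$. Partition $\Lambda_2=\begin{bmatrix}\Lambda_{2,1}&0\\0&\Lambda_{2,2}\end{bmatrix}$ with blocks of sizes $p\times p$ and $(q-p)\times(q-p)$ (second block empty if $q=p$). Put $\Delta_1=(\Lambda_1+\Lambda_{2,1})^{-1/2}$, $\Delta_2=\begin{bmatrix}\Delta_1&0\\0&\Lambda_{2,2}^{-1/2}\end{bmatrix}$, $\Delta_1'=(\Lambda_1^2+\Lambda_{2,1}^2)^{-1/2}\Lambda_1$, $\Delta_2'=\begin{bmatrix}(\Lambda_1^2+\Lambda_{2,1}^2)^{-1/2}\Lambda_{2,1}&0\\0&I_{q-p}\end{bmatrix}$, $\Upsilon_1=\begin{bmatrix}U_1\Delta_1U_1^\top&0\\0&U_2\Delta_2U_2^\top\end{bmatrix}$, $\Upsilon_2=\begin{bmatrix}U_1\Delta_1'U_1^\top&0\\0&U_2\Delta_2'U_2^\top\end{bmatrix}$, $J=R_0^{-1/2}(R_0^{1/2}RR_0^{1/2})^{1/2}R_0^{-1/2}$, and $J_0$ the block-diagonal matrix with the same $p\times p$ and $q\times q$ diagonal blocks as $J$. With $c_1=\operatorname{tr}(R_1^{1/2})+\operatorname{tr}(R_2^{1/2})-\operatorname{tr}(R_m^{1/2})$ and $c_2=\operatorname{tr}(R)-\operatorname{tr}\bigl((R_0^{1/2}R_mR_0^{1/2})^{1/2}\bigr)$,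 $$M_{R,1}=\frac1{2c_1}\bigl(-R^{-1/2}+(1-\mathfrak{D}_1(R))R_0^{-1/2}+\mathfrak{D}_1(R)\Upsilon_1\bigr),$$ $$M_{R,2}=\frac1{c_2}\bigl(-\tfrac12(J_0+J^{-1})+(1-\mathfrak{D}_2(R))I_d+\mathfrak{D}_2(R)\Upsilon_2\bigr).$$ For $t>0$ sufficiently small, $R+tH_t$ is positive definite, so the left-hand side is well defined. *)

theory Defs
  imports "Jordan_Normal_Form.Gauss_Jordan_Elimination" "Jordan_Normal_Form.Spectral_Radius"
begin

definition sym_mats :: "nat \<Rightarrow> real mat set" where
  "sym_mats m = {A \<in> carrier_mat m m. transpose_mat A = A}"

definition psd_mats :: "nat \<Rightarrow> real mat set" where
  "psd_mats m = {A \<in> sym_mats m. \<forall>v \<in> carrier_vec m. scalar_prod v (A *\<^sub>v v) \<ge> 0}"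

definition pd_mats :: "nat \<Rightarrow> real mat set" where
  "pd_mats m = {A \<in> sym_mats m. \<forall>v \<in> carrier_vec m. v \<noteq> 0\<^sub>v m \<longrightarrow> scalar_prod v (A *\<^sub>v v) > 0}"

definition corr_mats :: "nat \<Rightarrow> real mat set" where
  "corr_mats m = {A \<in> psd_mats m. \<forall>i<m. A $$ (i,i) = 1}"

definition tr :: "real mat \<Rightarrow> real" where
  "tr A = (\<Sum>i<dim_row A. A $$ (i,i))"

definition diag_part :: "real mat \<Rightarrow> real mat" where
  "diag_part A = mat_diag (dim_row A) (\<lambda>i. A $$ (i,i))"

(* Meaningful only for positive semi-definite A, where the root exists and is unique. *)
definition psd_sqrt :: "real mat \<Rightarrow> real mat" where
  "psd_sqrt A = (THE B. B \<in> psd_mats (dim_row A) \<and> B * B = A)"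

definition mat_inv :: "real mat \<Rightarrow> real mat" where
  "mat_inv A = the (mat_inverse A)"

definition inv_sqrt :: "real mat \<Rightarrow> real mat" where
  "inv_sqrt A = mat_inv (psd_sqrt A)"

definition corr_normalize :: "real mat \<Rightarrow> real mat" where
  "corr_normalize S = inv_sqrt (diag_part S) * S * inv_sqrt (diag_part S)"

(* For a square matrix A: the upper left p x p block and the complementary lower right block. *)
definition ul_block :: "nat \<Rightarrow> real mat \<Rightarrow> real mat" where
  "ul_block p A = (case split_block A p p of (A1, _, _, A2) \<Rightarrow> A1)"

definition lr_block :: "nat \<Rightarrow> real mat \<Rightarrow> real mat" where
  "lr_block p A = (case split_block A p p of (A1, _, _, A2) \<Rightarrow> A2)"

definition block_diag :: "real mat \<Rightarrow> real mat \<Rightarrow> real mat" where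
  "block_diag A B =
     four_block_mat A (0\<^sub>m (dim_row A) (dim_col B)) (0\<^sub>m (dim_row B) (dim_col A)) B"

definition block_diag_part :: "nat \<Rightarrow> real mat \<Rightarrow> real mat" where
  "block_diag_part p A = block_diag (ul_block p A) (lr_block p A)"

definition wasserstein_sq :: "real mat \<Rightarrow> real mat \<Rightarrow> real" where
  "wasserstein_sq A B = tr A + tr B - 2 * tr (psd_sqrt (psd_sqrt A * B * psd_sqrt A))"

definition coupling_mats :: "nat \<Rightarrow> nat \<Rightarrow> real mat \<Rightarrow> real mat \<Rightarrow> real mat set" where
  "coupling_mats p q A1 A2 = {A \<in> psd_mats (p + q). ul_block p A = A1 \<and> lr_block p A = A2}"

definition dep_coef1 :: "nat \<Rightarrow> nat \<Rightarrow> real mat \<Rightarrow> real" where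
  "dep_coef1 p q A =
     (let A1 = ul_block p A; A2 = lr_block p A in
       (wasserstein_sq A (1\<^sub>m (p + q)) - wasserstein_sq A1 (1\<^sub>m p) - wasserstein_sq A2 (1\<^sub>m q))
       / ((SUP B \<in> coupling_mats p q A1 A2. wasserstein_sq B (1\<^sub>m (p + q)))
          - wasserstein_sq A1 (1\<^sub>m p) - wasserstein_sq A2 (1\<^sub>m q)))"

definition dep_coef2 :: "nat \<Rightarrow> nat \<Rightarrow> real mat \<Rightarrow> real" where
  "dep_coef2 p q A =
     (let A1 = ul_block p A; A2 = lr_block p A; A0 = block_diag A1 A2 in
       wasserstein_sq A A0 / (SUP B \<in> coupling_mats p q A1 A2. wasserstein_sq B A0))"

(* The diagonal of L automatically lists the eigenvalues of A with multiplicity, since A = U L U^T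
   with U orthogonal.  The library predicate orthogonal_mat is not used: it only asks for pairwise
   orthogonal nonzero columns. *)
definition ordered_eigendecomp :: "nat \<Rightarrow> real mat \<Rightarrow> real mat \<Rightarrow> real mat \<Rightarrow> bool" where
  "ordered_eigendecomp n A U L \<longleftrightarrow>
     U \<in> carrier_mat n n \<and> inverts_mat U (transpose_mat U) \<and> inverts_mat (transpose_mat U) U \<and>
     L \<in> carrier_mat n n \<and> diagonal_mat L \<and> (\<forall>i j. i \<le> j \<and> j < n \<longrightarrow> L $$ (j,j) \<le> L $$ (i,i)) \<and>
     A = U * L * transpose_mat U"

(* The pairs (U1, L1) and (U2, L2) below stand for ordered eigendecompositions of the two diagonal
   blocks of R. *)

definition Psi_m :: "nat \<Rightarrow> nat \<Rightarrow> real mat \<Rightarrow> real mat \<Rightarrow> real mat \<Rightarrow> real mat \<Rightarrow> real mat" where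
  "Psi_m p q U1 L1 U2 L2 =
     U1 * psd_sqrt L1 * fst (split_block (1\<^sub>m (p + q)) p q) * psd_sqrt L2 * transpose_mat U2"

definition R_m :: "nat \<Rightarrow> nat \<Rightarrow> real mat \<Rightarrow> real mat \<Rightarrow> real mat \<Rightarrow> real mat \<Rightarrow> real mat \<Rightarrow> real mat" where
  "R_m p q R U1 L1 U2 L2 =
     four_block_mat (ul_block p R) (Psi_m p q U1 L1 U2 L2)
       (transpose_mat (Psi_m p q U1 L1 U2 L2)) (lr_block p R)"

definition Upsilon1 :: "nat \<Rightarrow> real mat \<Rightarrow> real mat \<Rightarrow> real mat \<Rightarrow> real mat \<Rightarrow> real mat" where
  "Upsilon1 p U1 L1 U2 L2 =
     (let L21 = ul_block p L2; L22 = lr_block p L2;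
          Delta1 = inv_sqrt (L1 + L21);
          Delta2 = block_diag Delta1 (inv_sqrt L22)
      in block_diag (U1 * Delta1 * transpose_mat U1) (U2 * Delta2 * transpose_mat U2))"

definition Upsilon2 :: "nat \<Rightarrow> nat \<Rightarrow> real mat \<Rightarrow> real mat \<Rightarrow> real mat \<Rightarrow> real mat \<Rightarrow> real mat" where
  "Upsilon2 p q U1 L1 U2 L2 =
     (let L21 = ul_block p L2;
          N = inv_sqrt (L1 * L1 + L21 * L21);
          Delta1 = N * L1;
          Delta2 = block_diag (N * L21) (1\<^sub>m (q - p))
      in block_diag (U1 * Delta1 * transpose_mat U1) (U2 * Delta2 * transpose_mat U2))"

definition M_R1 :: "nat \<Rightarrow> nat \<Rightarrow> real mat \<Rightarrow> real mat \<Rightarrow> real mat \<Rightarrow> real mat \<Rightarrow> real mat \<Rightarrow> real mat" where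
  "M_R1 p q R U1 L1 U2 L2 =
     (let R0 = block_diag_part p R;
          c1 = tr (psd_sqrt (ul_block p R)) + tr (psd_sqrt (lr_block p R))
               - tr (psd_sqrt (R_m p q R U1 L1 U2 L2))
      in (1 / (2 * c1)) \<cdot>\<^sub>m
           (- inv_sqrt R + (1 - dep_coef1 p q R) \<cdot>\<^sub>m inv_sqrt R0
            + dep_coef1 p q R \<cdot>\<^sub>m Upsilon1 p U1 L1 U2 L2))"

definition M_R2 :: "nat \<Rightarrow> nat \<Rightarrow> real mat \<Rightarrow> real mat \<Rightarrow> real mat \<Rightarrow> real mat \<Rightarrow> real mat \<Rightarrow> real mat" where
  "M_R2 p q R U1 L1 U2 L2 =
     (let R0 = block_diag_part p R;
          J = inv_sqrt R0 * psd_sqrt (psd_sqrt R0 * R * psd_sqrt R0) * inv_sqrt R0;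
          J0 = block_diag_part p J;
          c2 = tr R - tr (psd_sqrt (psd_sqrt R0 * R_m p q R U1 L1 U2 L2 * psd_sqrt R0))
      in (1 / c2) \<cdot>\<^sub>m
           ((- (1 / 2)) \<cdot>\<^sub>m (J0 + mat_inv J) + (1 - dep_coef2 p q R) \<cdot>\<^sub>m 1\<^sub>m (p + q)
            + dep_coef2 p q R \<cdot>\<^sub>m Upsilon2 p q U1 L1 U2 L2))"

end

theory Submission
  imports Defs
begin

text \<open>Both coefficients are ratios of traces of square roots, and the derivative is obtained by
  differentiating closed forms.

  The suprema are computed first. On the couplings of \<open>A1\<close> and \<open>A2\<close> the distance to the identity is
  \<open>tr A + d - 2 * tr (psd_sqrt B)\<close>, so the task is to minimise the trace of the root of a coupling \<open>B\<close>. Factor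
  \<open>B = Z Z\<^sup>T\<close> in the block eigenbasis: the rows of \<open>Z\<close> in each block are orthogonal, with squared norms
  the eigenvalues \<open>a\<close> and \<open>b\<close> of the blocks, and the columns can be taken orthogonal, with squared norms
  the eigenvalues of \<open>B\<close>. Ky Fan's inequality for the two groups of rows shows that the
  spectrum of \<open>B\<close> is majorised by the decreasing sequence \<open>a + b\<close> (padded by zeros), and concavity of the
  square root gives \<open>tr (psd_sqrt B) \<ge> \<Sum>i. sqrt (a i + b i)\<close> (\<open>pair_root_sum_le_tr_psd_sqrt\<close>). The
  coupling that pairs eigenvectors in decreasing order is a Gram matrix whose swapped Gram matrix is
  diagonal with entries \<open>a i + b i\<close>, so it attains the bound. For the second coefficient, conjugation
  with the root of \<open>A0\<close> turns couplings of \<open>A1\<close>, \<open>A2\<close> into couplings of their squares, and the same bound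
  applies (\<open>dep_coef1_eq\<close>, \<open>dep_coef2_eq\<close>).

  Then three kinds of terms are differentiated along a path of positive definite matrices, with
  one-sided derivatives at \<open>0\<close>. The root \<open>S\<close> of \<open>A\<close> has the derivative \<open>L\<close> that solves the Sylvester equation
  \<open>S L + L S = A'\<close>, because a coercive \<open>S\<close> makes the Sylvester operator bounded below
  (\<open>mat_deriv_psd_sqrt\<close>); taking traces after multiplication by \<open>S\<^sup>-\<^sup>1\<close> yields the derivatives of
  \<open>tr (psd_sqrt A)\<close> and of the fidelity (\<open>tr_fidelity_deriv\<close>). The suprema depend on the ordered
  eigenvalues of the blocks. These are simple at \<open>0\<close>, so they are differentiable with derivative
  \<open>u\<^sup>T A' u\<close> for the unit eigenvector \<open>u\<close> (\<open>ordered_eigenvalue_deriv\<close>), even though eigenvectors along the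
  path need not depend continuously on the parameter.

  Finally, the normalised path \<open>\<phi>(R + t H\<^sub>t)\<close> has the derivative \<open>H - (D\<^sub>H R + R D\<^sub>H) / 2\<close> at \<open>0\<close>, and
  symmetry of \<open>M\<close> and \<open>R\<close> turns its trace pairing with \<open>M\<close> into that of \<open>M - D\<^sub>M\<^sub>R\<close> with \<open>H\<close>.\<close>

section \<open>Entries, traces and quadratic forms\<close>

lemma index_mult_mat_sum:
  assumes "A \<in> carrier_mat n m" "B \<in> carrier_mat m k" "i < n" "j < k"
  shows "(A * B) $$ (i,j) = (\<Sum>l<m. A $$ (i,l) * B $$ (l,j))"
  using assms by (auto simp: scalar_prod_def atLeast0LessThan)

lemma tr_carrier: "A \<in> carrier_mat n m \<Longrightarrow> tr A = (\<Sum>i<n. A $$ (i,i))"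
  by (auto simp: tr_def)

lemma tr_mult:
  assumes "A \<in> carrier_mat n m" "B \<in> carrier_mat m n"
  shows "tr (A * B) = (\<Sum>i<n. \<Sum>j<m. A $$ (i,j) * B $$ (j,i))"
proof -
  have "A * B \<in> carrier_mat n n" using assms by auto
  then show ?thesis
    using index_mult_mat_sum[OF assms] by (simp add: tr_carrier)
qed

lemma tr_mult_comm:
  assumes "A \<in> carrier_mat n m" "B \<in> carrier_mat m n"
  shows "tr (A * B) = tr (B * A)"
  unfolding tr_mult[OF assms] tr_mult[OF assms(2,1)]
  by (subst sum.swap) (simp add: mult.commute)

lemma tr_add:
  assumes "A \<in> carrier_mat n n" "B \<in> carrier_mat n n"
  shows "tr (A + B) = tr A + tr B"
  using assms by (auto simp: tr_def sum.distrib)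

lemma tr_smult: "tr (c \<cdot>\<^sub>m A) = c * tr A" if "A \<in> carrier_mat n n"
  using that by (auto simp: tr_def sum_distrib_left)

text \<open>The quadratic form on coefficient functions \<open>nat \<Rightarrow> real\<close>: rows, columns and padded vectors can be
  plugged in without packing them into vectors of the right dimension.\<close>

definition quad_form :: "nat \<Rightarrow> real mat \<Rightarrow> (nat \<Rightarrow> real) \<Rightarrow> real" where
  "quad_form n A f = (\<Sum>i<n. \<Sum>j<n. f i * A $$ (i,j) * f j)"

lemma scalar_prod_quad_form:
  assumes "A \<in> carrier_mat n n" "v \<in> carrier_vec n"
  shows "scalar_prod v (A *\<^sub>v v) = quad_form n A (\<lambda>i. v $ i)"
  using assms unfolding quad_form_def
  by (auto simp: scalar_prod_def atLeast0LessThan sum_distrib_left mult.assoc intro!: sum.cong)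

lemma sym_mats_carrier: "A \<in> sym_mats n \<Longrightarrow> A \<in> carrier_mat n n"
  by (simp add: sym_mats_def)

lemma sym_mats_entry: "A \<in> sym_mats n \<Longrightarrow> i < n \<Longrightarrow> j < n \<Longrightarrow> A $$ (i,j) = A $$ (j,i)"
  unfolding sym_mats_def
  by (metis (mono_tags, lifting) carrier_matD(1) carrier_matD(2) index_transpose_mat(1) mem_Collect_eq)

lemma sym_matsI:
  assumes "A \<in> carrier_mat n n" "\<And>i j. i < n \<Longrightarrow> j < n \<Longrightarrow> A $$ (i,j) = A $$ (j,i)"
  shows "A \<in> sym_mats n"
  using assms by (auto simp: sym_mats_def intro!: eq_matI)

lemma psd_mats_quad_form:
  "A \<in> psd_mats n \<longleftrightarrow> A \<in> sym_mats n \<and> (\<forall>f. 0 \<le> quad_form n A f)"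
proof
  assume A: "A \<in> psd_mats n"
  then have c: "A \<in> carrier_mat n n" by (simp add: psd_mats_def sym_mats_def)
  have "0 \<le> quad_form n A f" for f
  proof -
    have "0 \<le> scalar_prod (vec n f) (A *\<^sub>v vec n f)"
      using A by (simp add: psd_mats_def)
    also have "\<dots> = quad_form n A (\<lambda>i. vec n f $ i)"
      by (rule scalar_prod_quad_form[OF c]) simp
    also have "\<dots> = quad_form n A f" by (simp add: quad_form_def)
    finally show ?thesis .
  qed
  with A show "A \<in> sym_mats n \<and> (\<forall>f. 0 \<le> quad_form n A f)" by (simp add: psd_mats_def)
next
  assume A: "A \<in> sym_mats n \<and> (\<forall>f. 0 \<le> quad_form n A f)"
  then show "A \<in> psd_mats n"
    by (auto simp: psd_mats_def scalar_prod_quad_form[OF sym_mats_carrier])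
qed

lemma pd_mats_quad_form:
  "A \<in> pd_mats n \<longleftrightarrow> A \<in> sym_mats n \<and> (\<forall>f. (\<exists>i<n. f i \<noteq> 0) \<longrightarrow> 0 < quad_form n A f)"
proof
  assume A: "A \<in> pd_mats n"
  then have c: "A \<in> carrier_mat n n" by (simp add: pd_mats_def sym_mats_def)
  have "0 < quad_form n A f" if "\<exists>i<n. f i \<noteq> 0" for f
  proof -
    have "vec n f \<noteq> 0\<^sub>v n" using that by (metis index_vec index_zero_vec(1))
    then have "0 < scalar_prod (vec n f) (A *\<^sub>v vec n f)"
      using A by (simp add: pd_mats_def)
    also have "\<dots> = quad_form n A (\<lambda>i. vec n f $ i)"
      by (rule scalar_prod_quad_form[OF c]) simp
    also have "\<dots> = quad_form n A f" by (simp add: quad_form_def)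
    finally show ?thesis .
  qed
  with A show "A \<in> sym_mats n \<and> (\<forall>f. (\<exists>i<n. f i \<noteq> 0) \<longrightarrow> 0 < quad_form n A f)"
    by (simp add: pd_mats_def)
next
  assume A: "A \<in> sym_mats n \<and> (\<forall>f. (\<exists>i<n. f i \<noteq> 0) \<longrightarrow> 0 < quad_form n A f)"
  have "0 < scalar_prod v (A *\<^sub>v v)" if v: "v \<in> carrier_vec n" "v \<noteq> 0\<^sub>v n" for v
  proof -
    have "\<exists>i<n. v $ i \<noteq> 0" using v by (metis carrier_vecD eq_vecI index_zero_vec(1) index_zero_vec(2))
    then show ?thesis using A v by (simp add: scalar_prod_quad_form[OF sym_mats_carrier[of A n]])
  qed
  with A show "A \<in> pd_mats n" by (simp add: pd_mats_def)
qed

lemma psd_mats_sym: "A \<in> psd_mats n \<Longrightarrow> A \<in> sym_mats n" by (simp add: psd_mats_def)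
lemma pd_mats_sym: "A \<in> pd_mats n \<Longrightarrow> A \<in> sym_mats n" by (simp add: pd_mats_def)
lemma psd_mats_carrier: "A \<in> psd_mats n \<Longrightarrow> A \<in> carrier_mat n n"
  by (simp add: psd_mats_def sym_mats_def)
lemma pd_mats_carrier: "A \<in> pd_mats n \<Longrightarrow> A \<in> carrier_mat n n"
  by (simp add: pd_mats_def sym_mats_def)

lemma pd_mats_imp_psd: "A \<in> pd_mats n \<Longrightarrow> A \<in> psd_mats n"
proof -
  assume A: "A \<in> pd_mats n"
  have "0 \<le> quad_form n A f" for f
  proof (cases "\<exists>i<n. f i \<noteq> 0")
    case True
    then show ?thesis using A by (auto simp: pd_mats_quad_form intro: less_imp_le)
  next
    case False
    then have "quad_form n A f = 0" by (simp add: quad_form_def)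
    then show ?thesis by simp
  qed
  with A show ?thesis by (simp add: pd_mats_quad_form psd_mats_quad_form)
qed

lemma mat_diag_index: "i < n \<Longrightarrow> j < n \<Longrightarrow> mat_diag n f $$ (i,j) = (if i = j then f j else 0)"
  by (simp add: mat_diag_def)

lemma mat_diag_dims [simp]: "dim_row (mat_diag n f) = n" "dim_col (mat_diag n f) = n"
  by (simp_all add: mat_diag_def)

lemma mat_diag_cong: "(\<And>i. i < n \<Longrightarrow> f i = g i) \<Longrightarrow> mat_diag n f = mat_diag n g"
  by (intro eq_matI) (auto simp: mat_diag_index)

lemma square_mult:
  fixes A B C :: "real mat"
  shows "A \<in> carrier_mat n n \<Longrightarrow> B \<in> carrier_mat n n \<Longrightarrow> C \<in> carrier_mat n n \<Longrightarrow> A * B * C = A * (B * C)"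
    and "A \<in> carrier_mat n n \<Longrightarrow> B \<in> carrier_mat n n \<Longrightarrow> A * B \<in> carrier_mat n n"
    and "A \<in> carrier_mat n n \<Longrightarrow> A\<^sup>T \<in> carrier_mat n n"
    and "mat_diag n f \<in> carrier_mat n n"
  by (simp_all add: assoc_mult_mat[of _ n n _ n _ n])

section \<open>Matrices with a prescribed orthonormal eigenbasis\<close>

definition orth_mat :: "nat \<Rightarrow> real mat \<Rightarrow> bool" where
  "orth_mat n U \<longleftrightarrow> U \<in> carrier_mat n n \<and> U * U\<^sup>T = 1\<^sub>m n \<and> U\<^sup>T * U = 1\<^sub>m n"

definition conj_diag :: "nat \<Rightarrow> real mat \<Rightarrow> (nat \<Rightarrow> real) \<Rightarrow> real mat" where
  "conj_diag n U l = U * mat_diag n l * U\<^sup>T"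

lemma orth_mat_carrier: "orth_mat n U \<Longrightarrow> U \<in> carrier_mat n n"
  by (simp add: orth_mat_def)

lemma orth_mat_transpose: "orth_mat n U \<Longrightarrow> orth_mat n U\<^sup>T"
  by (simp add: orth_mat_def)

lemma orth_mat_one: "orth_mat n (1\<^sub>m n)"
  by (simp add: orth_mat_def)

lemma orth_mat_mult:
  assumes U: "orth_mat n U" and V: "orth_mat n V"
  shows "orth_mat n (U * V)"
proof -
  have c: "U \<in> carrier_mat n n" "V \<in> carrier_mat n n" using U V by (simp_all add: orth_mat_def)
  have "U * V * (V\<^sup>T * U\<^sup>T) = U * (V * V\<^sup>T) * U\<^sup>T"
    using c by (simp add: assoc_mult_mat[of _ n n _ n _ n])
  moreover have "V\<^sup>T * U\<^sup>T * (U * V) = V\<^sup>T * (U\<^sup>T * U) * V"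
    using c by (simp add: assoc_mult_mat[of _ n n _ n _ n])
  ultimately show ?thesis
    using U V c by (simp add: orth_mat_def transpose_mult[of _ n n _ n])
qed

lemma orth_mat_rows:
  assumes "orth_mat n U" "i < n" "j < n"
  shows "(\<Sum>k<n. U $$ (i,k) * U $$ (j,k)) = (if i = j then 1 else 0)"
proof -
  have "(U * U\<^sup>T) $$ (i,j) = (\<Sum>k<n. U $$ (i,k) * U\<^sup>T $$ (k,j))"
    using assms by (intro index_mult_mat_sum[of _ n n _ n]) (auto simp: orth_mat_def)
  then show ?thesis using assms by (auto simp: orth_mat_def)
qed

lemma orth_mat_cols:
  assumes "orth_mat n U" "i < n" "j < n"
  shows "(\<Sum>k<n. U $$ (k,i) * U $$ (k,j)) = (if i = j then 1 else 0)"
  using orth_mat_rows[OF orth_mat_transpose[OF assms(1)] assms(2,3)] assms orth_mat_carrier[OF assms(1)]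
  by auto

lemma conj_diag_carrier [simp]: "orth_mat n U \<Longrightarrow> conj_diag n U l \<in> carrier_mat n n"
  unfolding conj_diag_def orth_mat_def
  by (meson mat_diag_dim mult_carrier_mat transpose_carrier_mat)

lemma conj_diag_index:
  assumes U: "U \<in> carrier_mat n n" and "i < n" "j < n"
  shows "conj_diag n U l $$ (i,j) = (\<Sum>k<n. l k * U $$ (i,k) * U $$ (j,k))"
proof -
  have "conj_diag n U l = Matrix.mat n n (\<lambda> (i,j). U $$ (i,j) * l j) * U\<^sup>T"
    unfolding conj_diag_def by (simp add: mat_diag_mult_right[OF U])
  also have "\<dots> $$ (i,j) = (\<Sum>k<n. U $$ (i,k) * l k * U $$ (j,k))"
    using assms by (subst index_mult_mat_sum[of _ n n _ n]) auto
  finally show ?thesis by (simp add: mult_ac)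
qed

lemma conj_diag_cong: "(\<And>i. i < n \<Longrightarrow> f i = g i) \<Longrightarrow> conj_diag n U f = conj_diag n U g"
  unfolding conj_diag_def by (metis mat_diag_cong)

lemma conj_diag_mult:
  assumes U: "orth_mat n U"
  shows "conj_diag n U a * conj_diag n U b = conj_diag n U (\<lambda>i. a i * b i)"
proof -
  have c: "U \<in> carrier_mat n n" "U\<^sup>T \<in> carrier_mat n n" using U by (simp_all add: orth_mat_def)
  note m = mat_diag_dim[of n a] mat_diag_dim[of n b]
  have "conj_diag n U a * conj_diag n U b = U * mat_diag n a * (U\<^sup>T * U) * mat_diag n b * U\<^sup>T"
    unfolding conj_diag_def using c m by (simp add: square_mult[where n = n])
  also have "\<dots> = U * (mat_diag n a * mat_diag n b) * U\<^sup>T"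
    using U c m by (simp add: orth_mat_def square_mult[where n = n] right_mult_one_mat[of _ n n] del: mat_diag_diag)
  finally show ?thesis by (simp add: conj_diag_def)
qed

lemma conj_diag_one:
  assumes U: "orth_mat n U"
  shows "conj_diag n U (\<lambda>_. 1) = 1\<^sub>m n"
  using U by (simp add: conj_diag_def orth_mat_def right_mult_one_mat[of U n n])

lemma conj_diag_one_mat: "conj_diag n (1\<^sub>m n) l = mat_diag n l"
  unfolding conj_diag_def by (simp add: left_mult_one_mat[OF mat_diag_dim] right_mult_one_mat[OF mat_diag_dim])

lemma conj_diag_sym: "orth_mat n U \<Longrightarrow> conj_diag n U l \<in> sym_mats n"
  by (rule sym_matsI) (simp_all add: conj_diag_index orth_mat_carrier mult_ac)

lemma tr_conj_diag:
  assumes U: "orth_mat n U"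
  shows "tr (conj_diag n U l) = (\<Sum>i<n. l i)"
proof -
  have "tr (conj_diag n U l) = (\<Sum>i<n. \<Sum>k<n. l k * U $$ (i,k) * U $$ (i,k))"
    using U by (simp add: tr_carrier[OF conj_diag_carrier[OF U]] conj_diag_index orth_mat_carrier)
  also have "\<dots> = (\<Sum>k<n. l k * (\<Sum>i<n. U $$ (i,k) * U $$ (i,k)))"
    by (subst sum.swap) (simp add: sum_distrib_left mult.assoc)
  also have "\<dots> = (\<Sum>k<n. l k)"
    using orth_mat_cols[OF U] by simp
  finally show ?thesis .
qed

lemma quad_form_conj_diag:
  assumes "U \<in> carrier_mat n n"
  shows "quad_form n (conj_diag n U l) f = (\<Sum>k<n. l k * (\<Sum>i<n. f i * U $$ (i,k))\<^sup>2)"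
proof -
  have "quad_form n (conj_diag n U l) f
      = (\<Sum>i<n. \<Sum>j<n. \<Sum>k<n. l k * (f i * U $$ (i,k)) * (f j * U $$ (j,k)))"
    unfolding quad_form_def
    by (intro sum.cong refl)
       (simp add: conj_diag_index[OF assms] sum_distrib_left sum_distrib_right mult_ac)
  also have "\<dots> = (\<Sum>i<n. \<Sum>k<n. \<Sum>j<n. l k * (f i * U $$ (i,k)) * (f j * U $$ (j,k)))"
    by (intro sum.cong refl sum.swap)
  also have "\<dots> = (\<Sum>k<n. \<Sum>i<n. \<Sum>j<n. l k * (f i * U $$ (i,k)) * (f j * U $$ (j,k)))"
    by (rule sum.swap)
  also have "\<dots> = (\<Sum>k<n. l k * (\<Sum>i<n. f i * U $$ (i,k))\<^sup>2)"
    by (simp add: power2_eq_square sum_product sum_distrib_left mult_ac)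
  finally show ?thesis .
qed

lemma quad_form_conj_diag_col:
  assumes U: "orth_mat n U" and k: "k < n"
  shows "quad_form n (conj_diag n U l) (\<lambda>i. U $$ (i,k)) = l k"
proof -
  have "quad_form n (conj_diag n U l) (\<lambda>i. U $$ (i,k))
      = (\<Sum>m<n. l m * (\<Sum>i<n. U $$ (i,k) * U $$ (i,m))\<^sup>2)"
    by (rule quad_form_conj_diag[OF orth_mat_carrier[OF U]])
  also have "\<dots> = (\<Sum>m<n. if m = k then l k else 0)"
    using orth_mat_cols[OF U k] by (intro sum.cong) auto
  also have "\<dots> = l k" using k by simp
  finally show ?thesis .
qed

lemma conj_diag_psd_iff:
  assumes U: "orth_mat n U"
  shows "conj_diag n U l \<in> psd_mats n \<longleftrightarrow> (\<forall>i<n. 0 \<le> l i)"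
proof
  assume "conj_diag n U l \<in> psd_mats n"
  then show "\<forall>i<n. 0 \<le> l i"
    using quad_form_conj_diag_col[OF U] by (metis psd_mats_quad_form)
next
  assume "\<forall>i<n. 0 \<le> l i"
  then show "conj_diag n U l \<in> psd_mats n"
    by (auto simp: psd_mats_quad_form conj_diag_sym[OF U] quad_form_conj_diag[OF orth_mat_carrier[OF U]]
        intro!: sum_nonneg)
qed

lemma orth_mat_col_sum_zero:
  assumes U: "orth_mat n U" and z: "\<And>k. k < n \<Longrightarrow> (\<Sum>i<n. f i * U $$ (i,k)) = 0" and j: "j < n"
  shows "f j = 0"
proof -
  have "0 = (\<Sum>k<n. (\<Sum>i<n. f i * U $$ (i,k)) * U $$ (j,k))" using z by simp
  also have "\<dots> = (\<Sum>i<n. f i * (\<Sum>k<n. U $$ (i,k) * U $$ (j,k)))"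
    unfolding sum_distrib_right sum_distrib_left by (subst sum.swap) (simp add: mult_ac)
  also have "\<dots> = (\<Sum>i<n. if i = j then f i else 0)"
    using orth_mat_rows[OF U _ j] by (intro sum.cong) auto
  also have "\<dots> = f j" using j by simp
  finally show ?thesis by simp
qed

lemma conj_diag_pd_iff:
  assumes U: "orth_mat n U"
  shows "conj_diag n U l \<in> pd_mats n \<longleftrightarrow> (\<forall>i<n. 0 < l i)"
proof
  assume A: "conj_diag n U l \<in> pd_mats n"
  show "\<forall>i<n. 0 < l i"
  proof (intro allI impI)
    fix k assume k: "k < n"
    have "\<exists>i<n. U $$ (i,k) \<noteq> 0"
    proof (rule ccontr)
      assume "\<not> ?thesis"
      then have "(\<Sum>i<n. U $$ (i,k) * U $$ (i,k)) = 0" by simp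
      with orth_mat_cols[OF U k k] show False by simp
    qed
    then have "0 < quad_form n (conj_diag n U l) (\<lambda>i. U $$ (i,k))"
      using A by (auto simp: pd_mats_quad_form)
    then show "0 < l k" using quad_form_conj_diag_col[OF U k] by simp
  qed
next
  assume l: "\<forall>i<n. 0 < l i"
  have "0 < quad_form n (conj_diag n U l) f" if f: "\<exists>i<n. f i \<noteq> 0" for f
  proof -
    obtain k where k: "k < n" "(\<Sum>i<n. f i * U $$ (i,k)) \<noteq> 0"
      using orth_mat_col_sum_zero[OF U] f by blast
    have "0 < (\<Sum>k<n. l k * (\<Sum>i<n. f i * U $$ (i,k))\<^sup>2)"
      by (rule sum_pos2[of _ k]) (use k l in \<open>auto intro: less_imp_le\<close>)
    then show ?thesis by (simp add: quad_form_conj_diag[OF orth_mat_carrier[OF U]])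
  qed
  then show "conj_diag n U l \<in> pd_mats n"
    by (simp add: pd_mats_quad_form conj_diag_sym[OF U])
qed

lemma conj_diag_add:
  assumes U: "orth_mat n U"
  shows "conj_diag n U a + conj_diag n U b = conj_diag n U (\<lambda>i. a i + b i)"
proof (rule eq_matI)
  note c = conj_diag_carrier[OF U, THEN carrier_matD(1)] conj_diag_carrier[OF U, THEN carrier_matD(2)]
  fix i j assume "i < dim_row (conj_diag n U (\<lambda>i. a i + b i))" "j < dim_col (conj_diag n U (\<lambda>i. a i + b i))"
  then show "(conj_diag n U a + conj_diag n U b) $$ (i,j) = conj_diag n U (\<lambda>i. a i + b i) $$ (i,j)"
    by (simp add: c conj_diag_index[OF orth_mat_carrier[OF U]] sum.distrib distrib_right)
qed (use conj_diag_carrier[OF U] in \<open>metis carrier_matD index_add_mat(2,3)\<close>)+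

lemma conj_diag_conj:
  assumes U: "U \<in> carrier_mat n n" and V: "V \<in> carrier_mat n n"
  shows "V * conj_diag n U l * V\<^sup>T = conj_diag n (V * U) l"
  unfolding conj_diag_def transpose_mult[OF V U]
  using U V mat_diag_dim[of n l] by (simp add: square_mult[where n = n])

lemma mat_inv_eqI:
  assumes A: "A \<in> carrier_mat n n" and B: "B \<in> carrier_mat n n" and AB: "A * B = 1\<^sub>m n"
  shows "mat_inv A = B"
proof -
  have BA: "B * A = 1\<^sub>m n" using mat_mult_left_right_inverse[OF A B AB] .
  have "A \<in> Units (ring_mat TYPE(real) n ())"
    unfolding Units_def ring_mat_def using A B AB BA by auto
  then obtain C where C: "mat_inverse A = Some C"
    using mat_inverse(1)[OF A, of "()"] by fastforce
  then have "A * C = 1\<^sub>m n" "C \<in> carrier_mat n n" using mat_inverse(2)[OF A C] by auto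
  then have "B = B * (A * C)" using B by simp
  also have "\<dots> = C" using A B BA \<open>C \<in> carrier_mat n n\<close> by (simp flip: assoc_mult_mat[of _ n n _ n _ n])
  finally show ?thesis by (simp add: mat_inv_def C)
qed

lemma mat_inv_conj_diag:
  assumes U: "orth_mat n U" and "\<And>i. i < n \<Longrightarrow> l i \<noteq> 0"
  shows "mat_inv (conj_diag n U l) = conj_diag n U (\<lambda>i. 1 / l i)"
proof (rule mat_inv_eqI)
  have "conj_diag n U l * conj_diag n U (\<lambda>i. 1 / l i) = conj_diag n U (\<lambda>_. 1)"
    unfolding conj_diag_mult[OF U] by (rule conj_diag_cong) (simp add: assms)
  then show "conj_diag n U l * conj_diag n U (\<lambda>i. 1 / l i) = 1\<^sub>m n" by (simp add: conj_diag_one[OF U])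
qed (use U in auto)

section \<open>The spectral theorem for real symmetric matrices\<close>

lemma mult_mat_vec_index:
  "A \<in> carrier_mat n n \<Longrightarrow> v \<in> carrier_vec n \<Longrightarrow> i < n \<Longrightarrow> (A *\<^sub>v v) $ i = (\<Sum>j<n. A $$ (i,j) * v $ j)"
  by (auto simp: scalar_prod_def atLeast0LessThan)

lemma eigenvalue_iff_sum:
  assumes A: "A \<in> carrier_mat n n"
  shows "eigenvalue A e \<longleftrightarrow> (\<exists>x. (\<exists>i<n. x i \<noteq> (0::real)) \<and> (\<forall>i<n. (\<Sum>j<n. A $$ (i,j) * x j) = e * x i))"
proof
  assume "eigenvalue A e"
  then obtain v where v: "v \<in> carrier_vec n" "v \<noteq> 0\<^sub>v n" "A *\<^sub>v v = e \<cdot>\<^sub>v v"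
    using A by (auto simp: eigenvalue_def eigenvector_def)
  have "(\<Sum>j<n. A $$ (i,j) * v $ j) = e * v $ i" if "i < n" for i
    using mult_mat_vec_index[OF A v(1) that] v that by simp
  moreover have "\<exists>i<n. v $ i \<noteq> 0"
    using v by (metis carrier_vecD eq_vecI index_zero_vec(1) index_zero_vec(2))
  ultimately show "\<exists>x. (\<exists>i<n. x i \<noteq> (0::real)) \<and> (\<forall>i<n. (\<Sum>j<n. A $$ (i,j) * x j) = e * x i)"
    by blast
next
  assume "\<exists>x. (\<exists>i<n. x i \<noteq> (0::real)) \<and> (\<forall>i<n. (\<Sum>j<n. A $$ (i,j) * x j) = e * x i)"
  then obtain x where x: "\<exists>i<n. x i \<noteq> 0" "\<forall>i<n. (\<Sum>j<n. A $$ (i,j) * x j) = e * x i" by blast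
  have "A *\<^sub>v vec n x = e \<cdot>\<^sub>v vec n x"
  proof (rule eq_vecI)
    fix i assume "i < dim_vec (e \<cdot>\<^sub>v vec n x)"
    then have i: "i < n" by simp
    then show "(A *\<^sub>v vec n x) $ i = (e \<cdot>\<^sub>v vec n x) $ i"
      using mult_mat_vec_index[OF A _ i, of "vec n x"] x(2) by simp
  qed (use A in auto)
  moreover have "vec n x \<noteq> 0\<^sub>v n" using x(1) by (metis index_vec index_zero_vec(1))
  ultimately show "eigenvalue A e"
    using A unfolding eigenvalue_def eigenvector_def by (metis carrier_matD(1) vec_carrier)
qed

text \<open>Split a complex eigenvector into its real and imaginary parts \<open>x\<close> and \<open>y\<close>: by symmetry the two
  ways of evaluating \<open>y\<^sup>T A x\<close> differ by \<open>Im z * (\<bar>x\<bar>\<^sup>2 + \<bar>y\<bar>\<^sup>2)\<close>, so the eigenvalue is real, and one of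
  \<open>x\<close>, \<open>y\<close> is a real eigenvector.\<close>

lemma sym_mat_spectrum_nonempty:
  assumes A: "A \<in> sym_mats n" and n: "n > 0"
  shows "spectrum A \<noteq> {}"
proof -
  let ?C = "map_mat complex_of_real A"
  have Ac: "A \<in> carrier_mat n n" using A by (rule sym_mats_carrier)
  then have C: "?C \<in> carrier_mat n n" by simp
  obtain z v where v: "v \<in> carrier_vec n" "v \<noteq> 0\<^sub>v n" "?C *\<^sub>v v = z \<cdot>\<^sub>v v"
    using spectrum_non_empty[OF C n] C unfolding spectrum_def eigenvalue_def eigenvector_def by auto
  define x y where "x i = Re (v $ i)" and "y i = Im (v $ i)" for i
  define a b where "a = Re z" and "b = Im z"
  have eq: "(\<Sum>j<n. complex_of_real (A $$ (i,j)) * v $ j) = z * v $ i" if "i < n" for i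
  proof -
    have "(?C *\<^sub>v v) $ i = (\<Sum>j<n. ?C $$ (i,j) * v $ j)"
      using v(1) that C by (intro mult_mat_vec_index) 
    also have "\<dots> = (\<Sum>j<n. complex_of_real (A $$ (i,j)) * v $ j)"
      using that Ac by auto
    finally show ?thesis using that v by simp
  qed
  have re: "(\<Sum>j<n. A $$ (i,j) * x j) = a * x i - b * y i" if "i < n" for i
    using arg_cong[OF eq[OF that], of Re] by (simp add: x_def y_def a_def b_def)
  have im: "(\<Sum>j<n. A $$ (i,j) * y j) = a * y i + b * x i" if "i < n" for i
    using arg_cong[OF eq[OF that], of Im] by (simp add: x_def y_def a_def b_def algebra_simps)
  have "(\<Sum>i<n. y i * (\<Sum>j<n. A $$ (i,j) * x j)) = (\<Sum>i<n. x i * (\<Sum>j<n. A $$ (i,j) * y j))"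
    unfolding sum_distrib_left
    by (subst sum.swap, intro sum.cong refl) (use sym_mats_entry[OF A] in \<open>auto simp: mult_ac\<close>)
  then have "(\<Sum>i<n. y i * (a * x i - b * y i)) = (\<Sum>i<n. x i * (a * y i + b * x i))"
    using re im by simp
  then have "(\<Sum>i<n. x i * (a * y i + b * x i) - y i * (a * x i - b * y i)) = 0"
    by (simp add: sum_subtractf)
  then have b0: "b * (\<Sum>i<n. (x i)\<^sup>2 + (y i)\<^sup>2) = 0"
    by (simp add: sum_distrib_left algebra_simps power2_eq_square)
  obtain k where k: "k < n" "v $ k \<noteq> 0"
    using v by (metis carrier_vecD eq_vecI index_zero_vec(1) index_zero_vec(2))
  then have k': "x k \<noteq> 0 \<or> y k \<noteq> 0" by (auto simp: x_def y_def complex_eq_iff)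
  have "0 < (\<Sum>i<n. (x i)\<^sup>2 + (y i)\<^sup>2)"
    by (rule sum_pos2[of _ k]) (use k k' in \<open>auto simp: sum_power2_gt_zero_iff\<close>)
  with b0 have b: "b = 0" by auto
  have "a \<in> spectrum A"
    unfolding spectrum_def mem_Collect_eq eigenvalue_iff_sum[OF Ac]
    using k' re im b k by (cases "x k = 0") auto
  then show ?thesis by blast
qed

text \<open>If \<open>v\<close> is a unit vector, the reflection in the hyperplane orthogonal to \<open>v - e\<^sub>0\<close> swaps \<open>v\<close> and
  \<open>e\<^sub>0\<close>. For \<open>v = e\<^sub>0\<close> the division by zero in the coefficient makes it the identity.\<close>

lemma orth_mat_with_first_col:
  assumes n: "n > 0" and v: "(\<Sum>i<n. (v i)\<^sup>2) = (1::real)"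
  obtains Q where "orth_mat n Q" "\<And>i. i < n \<Longrightarrow> Q $$ (i,0) = v i"
proof -
  define w where "w i = v i - (if i = 0 then 1 else 0)" for i :: nat
  define c where "c = 1 / (1 - v 0)"
  define Q where "Q = Matrix.mat n n (\<lambda>(i,j). (if i = j then 1 else 0) - c * w i * w j)"
  have Q: "Q \<in> carrier_mat n n" by (simp add: Q_def)
  have Qe: "Q $$ (i,j) = (if i = j then 1 else 0) - c * w i * w j" if "i < n" "j < n" for i j
    using that by (simp add: Q_def)
  have "(\<Sum>i<n. (w i)\<^sup>2) = (\<Sum>i<n. (v i)\<^sup>2 + (if i = 0 then 1 - 2 * v 0 else 0))"
    by (intro sum.cong) (auto simp: w_def power2_diff)
  then have w2: "(\<Sum>i<n. (w i)\<^sup>2) = 2 * (1 - v 0)"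
    using n v by (simp add: sum.distrib)
  have cw: "c * (c * (\<Sum>i<n. (w i)\<^sup>2)) = 2 * c"
  proof -
    have "1 / d * (1 / d * (2 * d)) = 2 * (1 / d)" for d :: real by (cases "d = 0") auto
    then show ?thesis unfolding w2 c_def .
  qed
  have "Q * Q\<^sup>T = 1\<^sub>m n"
  proof (rule eq_matI)
    fix i j assume "i < dim_row (1\<^sub>m n)" "j < dim_col (1\<^sub>m n)"
    then have ij: "i < n" "j < n" by auto
    have "(Q * Q\<^sup>T) $$ (i,j) = (\<Sum>k<n. Q $$ (i,k) * Q $$ (j,k))"
      using ij Q by (subst index_mult_mat_sum[of _ n n _ n]) auto
    also have "\<dots> = (\<Sum>k<n. (if k = i then (if i = j then 1 else 0) - c * w i * w j else 0)
        - (if k = j then c * w i * w j else 0) + w i * w j * (c * (c * (w k)\<^sup>2)))"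
      by (intro sum.cong refl) (use ij in \<open>auto simp: Qe algebra_simps power2_eq_square\<close>)
    also have "\<dots> = (if i = j then 1 else 0) - 2 * c * w i * w j + w i * w j * (c * (c * (\<Sum>k<n. (w k)\<^sup>2)))"
      using ij by (simp add: sum.distrib sum_subtractf sum_distrib_left)
    also have "\<dots> = 1\<^sub>m n $$ (i,j)" unfolding cw using ij by simp
    finally show "(Q * Q\<^sup>T) $$ (i,j) = 1\<^sub>m n $$ (i,j)" .
  qed (use Q in auto)
  then have orth: "orth_mat n Q"
    using Q mat_mult_left_right_inverse[OF Q _ ] by (simp add: orth_mat_def)
  have "Q $$ (i,0) = v i" if i: "i < n" for i
  proof (cases "v 0 = 1")
    case True
    then have "(\<Sum>i<n. (w i)\<^sup>2) = 0" using w2 by simp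
    then have "w i = 0" using i by (simp add: sum_nonneg_eq_0_iff)
    then show ?thesis using Qe[OF i n] by (auto simp: w_def)
  next
    case False
    then have cw0: "c * w 0 = -1" by (simp add: c_def w_def field_simps)
    have "Q $$ (i,0) = (if i = 0 then 1 else 0) - (c * w 0) * w i"
      using Qe[OF i n] by (simp only: mult_ac)
    then show ?thesis unfolding cw0 by (simp add: w_def)
  qed
  with orth show ?thesis by (rule that)
qed

lemma conj_diag_mult_col:
  assumes U: "orth_mat n U" and "i < n" "k < n"
  shows "(\<Sum>j<n. conj_diag n U l $$ (i,j) * U $$ (j,k)) = l k * U $$ (i,k)"
proof -
  have "(\<Sum>j<n. conj_diag n U l $$ (i,j) * U $$ (j,k))
      = (\<Sum>j<n. \<Sum>m<n. l m * U $$ (i,m) * (U $$ (j,m) * U $$ (j,k)))"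
    using assms by (simp add: conj_diag_index orth_mat_carrier sum_distrib_right mult.assoc)
  also have "\<dots> = (\<Sum>m<n. l m * U $$ (i,m) * (\<Sum>j<n. U $$ (j,m) * U $$ (j,k)))"
    by (subst sum.swap) (simp add: sum_distrib_left)
  also have "\<dots> = (\<Sum>m<n. if m = k then l k * U $$ (i,k) else 0)"
    using orth_mat_cols[OF U _ \<open>k < n\<close>] by (intro sum.cong) auto
  also have "\<dots> = l k * U $$ (i,k)" using \<open>k < n\<close> by simp
  finally show ?thesis .
qed

lemma spectrum_conj_diag:
  assumes U: "orth_mat n U"
  shows "spectrum (conj_diag n U l) = l ` {..<n}"
proof (intro subset_antisym subsetI)
  fix e assume "e \<in> spectrum (conj_diag n U l)"
  then obtain x where x: "\<exists>i<n. x i \<noteq> 0" "\<And>i. i < n \<Longrightarrow> (\<Sum>j<n. conj_diag n U l $$ (i,j) * x j) = e * x i"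
    unfolding spectrum_def using eigenvalue_iff_sum[OF conj_diag_carrier[OF U]] by blast
  obtain k where k: "k < n" "(\<Sum>i<n. x i * U $$ (i,k)) \<noteq> 0"
    using orth_mat_col_sum_zero[OF U] x(1) by blast
  have "e * (\<Sum>i<n. x i * U $$ (i,k)) = (\<Sum>i<n. (\<Sum>j<n. conj_diag n U l $$ (i,j) * x j) * U $$ (i,k))"
    using x(2) by (simp add: sum_distrib_left mult.assoc)
  also have "\<dots> = (\<Sum>j<n. x j * (\<Sum>i<n. conj_diag n U l $$ (j,i) * U $$ (i,k)))"
    unfolding sum_distrib_right sum_distrib_left
    by (subst sum.swap, intro sum.cong refl)
       (use sym_mats_entry[OF conj_diag_sym[OF U]] in \<open>auto simp: mult_ac\<close>)
  also have "\<dots> = l k * (\<Sum>i<n. x i * U $$ (i,k))"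
    by (subst sum_distrib_left, intro sum.cong refl) (simp add: conj_diag_mult_col[OF U _ k(1)] mult.left_commute)
  finally show "e \<in> l ` {..<n}" using k by auto
next
  fix e assume "e \<in> l ` {..<n}"
  then obtain k where k: "k < n" "e = l k" by auto
  have "\<exists>i<n. U $$ (i,k) \<noteq> 0"
  proof (rule ccontr)
    assume "\<not> ?thesis"
    then have "(\<Sum>i<n. U $$ (i,k) * U $$ (i,k)) = 0" by simp
    with orth_mat_cols[OF U k(1) k(1)] show False by simp
  qed
  then show "e \<in> spectrum (conj_diag n U l)"
    unfolding spectrum_def mem_Collect_eq eigenvalue_iff_sum[OF conj_diag_carrier[OF U]]
    using conj_diag_mult_col[OF U _ k(1)] k(2) by (intro exI[of _ "\<lambda>i. U $$ (i,k)"]) auto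
qed

text \<open>Deflation: a reflection moves a unit eigenvector for the largest eigenvalue to the first
  coordinate vector, which splits off a one-dimensional block, and the induction hypothesis handles
  the remaining block. Taking the largest eigenvalue first produces the decreasing order.\<close>

theorem sym_mat_decompose:
  assumes "A \<in> sym_mats n"
  shows "\<exists>U l. orth_mat n U \<and> A = conj_diag n U l \<and> (\<forall>i j. i \<le> j \<and> j < n \<longrightarrow> l j \<le> l i)"
  using assms
proof (induction n arbitrary: A)
  case 0
  have "A = conj_diag 0 (1\<^sub>m 0) (\<lambda>_. 0)"
    by (rule eq_matI) (use sym_mats_carrier[OF 0] in \<open>auto simp: conj_diag_one_mat\<close>)
  then show ?case using orth_mat_one by blast
next
  case (Suc n)
  let ?n = "Suc n"
  have A: "A \<in> carrier_mat ?n ?n" using Suc.prems by (rule sym_mats_carrier)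
  have fin: "finite (spectrum A)" "spectrum A \<noteq> {}"
    using card_finite_spectrum[OF A] sym_mat_spectrum_nonempty[OF Suc.prems] by auto
  define e where "e = Max (spectrum A)"
  have "e \<in> spectrum A" and emax: "\<And>e'. e' \<in> spectrum A \<Longrightarrow> e' \<le> e"
    using fin by (auto simp: e_def)
  then obtain x where x: "\<exists>i<?n. x i \<noteq> 0" "\<And>i. i < ?n \<Longrightarrow> (\<Sum>j<?n. A $$ (i,j) * x j) = e * x i"
    unfolding spectrum_def using eigenvalue_iff_sum[OF A] by blast
  define r where "r = sqrt (\<Sum>i<?n. (x i)\<^sup>2)"
  have rpos: "0 < (\<Sum>i<?n. (x i)\<^sup>2)"
  proof -
    obtain k where "k < ?n" "x k \<noteq> 0" using x(1) by blast
    then show ?thesis by (intro sum_pos2[of _ k]) auto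
  qed
  then have r: "r > 0" "r\<^sup>2 = (\<Sum>i<?n. (x i)\<^sup>2)" by (auto simp: r_def intro: less_imp_le)
  define v where "v i = x i / r" for i
  have "(\<Sum>i<?n. (v i)\<^sup>2) = (\<Sum>i<?n. (x i)\<^sup>2) / r\<^sup>2"
    by (simp only: v_def power_divide sum_divide_distrib)
  also have "\<dots> = 1" using r rpos by simp
  finally have "(\<Sum>i<?n. (v i)\<^sup>2) = 1" .
  then obtain Q where Q: "orth_mat ?n Q" "\<And>i. i < ?n \<Longrightarrow> Q $$ (i,0) = v i"
    using orth_mat_with_first_col[of ?n v] by blast
  have Av: "(\<Sum>j<?n. A $$ (i,j) * v j) = e * v i" if "i < ?n" for i
  proof -
    have "(\<Sum>j<?n. A $$ (i,j) * v j) = (\<Sum>j<?n. A $$ (i,j) * x j) / r"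
      by (simp only: v_def sum_divide_distrib times_divide_eq_right)
    then show ?thesis using x(2)[OF that] by (simp add: v_def)
  qed
  have Qc: "Q \<in> carrier_mat ?n ?n" "Q\<^sup>T \<in> carrier_mat ?n ?n" using Q(1) by (auto simp: orth_mat_def)
  define B where "B = Q\<^sup>T * (A * Q)"
  have Bc: "B \<in> carrier_mat ?n ?n" using A Qc by (simp add: B_def square_mult[where n = ?n])
  have Bsym: "B \<in> sym_mats ?n"
  proof -
    have AT: "A\<^sup>T = A" using Suc.prems by (simp add: sym_mats_def)
    have "B\<^sup>T = (A * Q)\<^sup>T * Q\<^sup>T\<^sup>T"
      unfolding B_def using A Qc by (intro transpose_mult[of _ ?n ?n _ ?n]) auto
    also have "\<dots> = B"
      using A Qc by (simp add: B_def transpose_mult[OF A Qc(1)] AT square_mult[where n = ?n])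
    finally have "B\<^sup>T = B" .
    with Bc show ?thesis by (simp add: sym_mats_def)
  qed
  have B0: "B $$ (i,0) = (if i = 0 then e else 0)" if i: "i < ?n" for i
  proof -
    have "B $$ (i,0) = (\<Sum>k<?n. Q\<^sup>T $$ (i,k) * (A * Q) $$ (k,0))"
      unfolding B_def using A Qc i by (intro index_mult_mat_sum) auto
    also have "\<dots> = (\<Sum>k<?n. Q $$ (k,i) * (e * v k))"
    proof (intro sum.cong refl)
      fix k assume "k \<in> {..<?n}"
      then have k: "k < ?n" by simp
      have "(A * Q) $$ (k,0) = (\<Sum>j<?n. A $$ (k,j) * Q $$ (j,0))"
        using A Qc k by (intro index_mult_mat_sum) auto
      also have "\<dots> = (\<Sum>j<?n. A $$ (k,j) * v j)" using Q(2) by (intro sum.cong) auto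
      finally show "Q\<^sup>T $$ (i,k) * (A * Q) $$ (k,0) = Q $$ (k,i) * (e * v k)"
        using Av[OF k] k i Qc(1) by simp
    qed
    also have "\<dots> = e * (\<Sum>k<?n. Q $$ (k,i) * Q $$ (k,0))"
      unfolding sum_distrib_left using Q(2) by (intro sum.cong) (auto simp: mult_ac)
    also have "\<dots> = (if i = 0 then e else 0)" using orth_mat_cols[OF Q(1) i, of 0] by simp
    finally show ?thesis .
  qed
  define A' where "A' = Matrix.mat n n (\<lambda>(i,j). B $$ (Suc i, Suc j))"
  have "A' \<in> sym_mats n"
    by (rule sym_matsI) (use sym_mats_entry[OF Bsym] in \<open>auto simp: A'_def\<close>)
  then obtain V m where V: "orth_mat n V" "A' = conj_diag n V m"
      and m: "\<And>i j. i \<le> j \<Longrightarrow> j < n \<Longrightarrow> m j \<le> m i"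
    using Suc.IH by meson
  define W where "W = Matrix.mat ?n ?n (\<lambda>(i,j). if i = 0 \<or> j = 0 then (if i = j then 1 else 0)
      else V $$ (i - 1, j - 1))"
  define l where "l i = (if i = 0 then e else m (i - 1))" for i
  have Wc: "W \<in> carrier_mat ?n ?n" by (simp add: W_def)
  have We: "W $$ (i,j) = (if i = 0 \<or> j = 0 then (if i = j then 1 else 0) else V $$ (i - 1, j - 1))"
    if "i < ?n" "j < ?n" for i j using that by (simp add: W_def)
  have "W * W\<^sup>T = 1\<^sub>m ?n"
  proof (rule eq_matI)
    fix i j assume "i < dim_row (1\<^sub>m ?n)" "j < dim_col (1\<^sub>m ?n)"
    then have ij: "i < ?n" "j < ?n" by auto
    have "(W * W\<^sup>T) $$ (i,j) = (\<Sum>k<?n. W $$ (i,k) * W $$ (j,k))"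
      using ij Wc by (subst index_mult_mat_sum[of _ ?n ?n _ ?n]) auto
    also have "\<dots> = 1\<^sub>m ?n $$ (i,j)"
      unfolding sum.lessThan_Suc_shift
      using ij orth_mat_rows[OF V(1), of "i - 1" "j - 1"] by (cases i; cases j) (auto simp: We)
    finally show "(W * W\<^sup>T) $$ (i,j) = 1\<^sub>m ?n $$ (i,j)" .
  qed (use Wc in auto)
  then have W: "orth_mat ?n W"
    using Wc mat_mult_left_right_inverse[OF Wc _] by (simp add: orth_mat_def)
  have "B = conj_diag ?n W l"
  proof (rule eq_matI)
    fix i j assume "i < dim_row (conj_diag ?n W l)" "j < dim_col (conj_diag ?n W l)"
    then have ij: "i < ?n" "j < ?n" using conj_diag_carrier[OF W, of l] by auto
    have V': "B $$ (Suc i, Suc j) = (\<Sum>k<n. m k * V $$ (i,k) * V $$ (j,k))" if "i < n" "j < n" for i j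
      using arg_cong[OF V(2), of "\<lambda>M. M $$ (i,j)"] that
      by (simp add: A'_def conj_diag_index orth_mat_carrier[OF V(1)])
    have "conj_diag ?n W l $$ (i,j) = (\<Sum>k<?n. l k * W $$ (i,k) * W $$ (j,k))"
      using ij by (simp add: conj_diag_index[OF Wc])
    also have "\<dots> = B $$ (i,j)"
      unfolding sum.lessThan_Suc_shift
      using ij B0 sym_mats_entry[OF Bsym, of 0 j] V'[of "i - 1" "j - 1"]
      by (cases i; cases j) (auto simp: We l_def)
    finally show "B $$ (i,j) = conj_diag ?n W l $$ (i,j)" by simp
  qed (use Bc conj_diag_carrier[OF W, of l] in auto)
  moreover have "A = Q * B * Q\<^sup>T"
  proof -
    have "Q * B * Q\<^sup>T = (Q * Q\<^sup>T) * A * (Q * Q\<^sup>T)"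
      unfolding B_def using A Qc by (simp add: square_mult[where n = ?n])
    then show ?thesis using Q(1) A by (simp add: orth_mat_def)
  qed
  ultimately have AU: "A = conj_diag ?n (Q * W) l" using conj_diag_conj[OF Wc Qc(1)] by simp
  have U: "orth_mat ?n (Q * W)" using orth_mat_mult[OF Q(1) W] .
  have "l j \<le> l i" if "i \<le> j" "j < ?n" for i j
  proof (cases "i = 0")
    case True
    have "l j \<in> spectrum A" unfolding AU spectrum_conj_diag[OF U] using that by auto
    then show ?thesis using emax True by (simp add: l_def)
  next
    case False
    then show ?thesis using m[of "i - 1" "j - 1"] that by (auto simp: l_def)
  qed
  with U AU show ?case by blast
qed

lemma psd_mat_decompose:
  assumes "A \<in> psd_mats n"
  obtains U l where "orth_mat n U" "A = conj_diag n U l" "\<And>i. i < n \<Longrightarrow> 0 \<le> l i"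
    "\<And>i j. i \<le> j \<Longrightarrow> j < n \<Longrightarrow> l j \<le> l i"
proof -
  obtain U l where U: "orth_mat n U" "A = conj_diag n U l" "\<And>i j. i \<le> j \<and> j < n \<longrightarrow> l j \<le> l i"
    using sym_mat_decompose[OF psd_mats_sym[OF assms]] by blast
  then show ?thesis using assms conj_diag_psd_iff[OF U(1)] by (intro that[of U l]) auto
qed

lemma pd_mat_decompose:
  assumes "A \<in> pd_mats n"
  obtains U l where "orth_mat n U" "A = conj_diag n U l" "\<And>i. i < n \<Longrightarrow> 0 < l i"
    "\<And>i j. i \<le> j \<Longrightarrow> j < n \<Longrightarrow> l j \<le> l i"
proof -
  obtain U l where U: "orth_mat n U" "A = conj_diag n U l" "\<And>i j. i \<le> j \<and> j < n \<longrightarrow> l j \<le> l i"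
    using sym_mat_decompose[OF pd_mats_sym[OF assms]] by blast
  then show ?thesis using assms conj_diag_pd_iff[OF U(1)] by (intro that[of U l]) auto
qed

lemma diagonal_mat_eq_mat_diag:
  assumes "L \<in> carrier_mat n n" "diagonal_mat L"
  shows "L = mat_diag n (\<lambda>i. L $$ (i,i))"
  using assms by (intro eq_matI) (auto simp: mat_diag_index diagonal_mat_def)

lemma ordered_eigendecompD:
  assumes "ordered_eigendecomp n A U L"
  shows "orth_mat n U" "A = conj_diag n U (\<lambda>i. L $$ (i,i))" "L = mat_diag n (\<lambda>i. L $$ (i,i))"
    "\<And>i j. i \<le> j \<Longrightarrow> j < n \<Longrightarrow> L $$ (j,j) \<le> L $$ (i,i)"
proof -
  show L: "L = mat_diag n (\<lambda>i. L $$ (i,i))"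
    using assms by (intro diagonal_mat_eq_mat_diag) (auto simp: ordered_eigendecomp_def)
  show "orth_mat n U"
    using assms by (auto simp: ordered_eigendecomp_def orth_mat_def inverts_mat_def)
  show "A = conj_diag n U (\<lambda>i. L $$ (i,i))"
    unfolding conj_diag_def L[symmetric] using assms by (simp add: ordered_eigendecomp_def)
  show "\<And>i j. i \<le> j \<Longrightarrow> j < n \<Longrightarrow> L $$ (j,j) \<le> L $$ (i,i)"
    using assms by (auto simp: ordered_eigendecomp_def)
qed

section \<open>Square roots and inverses\<close>

text \<open>The change of basis \<open>Q = U\<^sup>T V\<close> satisfies \<open>a\<^sub>i Q\<^sub>i\<^sub>j = Q\<^sub>i\<^sub>j b\<^sub>j\<close>, so \<open>a\<^sub>i = b\<^sub>j\<close> wherever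
  \<open>Q\<^sub>i\<^sub>j\<close> does not vanish, and the same identity holds for \<open>f (a\<^sub>i)\<close> and \<open>f (b\<^sub>j)\<close>: the functional
  calculus does not depend on the eigenbasis.\<close>

lemma conj_diag_calculus_unique:
  assumes U: "orth_mat n U" and V: "orth_mat n V" and eq: "conj_diag n U a = conj_diag n V b"
  shows "conj_diag n U (\<lambda>i. f (a i)) = conj_diag n V (\<lambda>i. f (b i))"
proof -
  have c: "U \<in> carrier_mat n n" "V \<in> carrier_mat n n" "U\<^sup>T \<in> carrier_mat n n" "V\<^sup>T \<in> carrier_mat n n"
    using U V by (auto simp: orth_mat_def)
  note u = U[unfolded orth_mat_def] V[unfolded orth_mat_def]
  note s = square_mult[where n = n]
  define Q where "Q = U\<^sup>T * V"
  have Q: "Q \<in> carrier_mat n n" using c by (simp add: Q_def s)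
  have "U\<^sup>T * (conj_diag n U a) * V = (U\<^sup>T * U) * mat_diag n a * Q"
    unfolding conj_diag_def Q_def using c by (simp add: s)
  moreover have "U\<^sup>T * (conj_diag n V b) * V = Q * mat_diag n b * (V\<^sup>T * V)"
    unfolding conj_diag_def Q_def using c by (simp add: s)
  ultimately have eq: "mat_diag n a * Q = Q * mat_diag n b"
    using eq u Q by (simp add: s left_mult_one_mat[of _ n n] right_mult_one_mat[of _ n n])
  have "a i * Q $$ (i,j) = Q $$ (i,j) * b j" if "i < n" "j < n" for i j
    using arg_cong[OF eq, of "\<lambda>M. M $$ (i,j)"] that
    by (simp add: mat_diag_mult_left[OF Q] mat_diag_mult_right[OF Q])
  then have "f (a i) * Q $$ (i,j) = Q $$ (i,j) * f (b j)" if "i < n" "j < n" for i j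
    using that by (cases "Q $$ (i,j) = 0") (auto, metis)
  then have eq': "mat_diag n (\<lambda>i. f (a i)) * Q = Q * mat_diag n (\<lambda>i. f (b i))"
    unfolding mat_diag_mult_left[OF Q] mat_diag_mult_right[OF Q] by (intro eq_matI) auto
  have "conj_diag n U (\<lambda>i. f (a i)) = U * mat_diag n (\<lambda>i. f (a i)) * U\<^sup>T * (V * V\<^sup>T)"
    unfolding conj_diag_def using u c by (simp add: s right_mult_one_mat[of _ n n])
  also have "\<dots> = U * (mat_diag n (\<lambda>i. f (a i)) * Q) * V\<^sup>T"
    unfolding Q_def using c by (simp add: s)
  also have "\<dots> = (U * U\<^sup>T) * V * mat_diag n (\<lambda>i. f (b i)) * V\<^sup>T"
    unfolding eq' unfolding Q_def using c by (simp add: s)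
  also have "\<dots> = conj_diag n V (\<lambda>i. f (b i))"
    unfolding conj_diag_def using u c by (simp add: s left_mult_one_mat[of _ n n])
  finally show ?thesis .
qed

lemma psd_root_unique:
  assumes B: "B \<in> psd_mats n" and U: "orth_mat n U" and eq: "B * B = conj_diag n U a"
  shows "B = conj_diag n U (\<lambda>i. sqrt (a i))"
proof -
  obtain V b where V: "orth_mat n V" "B = conj_diag n V b" "\<And>i. i < n \<Longrightarrow> 0 \<le> b i"
    using psd_mat_decompose[OF B] by blast
  have "conj_diag n V (\<lambda>i. b i * b i) = conj_diag n U a"
    using eq V conj_diag_mult by simp
  from conj_diag_calculus_unique[OF V(1) U this, of sqrt]
  have "conj_diag n V (\<lambda>i. sqrt (b i * b i)) = conj_diag n U (\<lambda>i. sqrt (a i))" .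
  moreover have "conj_diag n V (\<lambda>i. sqrt (b i * b i)) = B"
    unfolding V(2) by (rule conj_diag_cong) (simp add: V(3))
  ultimately show ?thesis by simp
qed

lemma psd_sqrt_conj_diag:
  assumes U: "orth_mat n U" and a: "\<And>i. i < n \<Longrightarrow> 0 \<le> a i"
  shows "psd_sqrt (conj_diag n U a) = conj_diag n U (\<lambda>i. sqrt (a i))"
proof -
  have dim: "dim_row (conj_diag n U a) = n" using conj_diag_carrier[OF U, of a] by simp
  show ?thesis unfolding psd_sqrt_def dim
  proof (rule the_equality)
    have "conj_diag n U (\<lambda>i. sqrt (a i) * sqrt (a i)) = conj_diag n U a"
      by (rule conj_diag_cong) (simp add: a)
    then show "conj_diag n U (\<lambda>i. sqrt (a i)) \<in> psd_mats n
        \<and> conj_diag n U (\<lambda>i. sqrt (a i)) * conj_diag n U (\<lambda>i. sqrt (a i)) = conj_diag n U a"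
      by (simp add: conj_diag_psd_iff[OF U] conj_diag_mult[OF U] a)
  qed (use psd_root_unique[OF _ U] in blast)
qed

lemma psd_sqrt_unique:
  assumes B: "B \<in> psd_mats n" and "B * B = A"
  shows "psd_sqrt A = B"
proof -
  obtain V b where V: "orth_mat n V" "B = conj_diag n V b" "\<And>i. i < n \<Longrightarrow> 0 \<le> b i"
    using psd_mat_decompose[OF B] by blast
  have "psd_sqrt A = conj_diag n V (\<lambda>i. sqrt (b i * b i))"
    unfolding assms(2)[symmetric] V(2) conj_diag_mult[OF V(1)]
    by (rule psd_sqrt_conj_diag[OF V(1)]) simp
  also have "\<dots> = B" unfolding V(2) by (rule conj_diag_cong) (simp add: V(3))
  finally show ?thesis .
qed

lemma psd_sqrt_psd:
  assumes "A \<in> psd_mats n"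
  shows "psd_sqrt A \<in> psd_mats n" "psd_sqrt A * psd_sqrt A = A"
proof -
  obtain U l where U: "orth_mat n U" "A = conj_diag n U l" "\<And>i. i < n \<Longrightarrow> 0 \<le> l i"
    using psd_mat_decompose[OF assms] by blast
  have root: "psd_sqrt A = conj_diag n U (\<lambda>i. sqrt (l i))"
    unfolding U(2) by (rule psd_sqrt_conj_diag[OF U(1) U(3)])
  show "psd_sqrt A \<in> psd_mats n" unfolding root by (simp add: conj_diag_psd_iff[OF U(1)] U(3))
  show "psd_sqrt A * psd_sqrt A = A"
    unfolding root conj_diag_mult[OF U(1)] by (subst U(2), rule conj_diag_cong) (simp add: U(3))
qed

lemma psd_sqrt_pd:
  assumes "A \<in> pd_mats n"
  shows "psd_sqrt A \<in> pd_mats n"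
proof -
  obtain U l where U: "orth_mat n U" "A = conj_diag n U l" "\<And>i. i < n \<Longrightarrow> 0 < l i"
    using pd_mat_decompose[OF assms] by blast
  have "psd_sqrt A = conj_diag n U (\<lambda>i. sqrt (l i))"
    unfolding U(2) by (rule psd_sqrt_conj_diag[OF U(1) less_imp_le[OF U(3)]])
  then show ?thesis by (simp add: conj_diag_pd_iff[OF U(1)] U(3))
qed

lemma mat_inv_pd:
  assumes "A \<in> pd_mats n"
  shows "mat_inv A \<in> pd_mats n" "A * mat_inv A = 1\<^sub>m n" "mat_inv A * A = 1\<^sub>m n"
proof -
  obtain U l where U: "orth_mat n U" "A = conj_diag n U l" "\<And>i. i < n \<Longrightarrow> 0 < l i"
    using pd_mat_decompose[OF assms] by blast
  have inv: "mat_inv A = conj_diag n U (\<lambda>i. 1 / l i)"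
    unfolding U(2) by (rule mat_inv_conj_diag[OF U(1)]) (use U(3) in force)
  show "mat_inv A \<in> pd_mats n" unfolding inv by (simp add: conj_diag_pd_iff[OF U(1)] U(3))
  have l0: "l i \<noteq> 0" if "i < n" for i using U(3)[OF that] by simp
  have "conj_diag n U (\<lambda>i. l i * (1 / l i)) = conj_diag n U (\<lambda>_. 1)"
    by (rule conj_diag_cong) (simp add: l0)
  then have one: "conj_diag n U (\<lambda>i. l i * (1 / l i)) = 1\<^sub>m n" by (simp add: conj_diag_one[OF U(1)])
  show "A * mat_inv A = 1\<^sub>m n" using one unfolding inv by (simp add: U(2) conj_diag_mult[OF U(1)])
  show "mat_inv A * A = 1\<^sub>m n"
    using one unfolding inv by (simp add: U(2) conj_diag_mult[OF U(1)] mult.commute)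
qed

lemma parseval:
  assumes U: "orth_mat n U"
  shows "(\<Sum>k<n. (\<Sum>i<n. f i * U $$ (i,k))\<^sup>2) = (\<Sum>i<n. (f i)\<^sup>2)"
proof -
  have "(\<Sum>k<n. (\<Sum>i<n. f i * U $$ (i,k))\<^sup>2) = quad_form n (conj_diag n U (\<lambda>_. 1)) f"
    by (simp add: quad_form_conj_diag[OF orth_mat_carrier[OF U]])
  also have "\<dots> = (\<Sum>i<n. \<Sum>j<n. if j = i then (f i)\<^sup>2 else 0)"
    unfolding conj_diag_one[OF U] quad_form_def
    by (intro sum.cong refl) (auto simp: power2_eq_square)
  finally show ?thesis by simp
qed

lemma pd_coercive:
  assumes "A \<in> pd_mats n"
  obtains s where "s > 0" "\<And>f. s * (\<Sum>i<n. (f i)\<^sup>2) \<le> quad_form n A f"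
proof -
  obtain U l where U: "orth_mat n U" "A = conj_diag n U l" "\<And>i. i < n \<Longrightarrow> 0 < l i"
    using pd_mat_decompose[OF assms] by blast
  define s where "s = Min (insert 1 (l ` {..<n}))"
  have "s \<le> l k" if "k < n" for k using that by (auto simp: s_def)
  then have "s * (\<Sum>k<n. (\<Sum>i<n. f i * U $$ (i,k))\<^sup>2) \<le> quad_form n A f" for f
    unfolding U(2) quad_form_conj_diag[OF orth_mat_carrier[OF U(1)]]
    by (subst sum_distrib_left) (intro sum_mono mult_right_mono; auto)
  then have "s * (\<Sum>i<n. (f i)\<^sup>2) \<le> quad_form n A f" for f
    by (simp only: parseval[OF U(1)])
  moreover have "s > 0" using U(3) by (auto simp: s_def)
  ultimately show ?thesis using that by blast
qed

lemma psd_conj: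
  assumes K: "K \<in> psd_mats n" and X: "X \<in> carrier_mat m n"
  shows "X * K * X\<^sup>T \<in> psd_mats m"
proof -
  have Kc: "K \<in> carrier_mat n n" and KT: "K\<^sup>T = K" using K by (auto simp: psd_mats_def sym_mats_def)
  have "(X * K * X\<^sup>T)\<^sup>T = X * (K\<^sup>T * X\<^sup>T)"
    using transpose_mult[of "X * K" m n "X\<^sup>T" m] transpose_mult[OF X Kc] X Kc by simp
  also have "\<dots> = X * K * X\<^sup>T" using X Kc KT by (simp add: assoc_mult_mat[of _ m n _ n _ m])
  finally have "X * K * X\<^sup>T \<in> sym_mats m" using X Kc by (auto simp: sym_mats_def)
  moreover have "0 \<le> scalar_prod v (X * K * X\<^sup>T *\<^sub>v v)" if v: "v \<in> carrier_vec m" for v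
  proof -
    have w: "X\<^sup>T *\<^sub>v v \<in> carrier_vec n" using X v by auto
    have "X * K * X\<^sup>T *\<^sub>v v = X *\<^sub>v (K *\<^sub>v (X\<^sup>T *\<^sub>v v))"
      using X Kc v by (simp add: assoc_mult_mat_vec[of _ m n _ m] assoc_mult_mat_vec[of _ m n _ n])
    also have "scalar_prod v \<dots> = scalar_prod (X\<^sup>T *\<^sub>v v) (K *\<^sub>v (X\<^sup>T *\<^sub>v v))"
      using transpose_vec_mult_scalar[OF X _ v, of "K *\<^sub>v (X\<^sup>T *\<^sub>v v)"] mult_mat_vec_carrier[OF Kc w] by simp
    finally have "scalar_prod v (X * K * X\<^sup>T *\<^sub>v v) = scalar_prod (X\<^sup>T *\<^sub>v v) (K *\<^sub>v (X\<^sup>T *\<^sub>v v))" .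
    then show ?thesis using K w by (simp add: psd_mats_def)
  qed
  ultimately show ?thesis by (simp add: psd_mats_def)
qed

lemma psd_one: "1\<^sub>m n \<in> psd_mats n"
  using conj_diag_psd_iff[OF orth_mat_one, of n "\<lambda>_. 1"] by (simp add: conj_diag_one_mat)

lemma psd_gram: "X \<in> carrier_mat m n \<Longrightarrow> X * X\<^sup>T \<in> psd_mats m"
  using psd_conj[OF psd_one, of X m n] by simp

lemma gram_eq_zero:
  assumes N: "N \<in> carrier_mat m n" and "N\<^sup>T * N = 0\<^sub>m n n"
  shows "N = (0\<^sub>m m n :: real mat)"
proof (rule eq_matI)
  fix i j assume "i < dim_row (0\<^sub>m m n :: real mat)" "j < dim_col (0\<^sub>m m n :: real mat)"
  then have ij: "i < m" "j < n" by auto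
  have "0 = (N\<^sup>T * N) $$ (j,j)" using assms ij by simp
  also have "\<dots> = (\<Sum>k<m. (N $$ (k,j))\<^sup>2)"
    using N ij by (subst index_mult_mat_sum[of _ n m _ n]) (auto simp: power2_eq_square)
  finally show "N $$ (i,j) = (0\<^sub>m m n :: real mat) $$ (i,j)"
    using ij by (auto simp: sum_nonneg_eq_0_iff)
qed (use N in auto)

lemma mat_assoc:
  fixes A B C :: "real mat"
  shows "dim_col A = dim_row B \<Longrightarrow> dim_col B = dim_row C \<Longrightarrow> A * B * C = A * (B * C)"
  by (rule assoc_mult_mat[of _ "dim_row A" "dim_row B" _ "dim_row C" _ "dim_col C"]) auto

text \<open>Swapping the factors of a Gram matrix preserves the nonzero eigenvalues, hence this trace. If
  \<open>C\<^sup>T C = U diag(l) U\<^sup>T\<close>, then \<open>C U diag(l)\<^sup>-\<^sup>1\<^sup>/\<^sup>2 U\<^sup>T C\<^sup>T\<close> is the root of \<open>C C\<^sup>T\<close>. The matrix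
  may be singular: division by zero drops the kernel of \<open>C\<close>, which \<open>C\<close> annihilates anyway.\<close>

lemma tr_psd_sqrt_gram:
  assumes C: "C \<in> carrier_mat m n"
  shows "tr (psd_sqrt (C\<^sup>T * C)) = tr (psd_sqrt (C * C\<^sup>T))"
proof -
  have "C\<^sup>T * C \<in> psd_mats n" using psd_gram[of "C\<^sup>T" n m] C by simp
  then obtain U l where U: "orth_mat n U" "C\<^sup>T * C = conj_diag n U l" "\<And>i. i < n \<Longrightarrow> 0 \<le> l i"
    by (rule psd_mat_decompose) (rule that)
  define K where "K = conj_diag n U (\<lambda>i. 1 / sqrt (l i))"
  define P where "P = conj_diag n U (\<lambda>i. if l i = 0 then 0 else 1)"
  define T where "T = C * K * C\<^sup>T"
  have Kc: "K \<in> carrier_mat n n" and Pc: "P \<in> carrier_mat n n" by (simp_all add: K_def P_def U(1))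
  have Tpsd: "T \<in> psd_mats m" unfolding T_def
    by (rule psd_conj[OF _ C]) (simp add: K_def conj_diag_psd_iff[OF U(1)] U(3))
  have KCK: "K * (C\<^sup>T * C) * K = P"
    unfolding U(2) K_def P_def conj_diag_mult[OF U(1)]
    by (rule conj_diag_cong) (use U(3) in \<open>auto simp flip: real_sqrt_mult\<close>)
  \<comment> \<open>\<open>P\<close> projects to the orthogonal complement of the kernel of \<open>C\<close>, and \<open>Z\<close> to the kernel\<close>
  have CP: "C * P = C"
  proof -
    define Z where "Z = conj_diag n U (\<lambda>i. if l i = 0 then 1 else 0)"
    have Z: "Z \<in> carrier_mat n n" "Z\<^sup>T = Z"
      using conj_diag_sym[OF U(1)] by (auto simp: Z_def sym_mats_def)
    have "conj_diag n U (\<lambda>i. (if l i = 0 then 0 else 1) + (if l i = 0 then 1 else 0)) = conj_diag n U (\<lambda>_. 1)"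
      by (rule conj_diag_cong) simp
    then have PZ: "P + Z = 1\<^sub>m n"
      by (simp add: P_def Z_def conj_diag_add[OF U(1)] conj_diag_one[OF U(1)])
    have "(C * Z)\<^sup>T * (C * Z) = Z * (C\<^sup>T * C) * Z"
      unfolding transpose_mult[OF C Z(1)] Z(2) using carrier_matD[OF C] carrier_matD[OF Z(1)]
      by (simp add: mat_assoc)
    also have "\<dots> = conj_diag n U (\<lambda>_. 0)"
      unfolding Z_def U(2) conj_diag_mult[OF U(1)] by (rule conj_diag_cong) auto
    also have "\<dots> = 0\<^sub>m n n"
      by (rule eq_matI) (use conj_diag_carrier[OF U(1)] in \<open>auto simp: conj_diag_index orth_mat_carrier[OF U(1)]\<close>)
    finally have zero: "(C * Z)\<^sup>T * (C * Z) = 0\<^sub>m n n" .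
    have "C * Z = 0\<^sub>m m n" by (rule gram_eq_zero[OF mult_carrier_mat[OF C Z(1)] zero])
    moreover have "C = C * P + C * Z"
      using C mult_add_distrib_mat[OF C Pc Z(1)] by (simp add: PZ)
    ultimately show ?thesis using C Pc by simp
  qed
  have "T * T = C * (K * (C\<^sup>T * C) * K) * C\<^sup>T"
    unfolding T_def using carrier_matD[OF C] carrier_matD[OF Kc] by (simp add: mat_assoc)
  also have "\<dots> = C * C\<^sup>T" unfolding KCK CP ..
  finally have "psd_sqrt (C * C\<^sup>T) = T" by (rule psd_sqrt_unique[OF Tpsd])
  moreover have "tr T = tr (K * (C\<^sup>T * C))"
  proof -
    have "tr T = tr (C\<^sup>T * (C * K))" unfolding T_def using C Kc by (intro tr_mult_comm[of _ m n]) auto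
    also have "C\<^sup>T * (C * K) = C\<^sup>T * C * K" using C Kc by (simp add: assoc_mult_mat[of _ n m _ n _ n])
    also have "tr \<dots> = tr (K * (C\<^sup>T * C))" using C Kc by (intro tr_mult_comm[of _ n n]) auto
    finally show ?thesis .
  qed
  moreover have "K * (C\<^sup>T * C) = conj_diag n U (\<lambda>i. sqrt (l i))"
    unfolding U(2) K_def conj_diag_mult[OF U(1)]
    by (rule conj_diag_cong) (use U(3) in \<open>simp add: real_div_sqrt\<close>)
  ultimately show ?thesis unfolding U(2) by (simp add: psd_sqrt_conj_diag[OF U(1) U(3)])
qed

section \<open>Majorisation\<close>

lemma bessel_coordinate:
  fixes e :: "nat \<Rightarrow> nat \<Rightarrow> real"
  assumes on: "\<And>j k. j < m \<Longrightarrow> k < m \<Longrightarrow> (\<Sum>i<d. e j i * e k i) = (if j = k then 1 else 0)"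
    and i: "i < d"
  shows "(\<Sum>j<m. (e j i)\<^sup>2) \<le> 1"
proof -
  define s where "s = (\<Sum>j<m. (e j i)\<^sup>2)"
  \<comment> \<open>the orthogonal projection of the coordinate vector \<open>i\<close> to the span of the \<open>e j\<close>\<close>
  define P where "P l = (\<Sum>j<m. e j i * e j l)" for l
  have "(\<Sum>l<d. (P l)\<^sup>2) = (\<Sum>l<d. \<Sum>j<m. \<Sum>k<m. e j i * e k i * (e j l * e k l))"
    by (simp add: P_def power2_eq_square sum_product mult_ac)
  also have "\<dots> = (\<Sum>j<m. \<Sum>l<d. \<Sum>k<m. e j i * e k i * (e j l * e k l))"
    by (rule sum.swap)
  also have "\<dots> = (\<Sum>j<m. \<Sum>k<m. \<Sum>l<d. e j i * e k i * (e j l * e k l))"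
    by (intro sum.cong refl sum.swap)
  also have "\<dots> = (\<Sum>j<m. \<Sum>k<m. e j i * e k i * (if j = k then 1 else 0))"
    using on by (intro sum.cong refl) (simp flip: sum_distrib_left)
  also have "\<dots> = (\<Sum>j<m. \<Sum>k<m. if k = j then (e j i)\<^sup>2 else 0)"
    by (intro sum.cong refl) (auto simp: power2_eq_square)
  also have "\<dots> = s" by (simp add: s_def)
  finally have "(\<Sum>l<d. (P l)\<^sup>2) = s" .
  moreover have "(P i)\<^sup>2 \<le> (\<Sum>l<d. (P l)\<^sup>2)"
    using i by (intro member_le_sum) auto
  moreover have "P i = s" by (simp add: P_def s_def power2_eq_square)
  ultimately have "s * s \<le> s" by (simp add: power2_eq_square)
  moreover have "s \<ge> 0" by (simp add: s_def sum_nonneg)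
  ultimately have "s \<le> 1"
    using mult_right_le_imp_le[of s s 1] by (cases "s = 0") auto
  then show ?thesis by (simp add: s_def)
qed

text \<open>The best way to spend a total weight of at most \<open>k\<close>, with no more than 1 on each value, is on the
  first \<open>k\<close> values: the summands \<open>(w j - [j < k]) * (f j - f k)\<close> are all nonpositive. The condition on the
  total weight allows it to be exactly \<open>k\<close>, or at most \<open>k\<close> if \<open>f k \<ge> 0\<close>.\<close>

lemma weighted_sum_le_top_sum:
  fixes f w :: "nat \<Rightarrow> real"
  assumes dec: "\<And>i j. i \<le> j \<Longrightarrow> j < n \<Longrightarrow> f j \<le> f i" and k: "k < n"
    and w: "\<And>j. j < n \<Longrightarrow> 0 \<le> w j" "\<And>j. j < n \<Longrightarrow> w j \<le> 1"
    and W: "f k * (\<Sum>j<n. w j) \<le> f k * k"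
  shows "(\<Sum>j<n. w j * f j) \<le> (\<Sum>j<k. f j)"
proof -
  let ?b = "\<lambda>j. if j < k then 1 else 0 :: real"
  have set: "{j. j < n \<and> j < k} = {..<k}" using k by auto
  have "(\<Sum>j<n. (w j - ?b j) * (f j - f k)) \<le> 0"
  proof (intro sum_nonpos)
    fix j assume "j \<in> {..<n}"
    then show "(w j - ?b j) * (f j - f k) \<le> 0"
      using dec[of j k] dec[of k j] w[of j] k
      by (cases "j < k") (auto simp: mult_le_0_iff)
  qed
  moreover have "(\<Sum>j<n. (w j - ?b j) * (f j - f k))
      = (\<Sum>j<n. w j * f j) - (\<Sum>j<n. ?b j * f j) - f k * (\<Sum>j<n. w j) + f k * (\<Sum>j<n. ?b j)"
    by (simp add: algebra_simps sum.distrib sum_subtractf sum_distrib_left)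
  moreover have "(\<Sum>j<n. ?b j * f j) = (\<Sum>j<k. f j)"
    using k by (intro sum.mono_neutral_cong_right) auto
  moreover have "(\<Sum>j<n. ?b j) = (\<Sum>j<k. 1)"
    using k by (intro sum.mono_neutral_cong_right) auto
  ultimately show ?thesis using W by simp
qed

text \<open>Ky Fan's inequality: the rows \<open>z j / sqrt (a j)\<close> are orthonormal, so the mass that they carry in
  the first \<open>k\<close> coordinates is at most 1 for each row and, by Bessel's inequality, at most \<open>k\<close> in
  total.\<close>

lemma orthogonal_rows_mass_le:
  fixes z :: "nat \<Rightarrow> nat \<Rightarrow> real"
  assumes orth: "\<And>j l. j < m \<Longrightarrow> l < m \<Longrightarrow> (\<Sum>i<d. z j i * z l i) = (if j = l then a j else 0)"
    and pos: "\<And>j. j < m \<Longrightarrow> 0 < a j"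
    and dec: "\<And>i j. i \<le> j \<Longrightarrow> j < m \<Longrightarrow> a j \<le> a i"
    and k: "k \<le> d"
  shows "(\<Sum>i<k. \<Sum>j<m. (z j i)\<^sup>2) \<le> (\<Sum>j<k. if j < m then a j else 0)"
proof -
  define e where "e j i = z j i / sqrt (a j)" for j i
  have on: "(\<Sum>i<d. e j i * e l i) = (if j = l then 1 else 0)" if "j < m" "l < m" for j l
  proof -
    have "(\<Sum>i<d. e j i * e l i) = (\<Sum>i<d. z j i * z l i) / (sqrt (a j) * sqrt (a l))"
      by (simp add: e_def sum_divide_distrib)
    then show ?thesis using orth[OF that] pos[OF that(1)] by (cases "j = l") auto
  qed
  define w where "w j = (\<Sum>i<k. (e j i)\<^sup>2)" for j
  have w0: "0 \<le> w j" for j by (simp add: w_def sum_nonneg)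
  have w1: "w j \<le> 1" if "j < m" for j
  proof -
    have "w j \<le> (\<Sum>i<d. (e j i)\<^sup>2)" unfolding w_def using k by (intro sum_mono2) auto
    then show ?thesis using on[OF that that] by (simp add: power2_eq_square)
  qed
  have wk: "(\<Sum>j<m. w j) \<le> k"
  proof -
    have "(\<Sum>j<m. w j) = (\<Sum>i<k. \<Sum>j<m. (e j i)\<^sup>2)" unfolding w_def by (rule sum.swap)
    also have "\<dots> \<le> (\<Sum>i<k. 1)"
      using k on by (intro sum_mono bessel_coordinate[where d = d]) auto
    finally show ?thesis by simp
  qed
  have "(\<Sum>i<k. \<Sum>j<m. (z j i)\<^sup>2) = (\<Sum>j<m. \<Sum>i<k. (e j i)\<^sup>2 * a j)"
    by (subst sum.swap, intro sum.cong refl) (use pos in \<open>fastforce simp: e_def power_divide\<close>)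
  also have "\<dots> = (\<Sum>j<m. w j * a j)" by (simp add: w_def sum_distrib_right)
  also have "\<dots> \<le> (\<Sum>j<k. if j < m then a j else 0)"
  proof (cases "k < m")
    case True
    have "a k * (\<Sum>j<m. w j) \<le> a k * k" using wk pos[OF True] by (intro mult_left_mono) auto
    then have "(\<Sum>j<m. w j * a j) \<le> (\<Sum>j<k. a j)"
      using dec w0 w1 True by (intro weighted_sum_le_top_sum) auto
    then show ?thesis using True by simp
  next
    case False
    have "(\<Sum>j<m. w j * a j) \<le> (\<Sum>j<m. a j)"
    proof (rule sum_mono)
      fix j assume "j \<in> {..<m}"
      then show "w j * a j \<le> a j" using w1 pos[of j] by (auto intro: mult_left_le_one_le[OF _ w0] less_imp_le)
    qed
    also have "\<dots> = (\<Sum>j<k. if j < m then a j else 0)"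
      using False by (intro sum.mono_neutral_cong_left) auto
    finally show ?thesis .
  qed
  finally show ?thesis .
qed

text \<open>Summation by parts: the partial sums of \<open>h i * s i\<close> are nonpositive and the weights \<open>1 / h i\<close> increase.
  The product form of the bound avoids dividing by \<open>h\<close>, which may vanish.\<close>

lemma abel_sum_bound:
  fixes h s :: "nat \<Rightarrow> real"
  assumes dec: "\<And>i j. i \<le> j \<Longrightarrow> j \<le> n \<Longrightarrow> h j \<le> h i"
    and h: "\<And>i. i \<le> n \<Longrightarrow> 0 \<le> h i"
    and part: "\<And>k. k \<le> n \<Longrightarrow> (\<Sum>i<k. h i * s i) \<le> 0"
  shows "(\<Sum>i<Suc n. h i * s i) \<le> h n * (\<Sum>i<Suc n. s i)"
  using assms
proof (induction n)
  case 0
  then show ?case by simp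
next
  case (Suc n)
  have IH: "(\<Sum>i<Suc n. h i * s i) \<le> h n * (\<Sum>i<Suc n. s i)"
    using Suc by simp
  have "(\<Sum>i<Suc n. h i * s i) \<le> h (Suc n) * (\<Sum>i<Suc n. s i)"
  proof (cases "0 \<le> (\<Sum>i<Suc n. s i)")
    case True
    then have "0 \<le> h (Suc n) * (\<Sum>i<Suc n. s i)" using Suc.prems(2)[of "Suc n"] by simp
    then show ?thesis using Suc.prems(3)[of "Suc n"] by linarith
  next
    case False
    then have "h n * (\<Sum>i<Suc n. s i) \<le> h (Suc n) * (\<Sum>i<Suc n. s i)"
      using Suc.prems(1)[of n "Suc n"] by (intro mult_right_mono_neg) auto
    then show ?thesis using IH by linarith
  qed
  then show ?case by (simp add: algebra_simps)
qed

text \<open>Concavity of the square root, in the form that \<open>(x i - y i) / (sqrt (x i) - sqrt (y i))\<close> is the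
  decreasing sequence \<open>h i = sqrt (x i) + sqrt (y i)\<close>, so that summation by parts applies. If \<open>h n\<close> vanishes, the
  last entries of both sequences are zero and can be dropped.\<close>

lemma sum_sqrt_le_of_majorized:
  fixes x y :: "nat \<Rightarrow> real"
  assumes "\<And>i j. i \<le> j \<Longrightarrow> j < n \<Longrightarrow> x j \<le> x i" "\<And>i j. i \<le> j \<Longrightarrow> j < n \<Longrightarrow> y j \<le> y i"
    and "\<And>i. i < n \<Longrightarrow> 0 \<le> x i" "\<And>i. i < n \<Longrightarrow> 0 \<le> y i"
    and "\<And>k. k \<le> n \<Longrightarrow> (\<Sum>i<k. x i) \<le> (\<Sum>i<k. y i)"
    and "(\<Sum>i<n. x i) = (\<Sum>i<n. y i)"
  shows "(\<Sum>i<n. sqrt (y i)) \<le> (\<Sum>i<n. sqrt (x i))"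
  using assms
proof (induction n)
  case (Suc n)
  define h s where "h i = sqrt (x i) + sqrt (y i)" and "s i = sqrt (x i) - sqrt (y i)" for i
  have hs: "h i * s i = x i - y i" if "i < Suc n" for i
    using Suc.prems(3,4)[OF that] by (simp add: h_def s_def algebra_simps)
  have hs_sum: "(\<Sum>i<k. h i * s i) = (\<Sum>i<k. x i) - (\<Sum>i<k. y i)" if "k \<le> Suc n" for k
    unfolding sum_subtractf[symmetric] using that by (intro sum.cong) (auto simp: hs)
  have h0: "0 \<le> h i" if "i \<le> n" for i using Suc.prems(3,4)[of i] that by (simp add: h_def)
  have "(\<Sum>i<Suc n. h i * s i) \<le> h n * (\<Sum>i<Suc n. s i)"
  proof (rule abel_sum_bound)
    show "h j \<le> h i" if "i \<le> j" "j \<le> n" for i j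
      unfolding h_def using Suc.prems(1,2)[of i j] that by (intro add_mono real_sqrt_le_mono) auto
    show "(\<Sum>i<k. h i * s i) \<le> 0" if "k \<le> n" for k
      using that Suc.prems(5)[of k] by (simp add: hs_sum)
  qed (rule h0)
  then have key: "0 \<le> h n * (\<Sum>i<Suc n. s i)" using hs_sum[of "Suc n"] Suc.prems(6) by simp
  show ?case
  proof (cases "h n = 0")
    case False
    then have "0 \<le> (\<Sum>i<Suc n. s i)" using key h0[of n] by (simp add: zero_le_mult_iff)
    then show ?thesis by (simp add: s_def sum_subtractf)
  next
    case True
    then have "sqrt (x n) = 0 \<and> sqrt (y n) = 0"
      using Suc.prems(3,4)[of n] by (simp add: h_def add_nonneg_eq_0_iff)
    then have "x n = 0" "y n = 0" by auto
    moreover have "(\<Sum>i<n. sqrt (y i)) \<le> (\<Sum>i<n. sqrt (x i))"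
      using Suc.prems calculation by (intro Suc.IH) auto
    ultimately show ?thesis by simp
  qed
qed simp

section \<open>Block matrices\<close>

lemma ul_block_carrier: "ul_block p A \<in> carrier_mat p p"
  by (simp add: ul_block_def split_block_def Let_def)

lemma lr_block_carrier: "A \<in> carrier_mat (p + q) (p + q) \<Longrightarrow> lr_block p A \<in> carrier_mat q q"
  by (auto simp: lr_block_def split_block_def Let_def)

lemma ul_block_index: "i < p \<Longrightarrow> j < p \<Longrightarrow> ul_block p A $$ (i,j) = A $$ (i,j)"
  by (simp add: ul_block_def split_block_def Let_def)

lemma lr_block_index:
  "A \<in> carrier_mat (p + q) (p + q) \<Longrightarrow> i < q \<Longrightarrow> j < q \<Longrightarrow> lr_block p A $$ (i,j) = A $$ (p + i, p + j)"
  by (auto simp: lr_block_def split_block_def Let_def add.commute)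

lemma block_diag_carrier:
  "A \<in> carrier_mat p p \<Longrightarrow> B \<in> carrier_mat q q \<Longrightarrow> block_diag A B \<in> carrier_mat (p + q) (p + q)"
  by (simp add: block_diag_def)

lemma block_diag_index:
  assumes "A \<in> carrier_mat p p" "B \<in> carrier_mat q q" "i < p + q" "j < p + q"
  shows "block_diag A B $$ (i,j) = (if i < p \<and> j < p then A $$ (i,j)
    else if p \<le> i \<and> p \<le> j then B $$ (i - p, j - p) else 0)"
  using assms by (auto simp: block_diag_def)

lemma block_diag_mult:
  assumes "A \<in> carrier_mat p p" "B \<in> carrier_mat q q" "A' \<in> carrier_mat p p" "B' \<in> carrier_mat q q"
  shows "block_diag A B * block_diag A' B' = block_diag (A * A') (B * B')"
  unfolding block_diag_def
  using assms by (subst mult_four_block_mat[of _ p p _ q _ q _ _ p _ q]) auto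

lemma block_diag_transpose:
  assumes "A \<in> carrier_mat p p" "B \<in> carrier_mat q q"
  shows "(block_diag A B)\<^sup>T = block_diag A\<^sup>T B\<^sup>T"
  unfolding block_diag_def
  using assms by (subst transpose_four_block_mat[of _ p p _ q _ q]) auto

lemma block_diag_one: "block_diag (1\<^sub>m p) (1\<^sub>m q) = 1\<^sub>m (p + q)"
  by (rule eq_matI) (auto simp: block_diag_def)

lemma orth_mat_block_diag:
  assumes "orth_mat p U" "orth_mat q V"
  shows "orth_mat (p + q) (block_diag U V)"
  using assms
  by (simp add: orth_mat_def block_diag_carrier block_diag_transpose[where p = p and q = q]
      block_diag_mult[where p = p and q = q] block_diag_one)

definition join_at :: "nat \<Rightarrow> (nat \<Rightarrow> real) \<Rightarrow> (nat \<Rightarrow> real) \<Rightarrow> nat \<Rightarrow> real" where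
  "join_at p a b i = (if i < p then a i else b (i - p))"

lemma block_diag_mat_diag: "block_diag (mat_diag p a) (mat_diag q b) = mat_diag (p + q) (join_at p a b)"
  by (rule eq_matI) (auto simp: block_diag_def mat_diag_index join_at_def)

lemma block_diag_conj_diag:
  assumes "orth_mat p U" "orth_mat q V"
  shows "block_diag (conj_diag p U a) (conj_diag q V b) = conj_diag (p + q) (block_diag U V) (join_at p a b)"
  unfolding conj_diag_def block_diag_mat_diag[symmetric]
  using assms mat_diag_dim[of p a] mat_diag_dim[of q b]
  by (simp add: orth_mat_def block_diag_transpose[where p = p and q = q]
      block_diag_mult[where p = p and q = q] square_mult[where n = p] square_mult[where n = q])

lemma sum_split_add: "(\<Sum>i<p + q. f i) = (\<Sum>i<p. f i) + (\<Sum>i<q. f (p + i))" for f :: "nat \<Rightarrow> real"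
  by (induction q) auto

lemma tr_blocks:
  assumes "A \<in> carrier_mat (p + q) (p + q)"
  shows "tr A = tr (ul_block p A) + tr (lr_block p A)"
  using assms
  by (simp add: tr_carrier[OF assms] tr_carrier[OF ul_block_carrier] tr_carrier[OF lr_block_carrier]
      sum_split_add ul_block_index lr_block_index)

lemma mat_from_blocks:
  assumes "A \<in> carrier_mat (p + q) (p + q)"
  obtains B C where "B \<in> carrier_mat p q" "C \<in> carrier_mat q p"
    "A = four_block_mat (ul_block p A) B C (lr_block p A)"
proof -
  obtain A1 B C A2 where s: "split_block A p p = (A1, B, C, A2)" by (metis prod_cases4)
  then have "A1 = ul_block p A" "A2 = lr_block p A" by (simp_all add: ul_block_def lr_block_def)
  then show ?thesis using split_block[OF s, of q q] assms that by auto
qed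

lemma blocks_of_four_block:
  assumes "A \<in> carrier_mat p p" "B \<in> carrier_mat p q" "C \<in> carrier_mat q p" "D \<in> carrier_mat q q"
  shows "ul_block p (four_block_mat A B C D) = A" "lr_block p (four_block_mat A B C D) = D"
  using assms by (auto simp: ul_block_def lr_block_def split_block_def Let_def intro!: eq_matI)

lemma blocks_of_block_diag:
  assumes "A \<in> carrier_mat p p" "D \<in> carrier_mat q q"
  shows "ul_block p (block_diag A D) = A" "lr_block p (block_diag A D) = D"
  unfolding block_diag_def using assms by (auto intro!: blocks_of_four_block)

lemma blocks_of_conj:
  assumes A: "A \<in> carrier_mat (p + q) (p + q)"
    and "U \<in> carrier_mat p p" "V \<in> carrier_mat q q" "U' \<in> carrier_mat p p" "V' \<in> carrier_mat q q"
  shows "ul_block p (block_diag U V * A * block_diag U' V') = U * ul_block p A * U'"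
    "lr_block p (block_diag U V * A * block_diag U' V') = V * lr_block p A * V'"
proof -
  obtain B C where BC: "B \<in> carrier_mat p q" "C \<in> carrier_mat q p"
      and Aeq: "A = four_block_mat (ul_block p A) B C (lr_block p A)"
    using mat_from_blocks[OF A] .
  note c = assms(2-) BC ul_block_carrier[of p A] lr_block_carrier[OF A]
  have "block_diag U V * A * block_diag U' V' = four_block_mat (U * ul_block p A * U') (U * B * V')
      (V * C * U') (V * lr_block p A * V')"
    unfolding block_diag_def
    apply (subst Aeq)
    apply (subst mult_four_block_mat[of _ p p _ q _ q _ _ p _ q])
    using c apply auto[8]
    apply (subst mult_four_block_mat[of _ p p _ q _ q _ _ p _ q])
    using c by auto
  then show "ul_block p (block_diag U V * A * block_diag U' V') = U * ul_block p A * U'"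
    "lr_block p (block_diag U V * A * block_diag U' V') = V * lr_block p A * V'"
    using c by (auto intro!: blocks_of_four_block)
qed

lemma blocks_psd_pd:
  assumes c: "A \<in> carrier_mat (p + q) (p + q)"
  shows "A \<in> pd_mats (p + q) \<Longrightarrow> ul_block p A \<in> pd_mats p"
    "A \<in> pd_mats (p + q) \<Longrightarrow> lr_block p A \<in> pd_mats q"
proof -
  assume A: "A \<in> pd_mats (p + q)"
  note sym = sym_mats_entry[OF pd_mats_sym[OF A]]
  show "ul_block p A \<in> pd_mats p" unfolding pd_mats_quad_form
  proof (intro conjI allI impI)
    show "ul_block p A \<in> sym_mats p"
      by (rule sym_matsI[OF ul_block_carrier]) (simp add: ul_block_index sym)
    fix f :: "nat \<Rightarrow> real" assume f: "\<exists>i<p. f i \<noteq> 0"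
    then obtain i where "i < p" "f i \<noteq> 0" by blast
    then have "\<exists>i<p + q. join_at p f (\<lambda>_. 0) i \<noteq> 0"
      by (intro exI[of _ i]) (simp add: join_at_def)
    then have "0 < quad_form (p + q) A (join_at p f (\<lambda>_. 0))"
      using A unfolding pd_mats_quad_form by blast
    also have "\<dots> = quad_form p (ul_block p A) f"
      by (simp add: quad_form_def sum_split_add join_at_def ul_block_index)
    finally show "0 < quad_form p (ul_block p A) f" .
  qed
  show "lr_block p A \<in> pd_mats q" unfolding pd_mats_quad_form
  proof (intro conjI allI impI)
    show "lr_block p A \<in> sym_mats q"
      by (rule sym_matsI[OF lr_block_carrier[OF c]]) (simp add: lr_block_index[OF c] sym)
    fix f :: "nat \<Rightarrow> real" assume "\<exists>i<q. f i \<noteq> 0"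
    then obtain i where "i < q" "f i \<noteq> 0" by blast
    then have "\<exists>i<p + q. join_at p (\<lambda>_. 0) f i \<noteq> 0"
      by (intro exI[of _ "p + i"]) (simp add: join_at_def)
    then have "0 < quad_form (p + q) A (join_at p (\<lambda>_. 0) f)"
      using A unfolding pd_mats_quad_form by blast
    also have "\<dots> = quad_form q (lr_block p A) f"
      by (simp add: quad_form_def sum_split_add join_at_def lr_block_index[OF c])
    finally show "0 < quad_form q (lr_block p A) f" .
  qed
qed


section \<open>The extremal coupling\<close>

text \<open>The trace of the root of a coupling that pairs the \<open>i\<close>-th largest eigenvalues of the two blocks; the
  surplus eigenvalues \<open>b i\<close>, \<open>i \<ge> p\<close>, of the larger block are paired with 0.\<close>

definition pair_root_sum :: "nat \<Rightarrow> nat \<Rightarrow> (nat \<Rightarrow> real) \<Rightarrow> (nat \<Rightarrow> real) \<Rightarrow> real" where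
  "pair_root_sum p q a b = (\<Sum>i<q. sqrt ((if i < p then a i else 0) + b i))"

text \<open>In the block eigenbasis write \<open>X = Z Z\<^sup>T\<close> where column \<open>i\<close> of \<open>Z\<close> has squared norm equal to the
  eigenvalue \<open>\<mu> i\<close> of \<open>X\<close>. The prescribed blocks say that the upper rows of \<open>Z\<close> are orthogonal with
  squared norms \<open>a\<close>, and the lower ones with squared norms \<open>b\<close>. Ky Fan's inequality, applied to the
  two groups of rows, shows that \<open>\<mu>\<close> is majorised by \<open>a + b\<close>, and the square root is concave.\<close>

lemma pair_root_sum_le_tr_psd_sqrt:
  assumes X: "X \<in> psd_mats (p + q)" and pq: "p \<le> q"
    and U: "orth_mat p U" "ul_block p X = conj_diag p U a"
    and V: "orth_mat q V" "lr_block p X = conj_diag q V b"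
    and a: "\<And>i. i < p \<Longrightarrow> 0 < a i" "\<And>i j. i \<le> j \<Longrightarrow> j < p \<Longrightarrow> a j \<le> a i"
    and b: "\<And>i. i < q \<Longrightarrow> 0 < b i" "\<And>i j. i \<le> j \<Longrightarrow> j < q \<Longrightarrow> b j \<le> b i"
  shows "pair_root_sum p q a b \<le> tr (psd_sqrt X)"
proof -
  let ?d = "p + q"
  obtain E \<mu> where E: "orth_mat ?d E" "X = conj_diag ?d E \<mu>" "\<And>i. i < ?d \<Longrightarrow> 0 \<le> \<mu> i"
      "\<And>i j. i \<le> j \<Longrightarrow> j < ?d \<Longrightarrow> \<mu> j \<le> \<mu> i"
    by (rule psd_mat_decompose[OF X]) (rule that)
  define W where "W = block_diag U V"
  have W: "orth_mat ?d W" unfolding W_def by (rule orth_mat_block_diag[OF U(1) V(1)])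
  have WT: "W\<^sup>T = block_diag U\<^sup>T V\<^sup>T"
    unfolding W_def by (rule block_diag_transpose) (use U V in \<open>auto simp: orth_mat_def\<close>)
  define Q where "Q = W\<^sup>T * E"
  have Q: "orth_mat ?d Q" unfolding Q_def by (intro orth_mat_mult orth_mat_transpose W E)
  define Y where "Y = W\<^sup>T * X * W"
  have Xc: "X \<in> carrier_mat ?d ?d" using X by (rule psd_mats_carrier)
  have Yc: "Y \<in> carrier_mat ?d ?d"
    using Xc W by (simp add: Y_def orth_mat_def square_mult[where n = ?d])
  have YQ: "Y = conj_diag ?d Q \<mu>"
    using conj_diag_conj[of E ?d "W\<^sup>T" \<mu>] W E by (simp add: Y_def Q_def orth_mat_def)
  have diag: "U\<^sup>T * conj_diag n U l * U = mat_diag n l" if "orth_mat n U" for n U l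
  proof -
    have "U\<^sup>T * conj_diag n U l * U = (U\<^sup>T * U) * mat_diag n l * (U\<^sup>T * U)"
      using orth_mat_carrier[OF that] unfolding conj_diag_def by (simp add: square_mult[where n = n])
    then show ?thesis
      using that by (simp add: orth_mat_def left_mult_one_mat[OF mat_diag_dim] right_mult_one_mat[OF mat_diag_dim])
  qed
  have Yul: "ul_block p Y = mat_diag p a" and Ylr: "lr_block p Y = mat_diag q b"
    unfolding Y_def WT unfolding W_def
    using U V diag by (simp_all add: blocks_of_conj[OF Xc] orth_mat_def)
  have Y1: "Y $$ (j,k) = (if j = k then a j else 0)" if "j < p" "k < p" for j k
    using arg_cong[OF Yul, of "\<lambda>M. M $$ (j,k)"] that by (simp add: ul_block_index mat_diag_index)
  have Y2: "Y $$ (p + j,p + k) = (if j = k then b j else 0)" if "j < q" "k < q" for j k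
    using arg_cong[OF Ylr, of "\<lambda>M. M $$ (j,k)"] that by (simp add: lr_block_index[OF Yc] mat_diag_index)
  define z where "z j i = Q $$ (j,i) * sqrt (\<mu> i)" for j i
  have zz: "(\<Sum>i<?d. z j i * z k i) = Y $$ (j,k)" if "j < ?d" "k < ?d" for j k
    unfolding YQ conj_diag_index[OF orth_mat_carrier[OF Q] that] z_def
    by (intro sum.cong refl) (use E(3) in \<open>auto simp: mult_ac\<close>)
  have zcol: "(\<Sum>j<?d. (z j i)\<^sup>2) = \<mu> i" if "i < ?d" for i
  proof -
    have "(\<Sum>j<?d. (z j i)\<^sup>2) = \<mu> i * (\<Sum>j<?d. Q $$ (j,i) * Q $$ (j,i))"
      unfolding sum_distrib_left
      by (intro sum.cong refl) (use E(3)[OF that] in \<open>auto simp: z_def power_mult_distrib power2_eq_square\<close>)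
    then show ?thesis using orth_mat_cols[OF Q that that] by simp
  qed
  define \<nu> where "\<nu> i = (if i < p then a i else 0) + (if i < q then b i else 0)" for i
  have part: "(\<Sum>i<k. \<mu> i) \<le> (\<Sum>i<k. \<nu> i)" if k: "k \<le> ?d" for k
  proof -
    have "(\<Sum>i<k. \<mu> i) = (\<Sum>i<k. \<Sum>j<p. (z j i)\<^sup>2) + (\<Sum>i<k. \<Sum>j<q. (z (p + j) i)\<^sup>2)"
      unfolding sum.distrib[symmetric]
      using k by (intro sum.cong refl) (simp add: sum_split_add flip: zcol)
    also have "\<dots> \<le> (\<Sum>i<k. if i < p then a i else 0) + (\<Sum>i<k. if i < q then b i else 0)"
    proof (intro add_mono)
      show "(\<Sum>i<k. \<Sum>j<p. (z j i)\<^sup>2) \<le> (\<Sum>i<k. if i < p then a i else 0)"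
        by (rule orthogonal_rows_mass_le[OF _ a k]) (simp add: zz Y1)
      show "(\<Sum>i<k. \<Sum>j<q. (z (p + j) i)\<^sup>2) \<le> (\<Sum>i<k. if i < q then b i else 0)"
        by (rule orthogonal_rows_mass_le[where z = "\<lambda>j i. z (p + j) i", OF _ b k]) (simp add: zz Y2)
    qed
    finally show ?thesis by (simp add: \<nu>_def sum.distrib)
  qed
  have tot\<nu>: "(\<Sum>i<?d. \<nu> i) = (\<Sum>i<p. a i) + (\<Sum>i<q. b i)"
    unfolding \<nu>_def sum.distrib
    by (intro arg_cong2[of _ _ _ _ "(+)"] sum.mono_neutral_cong_right) auto
  have "(\<Sum>i<?d. \<mu> i) = tr X" unfolding E(2) by (simp add: tr_conj_diag[OF E(1)])
  also have "\<dots> = (\<Sum>i<p. a i) + (\<Sum>i<q. b i)"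
    by (simp add: tr_blocks[OF Xc] U(2) V(2) tr_conj_diag[OF U(1)] tr_conj_diag[OF V(1)])
  finally have tot: "(\<Sum>i<?d. \<mu> i) = (\<Sum>i<?d. \<nu> i)" using tot\<nu> by simp
  have "(\<Sum>i<?d. sqrt (\<nu> i)) \<le> (\<Sum>i<?d. sqrt (\<mu> i))"
  proof (rule sum_sqrt_le_of_majorized)
    show "\<nu> j \<le> \<nu> i" if "i \<le> j" "j < ?d" for i j
      using that pq a(2)[of i j] b(2)[of i j] a(1)[of i] b(1)[of i] by (auto simp: \<nu>_def)
    show "0 \<le> \<nu> i" for i using a(1)[of i] b(1)[of i] by (auto simp: \<nu>_def)
  qed (use E part tot in auto)
  also have "(\<Sum>i<?d. sqrt (\<nu> i)) = pair_root_sum p q a b"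
    unfolding pair_root_sum_def
    by (rule sum.mono_neutral_cong_right) (use pq in \<open>auto simp: \<nu>_def\<close>)
  also have "(\<Sum>i<?d. sqrt (\<mu> i)) = tr (psd_sqrt X)"
    unfolding E(2) by (subst psd_sqrt_conj_diag[OF E(1,3)]) (simp_all add: tr_conj_diag[OF E(1)])
  finally show ?thesis .
qed

text \<open>A \<open>q \<times> (p + q)\<close> factor that pairs the \<open>i\<close>-th eigenvector of the first block with the \<open>i\<close>-th of
  the second one. The extremal coupling is its Gram matrix.\<close>

definition pairing_factor :: "nat \<Rightarrow> nat \<Rightarrow> real mat \<Rightarrow> real mat \<Rightarrow> (nat \<Rightarrow> real) \<Rightarrow> (nat \<Rightarrow> real) \<Rightarrow> real mat"
  where "pairing_factor p q U V g h = Matrix.mat q (p + q) (\<lambda>(i,j).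
    if j < p then (if i < p then g i * U $$ (j,i) else 0) else h i * V $$ (j - p,i))"

lemma pairing_factor_carrier: "pairing_factor p q U V g h \<in> carrier_mat q (p + q)"
  by (simp add: pairing_factor_def)

lemma pairing_factor_index:
  "i < q \<Longrightarrow> j < p \<Longrightarrow> pairing_factor p q U V g h $$ (i,j) = (if i < p then g i * U $$ (j,i) else 0)"
  "i < q \<Longrightarrow> j < q \<Longrightarrow> pairing_factor p q U V g h $$ (i,p + j) = h i * V $$ (j,i)"
  by (simp_all add: pairing_factor_def)

text \<open>The other Gram matrix of the factor is diagonal, which makes the trace of the root explicit.\<close>

lemma pairing_factor_outer_gram:
  assumes U: "orth_mat p U" and V: "orth_mat q V"
  shows "pairing_factor p q U V g h * (pairing_factor p q U V g h)\<^sup>T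
    = mat_diag q (\<lambda>i. (if i < p then (g i)\<^sup>2 else 0) + (h i)\<^sup>2)"
proof (rule eq_matI)
  let ?C = "pairing_factor p q U V g h"
  note c = pairing_factor_carrier[of p q U V g h]
  fix i j assume "i < dim_row (mat_diag q (\<lambda>i. (if i < p then (g i)\<^sup>2 else 0) + (h i)\<^sup>2))"
    "j < dim_col (mat_diag q (\<lambda>i. (if i < p then (g i)\<^sup>2 else 0) + (h i)\<^sup>2))"
  then have ij: "i < q" "j < q" by auto
  have "(?C * ?C\<^sup>T) $$ (i,j) = (\<Sum>k<p + q. ?C $$ (i,k) * ?C $$ (j,k))"
    using c ij by (subst index_mult_mat_sum[of _ q "p + q" _ q]) auto
  also have "\<dots> = (\<Sum>k<p. ?C $$ (i,k) * ?C $$ (j,k)) + h i * h j * (\<Sum>k<q. V $$ (k,i) * V $$ (k,j))"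
    unfolding sum_split_add sum_distrib_left using ij
    by (intro arg_cong2[of _ _ _ _ "(+)"] sum.cong refl) (simp add: pairing_factor_index mult_ac)
  also have "(\<Sum>k<p. ?C $$ (i,k) * ?C $$ (j,k))
      = (if i < p \<and> j < p then g i * g j * (\<Sum>k<p. U $$ (k,i) * U $$ (k,j)) else 0)"
    using ij by (auto simp: pairing_factor_index sum_distrib_left mult_ac intro!: sum.cong)
  also have "\<dots> + h i * h j * (\<Sum>k<q. V $$ (k,i) * V $$ (k,j))
      = mat_diag q (\<lambda>i. (if i < p then (g i)\<^sup>2 else 0) + (h i)\<^sup>2) $$ (i,j)"
    using ij orth_mat_cols[OF U, of i j] orth_mat_cols[OF V, of i j]
    by (auto simp: mat_diag_index power2_eq_square)
  finally show "(?C * ?C\<^sup>T) $$ (i,j) = mat_diag q (\<lambda>i. (if i < p then (g i)\<^sup>2 else 0) + (h i)\<^sup>2) $$ (i,j)" .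
qed (use pairing_factor_carrier[of p q U V g h] in auto)

lemma tr_psd_sqrt_pairing:
  assumes "orth_mat p U" "orth_mat q V"
  shows "tr (psd_sqrt ((pairing_factor p q U V g h)\<^sup>T * pairing_factor p q U V g h))
    = pair_root_sum p q (\<lambda>i. (g i)\<^sup>2) (\<lambda>i. (h i)\<^sup>2)"
proof -
  have "psd_sqrt (mat_diag q (\<lambda>i. (if i < p then (g i)\<^sup>2 else 0) + (h i)\<^sup>2))
      = conj_diag q (1\<^sub>m q) (\<lambda>i. sqrt ((if i < p then (g i)\<^sup>2 else 0) + (h i)\<^sup>2))"
    unfolding conj_diag_one_mat[symmetric] by (rule psd_sqrt_conj_diag[OF orth_mat_one]) simp
  then show ?thesis
    unfolding tr_psd_sqrt_gram[OF pairing_factor_carrier] pairing_factor_outer_gram[OF assms]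
    by (simp add: tr_conj_diag[OF orth_mat_one] pair_root_sum_def)
qed

lemma psd_sqrt_mat_diag:
  "(\<And>i. i < n \<Longrightarrow> 0 \<le> f i) \<Longrightarrow> psd_sqrt (mat_diag n f) = mat_diag n (\<lambda>i. sqrt (f i))"
  using psd_sqrt_conj_diag[OF orth_mat_one, of n f] by (simp add: conj_diag_one_mat)

lemma four_block_eqI:
  assumes X: "X \<in> carrier_mat (p + q) (p + q)"
    and c: "A \<in> carrier_mat p p" "B \<in> carrier_mat p q" "C \<in> carrier_mat q p" "D \<in> carrier_mat q q"
    and "\<And>i j. i < p \<Longrightarrow> j < p \<Longrightarrow> X $$ (i,j) = A $$ (i,j)"
    and "\<And>i j. i < p \<Longrightarrow> j < q \<Longrightarrow> X $$ (i,p + j) = B $$ (i,j)"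
    and "\<And>i j. i < q \<Longrightarrow> j < p \<Longrightarrow> X $$ (p + i,j) = C $$ (i,j)"
    and "\<And>i j. i < q \<Longrightarrow> j < q \<Longrightarrow> X $$ (p + i,p + j) = D $$ (i,j)"
  shows "four_block_mat A B C D = X"
proof (rule eq_matI)
  fix i j assume "i < dim_row X" "j < dim_col X"
  then have ij: "i < p + q" "j < p + q" using X by auto
  have s: "k = p + (k - p)" "k - p < q" if "\<not> k < p" "k < p + q" for k using that by auto
  consider "i < p" "j < p" | "i < p" "\<not> j < p" | "\<not> i < p" "j < p" | "\<not> i < p" "\<not> j < p" by blast
  then show "four_block_mat A B C D $$ (i,j) = X $$ (i,j)"
    using c ij assms(6)[of i j] assms(7)[of i "j - p"] assms(8)[of "i - p" j] assms(9)[of "i - p" "j - p"]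
      s[of i] s[of j]
    by cases auto
qed (use X c in auto)

lemma R_m_eq_gram:
  assumes R: "R \<in> carrier_mat (p + q) (p + q)" and pq: "p \<le> q"
    and U: "orth_mat p U" "ul_block p R = conj_diag p U a"
    and V: "orth_mat q V" "lr_block p R = conj_diag q V b"
    and a: "\<And>i. i < p \<Longrightarrow> 0 < a i" and b: "\<And>i. i < q \<Longrightarrow> 0 < b i"
  shows "R_m p q R U (mat_diag p a) V (mat_diag q b)
    = (pairing_factor p q U V (\<lambda>i. sqrt (a i)) (\<lambda>i. sqrt (b i)))\<^sup>T
      * pairing_factor p q U V (\<lambda>i. sqrt (a i)) (\<lambda>i. sqrt (b i))" (is "_ = ?C\<^sup>T * ?C")
proof -
  have C: "?C \<in> carrier_mat q (p + q)" by (rule pairing_factor_carrier)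
  have Uc: "U \<in> carrier_mat p p" and Vc: "V \<in> carrier_mat q q" using U V by (auto simp: orth_mat_def)
  define Psi where "Psi = Psi_m p q U (mat_diag p a) V (mat_diag q b)"
  define Pi where "Pi = fst (split_block (1\<^sub>m (p + q) :: real mat) p q)"
  have Pi: "Pi \<in> carrier_mat p q" "\<And>i j. i < p \<Longrightarrow> j < q \<Longrightarrow> Pi $$ (i,j) = (if i = j then 1 else 0)"
    by (auto simp: Pi_def split_block_def Let_def)
  have entry: "(?C\<^sup>T * ?C) $$ (i,j) = (\<Sum>k<q. ?C $$ (k,i) * ?C $$ (k,j))" if "i < p + q" "j < p + q" for i j
    using C that by (subst index_mult_mat_sum[of _ "p + q" q _ "p + q"]) auto
  have DV: "mat_diag q (\<lambda>i. sqrt (b i)) * V\<^sup>T = Matrix.mat q q (\<lambda>(i,j). sqrt (b i) * V $$ (j,i))"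
    using Vc by (subst mat_diag_mult_left[of _ q q]) (auto intro!: eq_matI)
  have UD: "U * mat_diag p (\<lambda>i. sqrt (a i)) = Matrix.mat p p (\<lambda>(i,j). U $$ (i,j) * sqrt (a j))"
    by (rule mat_diag_mult_right[OF Uc])
  have Psi_eq: "Psi = (U * mat_diag p (\<lambda>i. sqrt (a i))) * Pi * (mat_diag q (\<lambda>i. sqrt (b i)) * V\<^sup>T)"
    unfolding Psi_def Psi_m_def Pi_def[symmetric]
    using a b Uc Vc carrier_matD[OF Pi(1)] by (simp add: psd_sqrt_mat_diag less_imp_le mat_assoc)
  have Psic: "Psi \<in> carrier_mat p q"
    unfolding Psi_eq UD DV using Pi(1) by (meson mat_carrier mult_carrier_mat)
  have UDPi: "(U * mat_diag p (\<lambda>i. sqrt (a i)) * Pi) $$ (i,k) = (if k < p then U $$ (i,k) * sqrt (a k) else 0)"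
    if "i < p" "k < q" for i k
  proof -
    have "(U * mat_diag p (\<lambda>i. sqrt (a i)) * Pi) $$ (i,k) = (\<Sum>l<p. U $$ (i,l) * sqrt (a l) * Pi $$ (l,k))"
      unfolding UD using that Pi(1) by (subst index_mult_mat_sum[of _ p p _ q]) auto
    also have "\<dots> = (\<Sum>l<p. if l = k then U $$ (i,l) * sqrt (a l) else 0)"
      using that Pi(2) by (intro sum.cong) auto
    finally show ?thesis by simp
  qed
  have Psi: "Psi $$ (i,j) = (\<Sum>k<q. ?C $$ (k,i) * ?C $$ (k,p + j))" if "i < p" "j < q" for i j
  proof -
    have "Psi $$ (i,j) = (\<Sum>k<q. (U * mat_diag p (\<lambda>i. sqrt (a i)) * Pi) $$ (i,k) * (sqrt (b k) * V $$ (j,k)))"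
      unfolding Psi_eq DV using that Uc Pi(1) by (subst index_mult_mat_sum[of _ p q _ q]) auto
    also have "\<dots> = (\<Sum>k<q. ?C $$ (k,i) * ?C $$ (k,p + j))"
      using that by (intro sum.cong refl) (auto simp: UDPi pairing_factor_index)
    finally show ?thesis .
  qed
  show ?thesis unfolding R_m_def Psi_def[symmetric]
  proof (rule four_block_eqI)
    show "?C\<^sup>T * ?C \<in> carrier_mat (p + q) (p + q)" using C by auto
    show "ul_block p R \<in> carrier_mat p p" "lr_block p R \<in> carrier_mat q q"
      using ul_block_carrier lr_block_carrier[OF R] by auto
    show "Psi \<in> carrier_mat p q" "Psi\<^sup>T \<in> carrier_mat q p" using Psic by auto
    show "(?C\<^sup>T * ?C) $$ (i,p + j) = Psi $$ (i,j)" if "i < p" "j < q" for i j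
      using that by (simp add: Psi entry)
    show "(?C\<^sup>T * ?C) $$ (p + i,j) = Psi\<^sup>T $$ (i,j)" if "i < q" "j < p" for i j
      using that carrier_matD[OF Psic] by (simp add: Psi entry mult.commute)
    show "(?C\<^sup>T * ?C) $$ (i,j) = ul_block p R $$ (i,j)" if "i < p" "j < p" for i j
    proof -
      have "(?C\<^sup>T * ?C) $$ (i,j) = (\<Sum>k<q. if k < p then a k * U $$ (i,k) * U $$ (j,k) else 0)"
        unfolding entry[OF trans_less_add1[OF that(1)] trans_less_add1[OF that(2)]]
        using that a by (intro sum.cong refl) (auto simp: pairing_factor_index less_imp_le)
      also have "\<dots> = (\<Sum>k<p. a k * U $$ (i,k) * U $$ (j,k))"
        using pq by (intro sum.mono_neutral_cong_right) auto
      finally show ?thesis by (simp add: U(2) conj_diag_index[OF Uc that])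
    qed
    show "(?C\<^sup>T * ?C) $$ (p + i,p + j) = lr_block p R $$ (i,j)" if "i < q" "j < q" for i j
    proof -
      have "(?C\<^sup>T * ?C) $$ (p + i,p + j) = (\<Sum>k<q. b k * V $$ (i,k) * V $$ (j,k))"
        using that b by (subst entry) (auto simp: pairing_factor_index less_imp_le intro!: sum.cong)
      then show ?thesis by (simp add: V(2) conj_diag_index[OF Vc that])
    qed
  qed
qed


section \<open>Closed forms of the dependence coefficients\<close>

lemma wasserstein_sq_one:
  assumes B: "B \<in> psd_mats n"
  shows "wasserstein_sq B (1\<^sub>m n) = tr B + n - 2 * tr (psd_sqrt B)"
proof -
  have c: "psd_sqrt B \<in> carrier_mat n n" using psd_sqrt_psd(1)[OF B] by (rule psd_mats_carrier)
  have "tr (1\<^sub>m n) = n" by (simp add: tr_carrier[of _ n n])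
  then show ?thesis
    using psd_sqrt_psd(2)[OF B] c by (simp add: wasserstein_sq_def right_mult_one_mat[of _ n n])
qed

text \<open>The definition sandwiches the second argument between roots of the first. The Gram swap exchanges
  the roles, so that in the supremum over couplings \<open>B\<close> the fixed matrix \<open>A\<close> provides the roots.\<close>

lemma wasserstein_sq_eq:
  assumes B: "B \<in> psd_mats n" and A: "A \<in> psd_mats n"
  shows "wasserstein_sq B A = tr B + tr A - 2 * tr (psd_sqrt (psd_sqrt A * B * psd_sqrt A))"
proof -
  define S T where "S = psd_sqrt A" and "T = psd_sqrt B"
  have ST: "S \<in> psd_mats n" "T \<in> psd_mats n" "S * S = A" "T * T = B"
    using psd_sqrt_psd A B by (auto simp: S_def T_def)
  have c: "S \<in> carrier_mat n n" "T \<in> carrier_mat n n" using ST psd_mats_carrier by auto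
  have t: "S\<^sup>T = S" "T\<^sup>T = T" using ST by (auto simp: psd_mats_def sym_mats_def)
  have TS: "(S * T)\<^sup>T = T * S" using transpose_mult[OF c] t by simp
  have "T * A * T = (S * T)\<^sup>T * (S * T)"
    unfolding TS ST(3)[symmetric] using c by (simp add: square_mult[where n = n])
  moreover have "S * B * S = (S * T) * (S * T)\<^sup>T"
    unfolding TS ST(4)[symmetric] using c by (simp add: square_mult[where n = n])
  moreover have "S * T \<in> carrier_mat n n" using c by auto
  ultimately have "tr (psd_sqrt (T * A * T)) = tr (psd_sqrt (S * B * S))"
    using tr_psd_sqrt_gram[of "S * T" n n] by simp
  then show ?thesis by (simp add: wasserstein_sq_def S_def T_def)
qed

lemma conj_diag_mult_commuting_roots:
  assumes U: "orth_mat n U" and a: "\<And>i. i < n \<Longrightarrow> 0 < a i"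
  shows "conj_diag n U (\<lambda>i. sqrt (a i)) * conj_diag n U a * conj_diag n U (\<lambda>i. sqrt (a i))
    = conj_diag n U (\<lambda>i. (a i)\<^sup>2)"
  unfolding conj_diag_mult[OF U]
  by (rule conj_diag_cong) (use a in \<open>auto simp: power2_eq_square mult.commute mult.left_commute less_imp_le\<close>)

context
  fixes p q :: nat and A U V :: "real mat" and a b :: "nat \<Rightarrow> real"
  assumes A: "A \<in> pd_mats (p + q)" and pq: "p \<le> q"
    and U: "orth_mat p U" "ul_block p A = conj_diag p U a"
    and V: "orth_mat q V" "lr_block p A = conj_diag q V b"
    and a_dec: "\<And>i j. i \<le> j \<Longrightarrow> j < p \<Longrightarrow> a j \<le> a i"
    and b_dec: "\<And>i j. i \<le> j \<Longrightarrow> j < q \<Longrightarrow> b j \<le> b i"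
begin

lemma block_eigenvalues_pos: "i < p \<Longrightarrow> 0 < a i" "j < q \<Longrightarrow> 0 < b j"
  using blocks_psd_pd[OF pd_mats_carrier[OF A]] A U V conj_diag_pd_iff by auto

lemma block_diag_part_eq:
  "block_diag_part p A = conj_diag (p + q) (block_diag U V) (join_at p a b)"
  unfolding block_diag_part_def U(2) V(2) by (rule block_diag_conj_diag[OF U(1) V(1)])

lemma orth_block: "orth_mat (p + q) (block_diag U V)"
  by (rule orth_mat_block_diag[OF U(1) V(1)])

lemma block_diag_part_pd: "block_diag_part p A \<in> pd_mats (p + q)"
  unfolding block_diag_part_eq conj_diag_pd_iff[OF orth_block]
  by (auto simp: join_at_def intro: block_eigenvalues_pos)

lemma psd_sqrt_block_diag_part:
  "psd_sqrt (block_diag_part p A)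
    = block_diag (conj_diag p U (\<lambda>i. sqrt (a i))) (conj_diag q V (\<lambda>i. sqrt (b i)))"
proof -
  have "psd_sqrt (block_diag_part p A) = conj_diag (p + q) (block_diag U V) (\<lambda>i. sqrt (join_at p a b i))"
    unfolding block_diag_part_eq
    by (rule psd_sqrt_conj_diag[OF orth_block])
       (auto simp: join_at_def intro!: less_imp_le[OF block_eigenvalues_pos(1)] less_imp_le[OF block_eigenvalues_pos(2)])
  also have "\<dots> = conj_diag (p + q) (block_diag U V) (join_at p (\<lambda>i. sqrt (a i)) (\<lambda>i. sqrt (b i)))"
    by (rule conj_diag_cong) (simp add: join_at_def)
  finally show ?thesis by (simp add: block_diag_conj_diag[OF U(1) V(1)])
qed

abbreviation "Rm \<equiv> R_m p q A U (mat_diag p a) V (mat_diag q b)"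
abbreviation "RmC \<equiv> pairing_factor p q U V (\<lambda>i. sqrt (a i)) (\<lambda>i. sqrt (b i))"

lemma Rm_gram: "Rm = RmC\<^sup>T * RmC"
  by (rule R_m_eq_gram[OF pd_mats_carrier[OF A] pq U V block_eigenvalues_pos])

lemma Rm_psd: "Rm \<in> psd_mats (p + q)"
  unfolding Rm_gram
  using psd_gram[of "RmC\<^sup>T" "p + q" q]
    pairing_factor_carrier[of p q U V] by simp

lemma Rm_coupling: "Rm \<in> coupling_mats p q (ul_block p A) (lr_block p A)"
proof -
  have Ac: "A \<in> carrier_mat (p + q) (p + q)" using A by (rule pd_mats_carrier)
  have "Rm \<in> carrier_mat (p + q) (p + q)" using Rm_psd by (rule psd_mats_carrier)
  then have "\<And>i j. i < p \<Longrightarrow> j < p \<Longrightarrow> ul_block p Rm $$ (i,j) = ul_block p A $$ (i,j)"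
    and "\<And>i j. i < q \<Longrightarrow> j < q \<Longrightarrow> lr_block p Rm $$ (i,j) = lr_block p A $$ (i,j)"
    and "lr_block p Rm \<in> carrier_mat q q"
    using carrier_matD[OF ul_block_carrier[of p A]] carrier_matD[OF lr_block_carrier[OF Ac]]
    by (simp_all add: ul_block_index lr_block_index lr_block_carrier) (simp_all add: R_m_def ul_block_index)
  then have "ul_block p Rm = ul_block p A" "lr_block p Rm = lr_block p A"
    using carrier_matD[OF ul_block_carrier[of p A]] carrier_matD[OF lr_block_carrier[OF Ac]]
      carrier_matD[OF ul_block_carrier[of p Rm]]
    by (auto intro!: eq_matI)
  with Rm_psd show ?thesis by (simp add: coupling_mats_def)
qed

lemma tr_Rm: "tr Rm = tr A"
  using Rm_coupling tr_blocks[OF pd_mats_carrier[OF A]] tr_blocks[OF psd_mats_carrier[OF Rm_psd]]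
  by (simp add: coupling_mats_def)

lemma tr_psd_sqrt_Rm: "tr (psd_sqrt Rm) = pair_root_sum p q a b"
proof -
  have "tr (psd_sqrt Rm) = pair_root_sum p q (\<lambda>i. (sqrt (a i))\<^sup>2) (\<lambda>i. (sqrt (b i))\<^sup>2)"
    unfolding Rm_gram by (rule tr_psd_sqrt_pairing[OF U(1) V(1)])
  also have "\<dots> = pair_root_sum p q a b"
    unfolding pair_root_sum_def using block_eigenvalues_pos
    by (intro sum.cong refl) (simp add: less_imp_le)
  finally show ?thesis .
qed

lemma pairing_factor_mult_root:
  "RmC * psd_sqrt (block_diag_part p A)
    = pairing_factor p q U V a b" (is "?C * _ = _")
proof (rule eq_matI)
  let ?S1 = "conj_diag p U (\<lambda>i. sqrt (a i))" and ?S2 = "conj_diag q V (\<lambda>i. sqrt (b i))"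
  let ?S = "block_diag ?S1 ?S2"
  have c1: "?S1 \<in> carrier_mat p p" and c2: "?S2 \<in> carrier_mat q q"
    by (simp_all add: U(1) V(1))
  have c: "?S \<in> carrier_mat (p + q) (p + q)" by (rule block_diag_carrier[OF c1 c2])
  note idx = block_diag_index[OF c1 c2]
  fix i j assume "i < dim_row (pairing_factor p q U V a b)" "j < dim_col (pairing_factor p q U V a b)"
  then have ij: "i < q" "j < p + q" by (auto simp: pairing_factor_def)
  have entry: "(?C * ?S) $$ (i,j) = (\<Sum>k<p. ?C $$ (i,k) * ?S $$ (k,j)) + (\<Sum>k<q. ?C $$ (i,p + k) * ?S $$ (p + k,j))"
    using index_mult_mat_sum[OF pairing_factor_carrier c ij] by (simp add: sum_split_add)
  show "(?C * psd_sqrt (block_diag_part p A)) $$ (i,j) = pairing_factor p q U V a b $$ (i,j)"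
  proof (cases "j < p")
    case True
    have "(?C * ?S) $$ (i,j) = (\<Sum>k<p. ?C $$ (i,k) * ?S1 $$ (k,j))"
      unfolding entry using ij True by (simp add: idx)
    also have "\<dots> = (if i < p then sqrt (a i) * (\<Sum>k<p. ?S1 $$ (j,k) * U $$ (k,i)) else 0)"
      using ij True sym_mats_entry[OF conj_diag_sym[OF U(1)], of _ j]
      by (auto simp: pairing_factor_index sum_distrib_left mult_ac intro!: sum.cong)
    also have "\<dots> = pairing_factor p q U V a b $$ (i,j)"
      using ij True block_eigenvalues_pos(1)[of i]
      by (cases "i < p") (simp_all add: conj_diag_mult_col[OF U(1)] pairing_factor_index)
    finally show ?thesis by (simp add: psd_sqrt_block_diag_part)
  next
    case False
    define l where "l = j - p"
    have l: "j = p + l" "l < q" using ij False by (auto simp: l_def)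
    have "(?C * ?S) $$ (i,j) = (\<Sum>k<q. ?C $$ (i,p + k) * ?S2 $$ (k,l))"
      unfolding entry using ij l by (simp add: idx)
    also have "\<dots> = sqrt (b i) * (\<Sum>k<q. ?S2 $$ (l,k) * V $$ (k,i))"
      using ij l sym_mats_entry[OF conj_diag_sym[OF V(1)], of _ l]
      by (auto simp: pairing_factor_index sum_distrib_left mult_ac intro!: sum.cong)
    also have "\<dots> = pairing_factor p q U V a b $$ (i,j)"
      using ij l block_eigenvalues_pos(2)[of i]
      by (simp add: conj_diag_mult_col[OF V(1)] pairing_factor_index)
    finally show ?thesis by (simp add: psd_sqrt_block_diag_part)
  qed
qed (use psd_mats_carrier[OF psd_sqrt_psd(1)[OF pd_mats_imp_psd[OF block_diag_part_pd]]]
    in \<open>auto simp: pairing_factor_def\<close>)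

lemma tr_psd_sqrt_weighted_Rm:
  "tr (psd_sqrt (psd_sqrt (block_diag_part p A) * Rm * psd_sqrt (block_diag_part p A)))
    = pair_root_sum p q (\<lambda>i. (a i)\<^sup>2) (\<lambda>i. (b i)\<^sup>2)"
proof -
  let ?C = "RmC"
  let ?S = "psd_sqrt (block_diag_part p A)"
  have S: "?S \<in> psd_mats (p + q)" by (rule psd_sqrt_psd(1)[OF pd_mats_imp_psd[OF block_diag_part_pd]])
  then have Sc: "?S \<in> carrier_mat (p + q) (p + q)" and ST: "?S\<^sup>T = ?S"
    by (auto simp: psd_mats_def sym_mats_def)
  have "?S * Rm * ?S = (?C * ?S)\<^sup>T * (?C * ?S)"
    unfolding Rm_gram transpose_mult[OF pairing_factor_carrier Sc] ST
    using carrier_matD[OF Sc] carrier_matD[OF pairing_factor_carrier[of p q U V]]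
    by (simp add: mat_assoc)
  then show ?thesis
    by (simp add: pairing_factor_mult_root tr_psd_sqrt_pairing[OF U(1) V(1)])
qed

text \<open>The distance to the identity is an affine function of \<open>tr (psd_sqrt B)\<close> on the couplings, so the
  supremum is governed by the lower bound for that trace, which \<open>Rm\<close> attains.\<close>

theorem dep_coef1_eq:
  "dep_coef1 p q A = (tr (psd_sqrt (ul_block p A)) + tr (psd_sqrt (lr_block p A)) - tr (psd_sqrt A))
    / (tr (psd_sqrt (ul_block p A)) + tr (psd_sqrt (lr_block p A)) - pair_root_sum p q a b)"
proof -
  let ?A1 = "ul_block p A" and ?A2 = "lr_block p A"
  have Ac: "A \<in> carrier_mat (p + q) (p + q)" using A by (rule pd_mats_carrier)
  have blocks: "?A1 \<in> psd_mats p" "?A2 \<in> psd_mats q"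
    using blocks_psd_pd[OF Ac A] pd_mats_imp_psd by auto
  have sup: "(SUP B \<in> coupling_mats p q ?A1 ?A2. wasserstein_sq B (1\<^sub>m (p + q)))
      = tr A + (p + q) - 2 * pair_root_sum p q a b"
  proof (rule cSup_eq_maximum)
    have "wasserstein_sq Rm (1\<^sub>m (p + q)) = tr A + (p + q) - 2 * pair_root_sum p q a b"
      by (simp add: wasserstein_sq_one[OF Rm_psd] tr_Rm tr_psd_sqrt_Rm)
    then show "tr A + (p + q) - 2 * pair_root_sum p q a b
        \<in> (\<lambda>B. wasserstein_sq B (1\<^sub>m (p + q))) ` coupling_mats p q ?A1 ?A2"
      using Rm_coupling by (metis imageI)
    fix x assume "x \<in> (\<lambda>B. wasserstein_sq B (1\<^sub>m (p + q))) ` coupling_mats p q ?A1 ?A2"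
    then obtain B where B: "B \<in> psd_mats (p + q)" "ul_block p B = ?A1" "lr_block p B = ?A2"
        and x: "x = wasserstein_sq B (1\<^sub>m (p + q))"
      by (auto simp: coupling_mats_def)
    have "pair_root_sum p q a b \<le> tr (psd_sqrt B)"
      using B U V by (intro pair_root_sum_le_tr_psd_sqrt[OF B(1) pq]) 
        (auto intro: block_eigenvalues_pos a_dec b_dec)
    then show "x \<le> tr A + (p + q) - 2 * pair_root_sum p q a b"
      using tr_blocks[OF psd_mats_carrier[OF B(1)]] tr_blocks[OF Ac] B
      by (simp add: x wasserstein_sq_one)
  qed
  have ratio: "(2 * x) / (2 * y) = x / y" for x y :: real by simp
  have "dep_coef1 p q A = (2 * (tr (psd_sqrt ?A1) + tr (psd_sqrt ?A2) - tr (psd_sqrt A)))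
    / (2 * (tr (psd_sqrt ?A1) + tr (psd_sqrt ?A2) - pair_root_sum p q a b))"
    unfolding dep_coef1_def Let_def sup
    by (intro arg_cong2[of _ _ _ _ "(/)"])
       (simp_all add: wasserstein_sq_one[OF pd_mats_imp_psd[OF A]] wasserstein_sq_one[OF blocks(1)]
        wasserstein_sq_one[OF blocks(2)] tr_blocks[OF Ac])
  then show ?thesis unfolding ratio .
qed

text \<open>Conjugation with \<open>A0\<^sup>1\<^sup>/\<^sup>2\<close> maps couplings of \<open>A1\<close> and \<open>A2\<close> to couplings of \<open>A1\<^sup>2\<close> and \<open>A2\<^sup>2\<close>, and it maps
  \<open>Rm\<close> to the extremal one. This reduces the second supremum to the extremal problem of the first, with
  squared eigenvalues.\<close>

theorem dep_coef2_eq: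
  "dep_coef2 p q A
    = (tr A - tr (psd_sqrt (psd_sqrt (block_diag_part p A) * A * psd_sqrt (block_diag_part p A))))
      / (tr A - pair_root_sum p q (\<lambda>i. (a i)\<^sup>2) (\<lambda>i. (b i)\<^sup>2))"
proof -
  let ?A1 = "ul_block p A" and ?A2 = "lr_block p A" and ?A0 = "block_diag_part p A"
  let ?G = "pair_root_sum p q (\<lambda>i. (a i)\<^sup>2) (\<lambda>i. (b i)\<^sup>2)"
  have Ac: "A \<in> carrier_mat (p + q) (p + q)" using A by (rule pd_mats_carrier)
  have A0: "?A0 \<in> psd_mats (p + q)" by (rule pd_mats_imp_psd[OF block_diag_part_pd])
  have S: "psd_sqrt ?A0 \<in> psd_mats (p + q)" by (rule psd_sqrt_psd(1)[OF A0])
  have S': "psd_sqrt ?A0 \<in> carrier_mat (p + q) (p + q)" "(psd_sqrt ?A0)\<^sup>T = psd_sqrt ?A0"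
    using S by (auto simp: psd_mats_def sym_mats_def)
  have trA0: "tr ?A0 = tr A"
    using tr_blocks[OF psd_mats_carrier[OF A0]] tr_blocks[OF Ac]
    by (simp add: block_diag_part_def blocks_of_block_diag[OF ul_block_carrier lr_block_carrier[OF Ac]])
  have sup: "(SUP B \<in> coupling_mats p q ?A1 ?A2. wasserstein_sq B ?A0) = 2 * (tr A - ?G)"
  proof (rule cSup_eq_maximum)
    have "wasserstein_sq Rm ?A0 = 2 * (tr A - ?G)"
      by (simp add: wasserstein_sq_eq[OF Rm_psd A0] tr_Rm trA0 tr_psd_sqrt_weighted_Rm)
    then show "2 * (tr A - ?G) \<in> (\<lambda>B. wasserstein_sq B ?A0) ` coupling_mats p q ?A1 ?A2"
      using Rm_coupling by (metis imageI)
    fix x assume "x \<in> (\<lambda>B. wasserstein_sq B ?A0) ` coupling_mats p q ?A1 ?A2"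
    then obtain B where B: "B \<in> psd_mats (p + q)" "ul_block p B = ?A1" "lr_block p B = ?A2"
        and x: "x = wasserstein_sq B ?A0"
      by (auto simp: coupling_mats_def)
    let ?Y = "psd_sqrt ?A0 * B * psd_sqrt ?A0"
    have Y: "?Y \<in> psd_mats (p + q)" using psd_conj[OF B(1) S'(1)] S'(2) by simp
    have Yblocks: "ul_block p ?Y = conj_diag p U (\<lambda>i. (a i)\<^sup>2)" "lr_block p ?Y = conj_diag q V (\<lambda>i. (b i)\<^sup>2)"
      unfolding psd_sqrt_block_diag_part using U(1) V(1) block_eigenvalues_pos
      by (simp_all add: blocks_of_conj[OF psd_mats_carrier[OF B(1)]] B U(2) V(2) conj_diag_mult_commuting_roots)
    have "?G \<le> tr (psd_sqrt ?Y)"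
    proof (rule pair_root_sum_le_tr_psd_sqrt[OF Y pq U(1) Yblocks(1) V(1) Yblocks(2)])
      show "(a j)\<^sup>2 \<le> (a i)\<^sup>2" if "i \<le> j" "j < p" for i j
        using a_dec[OF that] block_eigenvalues_pos(1)[OF that(2)] by (intro power_mono) auto
      show "(b j)\<^sup>2 \<le> (b i)\<^sup>2" if "i \<le> j" "j < q" for i j
        using b_dec[OF that] block_eigenvalues_pos(2)[OF that(2)] by (intro power_mono) auto
    qed (use block_eigenvalues_pos in force)+
    then show "x \<le> 2 * (tr A - ?G)"
      using tr_blocks[OF psd_mats_carrier[OF B(1)]] tr_blocks[OF Ac] B
      by (simp add: x wasserstein_sq_eq[OF B(1) A0] trA0)
  qed
  have ratio: "(2 * x) / (2 * y) = x / y" for x y :: real by simp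
  have "dep_coef2 p q A = (2 * (tr A - tr (psd_sqrt (psd_sqrt ?A0 * A * psd_sqrt ?A0)))) / (2 * (tr A - ?G))"
    unfolding dep_coef2_def Let_def block_diag_part_def[symmetric] sup
    by (simp add: wasserstein_sq_eq[OF pd_mats_imp_psd[OF A] A0] trA0)
  then show ?thesis unfolding ratio .
qed

end

section \<open>Differentiating matrix paths\<close>

text \<open>Entrywise right derivative at \<open>0\<close> of a path of \<open>n \<times> n\<close> matrices. Differentiation from one side
  along \<open>R + t H\<^sub>t\<close> captures limits in which the direction \<open>H\<^sub>t\<close> varies with \<open>t\<close>.\<close>

definition mat_deriv :: "nat \<Rightarrow> (real \<Rightarrow> real mat) \<Rightarrow> real mat \<Rightarrow> bool" where
  "mat_deriv n A A' \<longleftrightarrow> (\<forall>t. A t \<in> carrier_mat n n) \<and> A' \<in> carrier_mat n n \<and>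
     (\<forall>i<n. \<forall>j<n. ((\<lambda>t. A t $$ (i,j)) has_real_derivative A' $$ (i,j)) (at_right 0))"

lemma mat_derivD:
  assumes "mat_deriv n A A'"
  shows "A t \<in> carrier_mat n n" "A' \<in> carrier_mat n n"
    "i < n \<Longrightarrow> j < n \<Longrightarrow> ((\<lambda>t. A t $$ (i,j)) has_real_derivative A' $$ (i,j)) (at_right 0)"
  using assms by (auto simp: mat_deriv_def)

lemma mat_deriv_quotient:
  assumes "mat_deriv n A A'" "i < n" "j < n"
  shows "((\<lambda>t. (A t $$ (i,j) - A 0 $$ (i,j)) / t) \<longlongrightarrow> A' $$ (i,j)) (at_right 0)"
  using mat_derivD(3)[OF assms] by (simp add: has_field_derivative_iff)

lemma mat_deriv_diff_tendsto:
  assumes "mat_deriv n A A'" "i < n" "j < n"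
  shows "((\<lambda>t. A t $$ (i,j) - A 0 $$ (i,j)) \<longlongrightarrow> 0) (at_right 0)"
proof -
  have "((\<lambda>t. A t $$ (i,j)) \<longlongrightarrow> A 0 $$ (i,j)) (at_right 0)"
    using DERIV_continuous[OF mat_derivD(3)[OF assms]] by (simp add: continuous_within)
  from tendsto_diff[OF this tendsto_const[of "A 0 $$ (i,j)"]] show ?thesis by simp
qed

lemma mat_deriv_const: "A \<in> carrier_mat n n \<Longrightarrow> mat_deriv n (\<lambda>_. A) (0\<^sub>m n n)"
  by (simp add: mat_deriv_def)

lemma mat_deriv_mult:
  assumes A: "mat_deriv n A A'" and B: "mat_deriv n B B'"
  shows "mat_deriv n (\<lambda>t. A t * B t) (A' * B 0 + A 0 * B')"
  unfolding mat_deriv_def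
proof (intro conjI allI impI)
  note c = mat_derivD(1,2)[OF A] mat_derivD(1,2)[OF B]
  show "A t * B t \<in> carrier_mat n n" for t using c(1)[of t] c(3)[of t] by simp
  show "A' * B 0 + A 0 * B' \<in> carrier_mat n n" using c by (simp add: square_mult[where n = n])
  fix i j assume ij: "i < n" "j < n"
  have "((\<lambda>t. \<Sum>k<n. A t $$ (i,k) * B t $$ (k,j)) has_real_derivative
      (\<Sum>k<n. A' $$ (i,k) * B 0 $$ (k,j) + B' $$ (k,j) * A 0 $$ (i,k))) (at_right 0)"
    using ij by (intro DERIV_sum DERIV_mult mat_derivD(3)[OF A] mat_derivD(3)[OF B]) auto
  moreover have "(\<lambda>t. (A t * B t) $$ (i,j)) = (\<lambda>t. \<Sum>k<n. A t $$ (i,k) * B t $$ (k,j))"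
    using ij index_mult_mat_sum[OF c(1) c(3)] by blast
  moreover have "(A' * B 0 + A 0 * B') $$ (i,j)
      = (\<Sum>k<n. A' $$ (i,k) * B 0 $$ (k,j) + B' $$ (k,j) * A 0 $$ (i,k))"
  proof -
    have "(A' * B 0 + A 0 * B') $$ (i,j) = (A' * B 0) $$ (i,j) + (A 0 * B') $$ (i,j)"
      using c(1)[of 0] c(4) ij by (intro index_add_mat) auto
    then show ?thesis
      using index_mult_mat_sum[OF c(2) c(3)[of 0] ij] index_mult_mat_sum[OF c(1)[of 0] c(4) ij]
      by (simp add: sum.distrib mult.commute)
  qed
  ultimately show "((\<lambda>t. (A t * B t) $$ (i,j)) has_real_derivative (A' * B 0 + A 0 * B') $$ (i,j)) (at_right 0)"
    by simp
qed

lemma mat_deriv_tr: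
  assumes "mat_deriv n A A'"
  shows "((\<lambda>t. tr (A t)) has_real_derivative tr A') (at_right 0)"
proof -
  have "((\<lambda>t. \<Sum>i<n. A t $$ (i,i)) has_real_derivative (\<Sum>i<n. A' $$ (i,i))) (at_right 0)"
    by (intro DERIV_sum mat_derivD(3)[OF assms]) auto
  then show ?thesis
    using tr_carrier[OF mat_derivD(1)[OF assms]] tr_carrier[OF mat_derivD(2)[OF assms]] by simp
qed

text \<open>Pairing \<open>S W + W P\<close> with \<open>W\<close> in the Frobenius inner product gives the quadratic forms of \<open>S\<close> on
  the columns of \<open>W\<close> and of \<open>P\<close> on its rows, so a coercive \<open>S\<close> makes the Sylvester operator
  \<open>W \<mapsto> S W + W P\<close> bounded below, uniformly in the positive semidefinite matrix \<open>P\<close>.\<close>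

lemma sylvester_bound:
  assumes S: "S \<in> carrier_mat n n" and P: "P \<in> carrier_mat n n" and W: "W \<in> carrier_mat n n"
    and s: "s > 0" "\<And>f. s * (\<Sum>i<n. (f i)\<^sup>2) \<le> quad_form n S f"
    and P0: "\<And>f. 0 \<le> quad_form n P f"
  shows "s\<^sup>2 * (\<Sum>i<n. \<Sum>j<n. (W $$ (i,j))\<^sup>2) \<le> (\<Sum>i<n. \<Sum>j<n. ((S * W + W * P) $$ (i,j))\<^sup>2)"
proof -
  let ?Z = "S * W + W * P"
  have Z: "?Z $$ (i,j) = (\<Sum>k<n. S $$ (i,k) * W $$ (k,j)) + (\<Sum>k<n. W $$ (i,k) * P $$ (k,j))"
    if "i < n" "j < n" for i j
  proof -
    have "?Z $$ (i,j) = (S * W) $$ (i,j) + (W * P) $$ (i,j)"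
      using W P that by (intro index_add_mat) auto
    then show ?thesis
      using that by (simp only: index_mult_mat_sum[OF S W] index_mult_mat_sum[OF W P])
  qed
  have "(\<Sum>i<n. \<Sum>j<n. W $$ (i,j) * ?Z $$ (i,j))
      = (\<Sum>i<n. \<Sum>j<n. \<Sum>k<n. W $$ (i,j) * S $$ (i,k) * W $$ (k,j))
      + (\<Sum>i<n. \<Sum>j<n. \<Sum>k<n. W $$ (i,k) * P $$ (k,j) * W $$ (i,j))"
    unfolding sum.distrib[symmetric]
    by (intro sum.cong refl) (simp add: Z sum_distrib_left sum.distrib mult_ac distrib_left)
  also have "(\<Sum>i<n. \<Sum>j<n. \<Sum>k<n. W $$ (i,j) * S $$ (i,k) * W $$ (k,j))
      = (\<Sum>j<n. quad_form n S (\<lambda>i. W $$ (i,j)))"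
    unfolding quad_form_def by (rule sum.swap)
  also have "(\<Sum>i<n. \<Sum>j<n. \<Sum>k<n. W $$ (i,k) * P $$ (k,j) * W $$ (i,j))
      = (\<Sum>i<n. quad_form n P (\<lambda>k. W $$ (i,k)))"
    unfolding quad_form_def by (intro sum.cong refl sum.swap)
  finally have eq: "(\<Sum>i<n. \<Sum>j<n. W $$ (i,j) * ?Z $$ (i,j))
      = (\<Sum>j<n. quad_form n S (\<lambda>i. W $$ (i,j))) + (\<Sum>i<n. quad_form n P (\<lambda>k. W $$ (i,k)))" .
  have "s * (\<Sum>i<n. \<Sum>j<n. (W $$ (i,j))\<^sup>2) = (\<Sum>j<n. s * (\<Sum>i<n. (W $$ (i,j))\<^sup>2))"
    by (subst sum.swap) (simp add: sum_distrib_left)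
  also have "\<dots> \<le> (\<Sum>j<n. quad_form n S (\<lambda>i. W $$ (i,j)))"
    by (intro sum_mono s(2))
  also have "\<dots> \<le> (\<Sum>i<n. \<Sum>j<n. W $$ (i,j) * ?Z $$ (i,j))"
    unfolding eq using P0 by (simp add: sum_nonneg)
  finally have low: "s * (\<Sum>i<n. \<Sum>j<n. (W $$ (i,j))\<^sup>2) \<le> (\<Sum>i<n. \<Sum>j<n. W $$ (i,j) * ?Z $$ (i,j))" .
  have "2 * s * (\<Sum>i<n. \<Sum>j<n. W $$ (i,j) * ?Z $$ (i,j))
      \<le> (\<Sum>i<n. \<Sum>j<n. s\<^sup>2 * (W $$ (i,j))\<^sup>2 + (?Z $$ (i,j))\<^sup>2)"
    unfolding sum_distrib_left
  proof (intro sum_mono)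
    fix i j
    have "0 \<le> (s * W $$ (i,j) - ?Z $$ (i,j))\<^sup>2" by simp
    then show "2 * s * (W $$ (i,j) * ?Z $$ (i,j)) \<le> s\<^sup>2 * (W $$ (i,j))\<^sup>2 + (?Z $$ (i,j))\<^sup>2"
      by (simp add: power2_diff power_mult_distrib mult_ac)
  qed
  also have "\<dots> = s\<^sup>2 * (\<Sum>i<n. \<Sum>j<n. (W $$ (i,j))\<^sup>2) + (\<Sum>i<n. \<Sum>j<n. (?Z $$ (i,j))\<^sup>2)"
    by (simp add: sum.distrib sum_distrib_left)
  finally have up: "2 * s * (\<Sum>i<n. \<Sum>j<n. W $$ (i,j) * ?Z $$ (i,j))
    \<le> s\<^sup>2 * (\<Sum>i<n. \<Sum>j<n. (W $$ (i,j))\<^sup>2) + (\<Sum>i<n. \<Sum>j<n. (?Z $$ (i,j))\<^sup>2)" .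
  have "2 * s * (s * (\<Sum>i<n. \<Sum>j<n. (W $$ (i,j))\<^sup>2)) \<le> 2 * s * (\<Sum>i<n. \<Sum>j<n. W $$ (i,j) * ?Z $$ (i,j))"
    using low s(1) by (intro mult_left_mono) auto
  with up show ?thesis by (simp add: power2_eq_square)
qed

lemma sylvester_tendsto_zero:
  fixes W P :: "real \<Rightarrow> real mat"
  assumes S: "S \<in> pd_mats n" and P: "\<And>t. P t \<in> psd_mats n" and W: "\<And>t. W t \<in> carrier_mat n n"
    and Z: "\<And>i j. i < n \<Longrightarrow> j < n \<Longrightarrow> ((\<lambda>t. (S * W t + W t * P t) $$ (i,j)) \<longlongrightarrow> 0) F"
    and ij: "i < n" "j < n"
  shows "((\<lambda>t. W t $$ (i,j)) \<longlongrightarrow> 0) F"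
proof -
  obtain s where s: "s > 0" "\<And>f. s * (\<Sum>i<n. (f i)\<^sup>2) \<le> quad_form n S f" using pd_coercive[OF S] by blast
  define z where "z t = (\<Sum>i<n. \<Sum>j<n. ((S * W t + W t * P t) $$ (i,j))\<^sup>2) / s\<^sup>2" for t
  have "(z \<longlongrightarrow> (\<Sum>i<n. \<Sum>j<n. 0\<^sup>2) / s\<^sup>2) F"
    unfolding z_def using s(1) by (intro tendsto_intros Z) auto
  then have z: "(z \<longlongrightarrow> 0) F" by simp
  have le: "(W t $$ (i,j))\<^sup>2 \<le> z t" for t
  proof -
    have "(W t $$ (i,j))\<^sup>2 \<le> (\<Sum>j<n. (W t $$ (i,j))\<^sup>2)"
      using ij by (intro member_le_sum) auto
    also have "\<dots> \<le> (\<Sum>i<n. \<Sum>j<n. (W t $$ (i,j))\<^sup>2)"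
      using ij by (intro member_le_sum[of i _ "\<lambda>i. \<Sum>j<n. (W t $$ (i,j))\<^sup>2"]) (auto intro: sum_nonneg)
    also have "\<dots> \<le> z t"
      using sylvester_bound[OF pd_mats_carrier[OF S] psd_mats_carrier[OF P] W s, of t t] P s(1)
      by (simp add: z_def pos_le_divide_eq mult.commute psd_mats_quad_form)
    finally show ?thesis .
  qed
  have "((\<lambda>t. (W t $$ (i,j))\<^sup>2) \<longlongrightarrow> 0) F"
    by (rule tendsto_sandwich[OF _ _ tendsto_const z]) (auto simp: le)
  then have "((\<lambda>t. sqrt ((W t $$ (i,j))\<^sup>2)) \<longlongrightarrow> sqrt 0) F" by (rule tendsto_real_sqrt)
  then show ?thesis by (simp add: tendsto_rabs_zero_iff)
qed

lemma sylvester_solution: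
  assumes S: "S \<in> pd_mats n" and K: "K \<in> carrier_mat n n"
  obtains L where "L \<in> carrier_mat n n" "S * L + L * S = K"
proof -
  obtain U l where U: "orth_mat n U" "S = conj_diag n U l" "\<And>i. i < n \<Longrightarrow> 0 < l i"
    using pd_mat_decompose[OF S] by blast
  have c: "U \<in> carrier_mat n n" "U\<^sup>T \<in> carrier_mat n n" using U(1) by (auto simp: orth_mat_def)
  note m = square_mult[where n = n]
  define M where "M = U\<^sup>T * K * U"
  have Mc: "M \<in> carrier_mat n n" using K c by (simp add: M_def m)
  \<comment> \<open>in the eigenbasis of \<open>S\<close> the Sylvester operator multiplies entry \<open>(i,j)\<close> by \<open>l i + l j\<close>\<close>
  define Y where "Y = Matrix.mat n n (\<lambda>(i,j). M $$ (i,j) / (l i + l j))"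
  have Yc: "Y \<in> carrier_mat n n" by (simp add: Y_def)
  define L where "L = U * Y * U\<^sup>T"
  have Lc: "L \<in> carrier_mat n n" using Yc c by (simp add: L_def m)
  have UU: "U\<^sup>T * U = 1\<^sub>m n" using U(1) by (simp add: orth_mat_def)
  have "S * L = U * mat_diag n l * 1\<^sub>m n * Y * U\<^sup>T"
    unfolding U(2) conj_diag_def L_def UU[symmetric] using c Yc by (simp add: m)
  then have SL: "S * L = U * (mat_diag n l * Y) * U\<^sup>T"
    using c Yc by (simp add: m right_mult_one_mat[of _ n n] left_mult_one_mat[of _ n n])
  have "L * S = U * Y * 1\<^sub>m n * mat_diag n l * U\<^sup>T"
    unfolding U(2) conj_diag_def L_def UU[symmetric] using c Yc by (simp add: m)
  then have LS: "L * S = U * (Y * mat_diag n l) * U\<^sup>T"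
    using c Yc by (simp add: m right_mult_one_mat[of _ n n] left_mult_one_mat[of _ n n])
  have sum: "mat_diag n l * Y + Y * mat_diag n l = M"
  proof (rule eq_matI)
    fix i j assume "i < dim_row M" "j < dim_col M"
    then have ij: "i < n" "j < n" using Mc by auto
    then have "l i + l j \<noteq> 0" using U(3)[of i] U(3)[of j] by simp
    then have "l i * (M $$ (i,j) / (l i + l j)) + M $$ (i,j) / (l i + l j) * l j = M $$ (i,j)"
      by (simp add: divide_simps) (simp add: algebra_simps)
    then show "(mat_diag n l * Y + Y * mat_diag n l) $$ (i,j) = M $$ (i,j)"
      unfolding mat_diag_mult_left[OF Yc] mat_diag_mult_right[OF Yc] using ij by (simp add: Y_def)
  qed (use Mc Yc in auto)
  have "S * L + L * S = U * (mat_diag n l * Y + Y * mat_diag n l) * U\<^sup>T"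
    unfolding SL LS using c Yc mat_diag_dim[of n l]
    by (simp add: mult_add_distrib_mat[of _ n n _ n] add_mult_distrib_mat[of _ n n _ _ n] m)
  also have "\<dots> = (U * U\<^sup>T) * K * (U * U\<^sup>T)"
    unfolding sum M_def using K c by (simp add: m)
  also have "\<dots> = K" using U(1) K by (simp add: orth_mat_def)
  finally show ?thesis using that[OF Lc] by simp
qed

text \<open>Subtracting \<open>S\<^sub>0 L + L S\<^sub>0 = A'\<close> from the difference quotient of \<open>S\<^sub>t S\<^sub>t = A\<^sub>t\<close> leaves a Sylvester
  equation for the error whose right-hand side tends to \<open>0\<close>; the same bound, applied to
  \<open>S\<^sub>t - S\<^sub>0\<close> first, gives the continuity that this needs.\<close>

lemma mat_deriv_psd_sqrt:
  assumes A: "mat_deriv n A A'" and pd: "\<And>t. A t \<in> pd_mats n"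
    and L: "L \<in> carrier_mat n n" "psd_sqrt (A 0) * L + L * psd_sqrt (A 0) = A'"
  shows "mat_deriv n (\<lambda>t. psd_sqrt (A t)) L"
proof -
  define S where "S t = psd_sqrt (A t)" for t
  have Spd: "S t \<in> pd_mats n" for t unfolding S_def by (rule psd_sqrt_pd[OF pd])
  have Sc: "S t \<in> carrier_mat n n" for t using Spd by (rule pd_mats_carrier)
  have SS: "S t * S t = A t" for t unfolding S_def by (rule psd_sqrt_psd(2)[OF pd_mats_imp_psd[OF pd]])
  have Ac: "A t \<in> carrier_mat n n" for t using A by (rule mat_derivD)
  define D where "D t = S t - S 0" for t
  have Dc: "D t \<in> carrier_mat n n" for t using Sc by (simp add: D_def minus_carrier_mat)
  have eqD: "S 0 * D t + D t * S t = A t - A 0" for t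
  proof -
    have "S 0 * D t = S 0 * S t - A 0" unfolding D_def SS[symmetric]
      by (rule mult_minus_distrib_mat[OF Sc Sc Sc])
    moreover have "D t * S t = A t - S 0 * S t" unfolding D_def SS[symmetric]
      by (rule minus_mult_distrib_mat[OF Sc Sc Sc])
    ultimately show ?thesis
      using Sc[of 0] Sc[of t] Ac[of t] Ac[of 0] by (intro eq_matI) auto
  qed
  have D0: "((\<lambda>t. D t $$ (i,j)) \<longlongrightarrow> 0) (at_right 0)" if "i < n" "j < n" for i j
  proof (rule sylvester_tendsto_zero[where P = S, OF Spd[of 0] pd_mats_imp_psd[OF Spd] Dc _ that])
    fix i j assume ij: "i < n" "j < n"
    then have "(\<lambda>t. (S 0 * D t + D t * S t) $$ (i,j)) = (\<lambda>t. A t $$ (i,j) - A 0 $$ (i,j))"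
      unfolding eqD using Ac[of 0, THEN carrier_matD(1)] Ac[of 0, THEN carrier_matD(2)] by (intro ext) simp
    then show "((\<lambda>t. (S 0 * D t + D t * S t) $$ (i,j)) \<longlongrightarrow> 0) (at_right 0)"
      using mat_deriv_diff_tendsto[OF A ij] by simp
  qed
  define W where "W t = (1 / t) \<cdot>\<^sub>m D t - L" for t
  have Wc: "W t \<in> carrier_mat n n" for t using Dc L by (simp add: W_def minus_carrier_mat)
  have eqW: "S 0 * W t + W t * S t = (1 / t) \<cdot>\<^sub>m (A t - A 0) - A' - L * D t" for t
  proof -
    have t: "(1 / t) \<cdot>\<^sub>m D t \<in> carrier_mat n n" using Dc by simp
    have rearrange: "(M - T1) + (N - T2) = (M + N) - (T1 + T3) - (T2 - T3)"
      if "M \<in> carrier_mat n n" "N \<in> carrier_mat n n" "T1 \<in> carrier_mat n n" "T2 \<in> carrier_mat n n"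
        "T3 \<in> carrier_mat n n" for M N T1 T2 T3 :: "real mat"
      using that by (intro eq_matI) auto
    have "S 0 * W t = (1 / t) \<cdot>\<^sub>m (S 0 * D t) - S 0 * L"
      unfolding W_def mult_minus_distrib_mat[OF Sc t L(1)] by (simp add: mult_smult_distrib[OF Sc Dc])
    moreover have "W t * S t = (1 / t) \<cdot>\<^sub>m (D t * S t) - L * S t"
      unfolding W_def minus_mult_distrib_mat[OF t L(1) Sc] by (simp add: mult_smult_assoc_mat[OF Dc Sc])
    moreover have "L * D t = L * S t - L * S 0" unfolding D_def
      by (rule mult_minus_distrib_mat[OF L(1) Sc Sc])
    moreover have "(1 / t) \<cdot>\<^sub>m (A t - A 0) = (1 / t) \<cdot>\<^sub>m (S 0 * D t) + (1 / t) \<cdot>\<^sub>m (D t * S t)"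
      unfolding eqD[symmetric] using Sc Dc
      by (intro add_smult_distrib_left_mat[of _ n n]) (auto intro: mult_carrier_mat)
    moreover have "A' = S 0 * L + L * S 0" using L(2) by (simp add: S_def)
    moreover have "S 0 * D t \<in> carrier_mat n n" "D t * S t \<in> carrier_mat n n" "L * S t \<in> carrier_mat n n"
      "S 0 * L \<in> carrier_mat n n" "L * S 0 \<in> carrier_mat n n"
      using Sc Dc L(1) by (auto intro: mult_carrier_mat)
    moreover note rearrange[of "(1 / t) \<cdot>\<^sub>m (S 0 * D t)" "(1 / t) \<cdot>\<^sub>m (D t * S t)" "S 0 * L" "L * S t" "L * S 0"]
    ultimately show ?thesis by (simp only: smult_carrier_mat)
  qed
  have W0: "((\<lambda>t. W t $$ (i,j)) \<longlongrightarrow> 0) (at_right 0)" if "i < n" "j < n" for i j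
  proof (rule sylvester_tendsto_zero[where P = S, OF Spd[of 0] pd_mats_imp_psd[OF Spd] Wc _ that])
    fix i j assume ij: "i < n" "j < n"
    have e: "(S 0 * W t + W t * S t) $$ (i,j)
        = (A t $$ (i,j) - A 0 $$ (i,j)) / t - A' $$ (i,j) - (\<Sum>k<n. L $$ (i,k) * D t $$ (k,j))" for t
      unfolding eqW using ij Ac[of t] Ac[of 0] mat_derivD(2)[OF A] mult_carrier_mat[OF L(1) Dc[of t]]
        carrier_matD[OF L(1)] carrier_matD[OF Dc[of t]]
      by (simp add: index_mult_mat_sum[OF L(1) Dc ij] del: index_mult_mat)
    have "((\<lambda>t. (A t $$ (i,j) - A 0 $$ (i,j)) / t - A' $$ (i,j) - (\<Sum>k<n. L $$ (i,k) * D t $$ (k,j)))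
        \<longlongrightarrow> A' $$ (i,j) - A' $$ (i,j) - (\<Sum>k<n. L $$ (i,k) * 0)) (at_right 0)"
      using ij by (intro tendsto_intros mat_deriv_quotient[OF A] D0) auto
    then show "((\<lambda>t. (S 0 * W t + W t * S t) $$ (i,j)) \<longlongrightarrow> 0) (at_right 0)"
      unfolding e by simp
  qed
  show ?thesis unfolding mat_deriv_def S_def[symmetric]
  proof (intro conjI allI impI Sc L(1))
    fix i j assume ij: "i < n" "j < n"
    have "W t $$ (i,j) + L $$ (i,j) = (S t $$ (i,j) - S 0 $$ (i,j)) / t" for t
      using ij L(1) Sc[of t] Sc[of 0] by (simp add: W_def D_def)
    moreover have "((\<lambda>t. W t $$ (i,j) + L $$ (i,j)) \<longlongrightarrow> 0 + L $$ (i,j)) (at_right 0)"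
      by (intro tendsto_intros W0 ij)
    ultimately show "((\<lambda>t. S t $$ (i,j)) has_real_derivative L $$ (i,j)) (at_right 0)"
      by (simp add: has_field_derivative_iff)
  qed
qed

section \<open>Derivatives of traces of square roots\<close>

text \<open>Multiply the equation by \<open>S\<^sup>-\<^sup>1\<close> and use cyclicity: both terms on the left contribute \<open>tr L\<close>.\<close>

lemma tr_sylvester:
  assumes S: "S \<in> pd_mats n" and L: "L \<in> carrier_mat n n" "S * L + L * S = K"
  shows "tr L = 1 / 2 * tr (mat_inv S * K)"
proof -
  let ?I = "mat_inv S"
  have c: "S \<in> carrier_mat n n" "?I \<in> carrier_mat n n"
    using S mat_inv_pd(1)[OF S] pd_mats_carrier by auto
  note m = square_mult[where n = n]
  have "?I * K = (?I * S) * L + ?I * L * S"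
    unfolding L(2)[symmetric] using c L(1) by (simp add: m mult_add_distrib_mat[of _ n n _ n])
  then have "tr (?I * K) = tr L + tr (?I * L * S)"
    using c L(1) by (simp add: mat_inv_pd(3)[OF S] tr_add[of _ n] m)
  also have "tr (?I * L * S) = tr ((S * ?I) * L)"
    using c L(1) by (subst tr_mult_comm[of _ n n]) (auto simp: m)
  also have "\<dots> = tr L" using L(1) by (simp add: mat_inv_pd(2)[OF S])
  finally show ?thesis by simp
qed

lemma tr_psd_sqrt_deriv:
  assumes A: "mat_deriv n A A'" and pd: "\<And>t. A t \<in> pd_mats n"
  shows "((\<lambda>t. tr (psd_sqrt (A t))) has_real_derivative 1 / 2 * tr (inv_sqrt (A 0) * A')) (at_right 0)"
proof -
  have S: "psd_sqrt (A 0) \<in> pd_mats n" by (rule psd_sqrt_pd[OF pd])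
  obtain L where L: "L \<in> carrier_mat n n" "psd_sqrt (A 0) * L + L * psd_sqrt (A 0) = A'"
    using sylvester_solution[OF S mat_derivD(2)[OF A]] by blast
  show ?thesis
    using mat_deriv_tr[OF mat_deriv_psd_sqrt[OF A pd L]] tr_sylvester[OF S L]
    by (simp add: inv_sqrt_def)
qed

lemma pd_conj:
  assumes A: "A \<in> pd_mats n" and S: "S \<in> pd_mats n"
  shows "S * A * S \<in> pd_mats n"
proof -
  have c: "S \<in> carrier_mat n n" "A \<in> carrier_mat n n" "S\<^sup>T = S"
    using A S by (auto simp: pd_mats_def sym_mats_def)
  have "S * A * S \<in> psd_mats n" using psd_conj[OF pd_mats_imp_psd[OF A] c(1)] c(3) by simp
  moreover have "0 < scalar_prod v (S * A * S *\<^sub>v v)" if v: "v \<in> carrier_vec n" "v \<noteq> 0\<^sub>v n" for v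
  proof -
    define w where "w = S *\<^sub>v v"
    have w: "w \<in> carrier_vec n" using c v by (simp add: w_def)
    have "mat_inv S *\<^sub>v w = v"
      using v(1) c(1) mat_inv_pd[OF S]
      by (simp add: w_def pd_mats_carrier flip: assoc_mult_mat_vec[of _ n n _ n])
    then have "w \<noteq> 0\<^sub>v n"
      using v(2) pd_mats_carrier[OF mat_inv_pd(1)[OF S]] by auto
    then have "0 < scalar_prod w (A *\<^sub>v w)" using A w by (simp add: pd_mats_def)
    also have "\<dots> = scalar_prod v (S *\<^sub>v (A *\<^sub>v w))"
      using transpose_vec_mult_scalar[OF c(1) _ v(1), of "A *\<^sub>v w"] mult_mat_vec_carrier[OF c(2) w]
      by (simp add: c(3) w_def)
    also have "S *\<^sub>v (A *\<^sub>v w) = S * A * S *\<^sub>v v"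
      using c v by (simp add: w_def assoc_mult_mat_vec[of _ n n _ n])
    finally show ?thesis .
  qed
  ultimately show ?thesis by (simp add: pd_mats_def psd_mats_def)
qed

text \<open>Differentiating \<open>X = S A S\<close> with \<open>S\<^sup>2 = B\<close>, the contributions of \<open>S'\<close> combine, using
  \<open>A S = S\<^sup>-\<^sup>1 X\<close> and cyclicity of the trace, into the trace of \<open>J (S S' + S' S) = J B'\<close>, where \<open>J\<close> is
  the optimal transport map from \<open>B\<close> to \<open>A\<close>.\<close>

lemma tr_fidelity_deriv:
  assumes A: "mat_deriv n A A'" and B: "mat_deriv n B B'"
    and Apd: "\<And>t. A t \<in> pd_mats n" and Bpd: "\<And>t. B t \<in> pd_mats n"
  defines "J \<equiv> inv_sqrt (B 0) * psd_sqrt (psd_sqrt (B 0) * A 0 * psd_sqrt (B 0)) * inv_sqrt (B 0)"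
  shows "((\<lambda>t. tr (psd_sqrt (psd_sqrt (B t) * A t * psd_sqrt (B t)))) has_real_derivative
    1 / 2 * (tr (J * B') + tr (mat_inv J * A'))) (at_right 0)"
    and "J \<in> pd_mats n"
proof -
  define S where "S t = psd_sqrt (B t)" for t
  define X where "X t = S t * A t * S t" for t
  define Y where "Y = psd_sqrt (X 0)"
  define Si where "Si = mat_inv (S 0)"
  define Yi where "Yi = mat_inv Y"
  have Spd: "S t \<in> pd_mats n" for t unfolding S_def by (rule psd_sqrt_pd[OF Bpd])
  have Xpd: "X t \<in> pd_mats n" for t unfolding X_def by (rule pd_conj[OF Apd Spd])
  have Ypd: "Y \<in> pd_mats n" unfolding Y_def by (rule psd_sqrt_pd[OF Xpd])
  note Sinv = mat_inv_pd[OF Spd[of 0], folded Si_def]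
  note Yinv = mat_inv_pd[OF Ypd, folded Yi_def]
  have J: "J = Si * Y * Si" by (simp add: J_def Si_def Y_def X_def S_def inv_sqrt_def)
  show Jpd: "J \<in> pd_mats n" unfolding J by (rule pd_conj[OF Ypd Sinv(1)])
  obtain S' where S': "S' \<in> carrier_mat n n" "S 0 * S' + S' * S 0 = B'"
    using sylvester_solution[OF Spd[of 0] mat_derivD(2)[OF B]] by blast
  have Sd: "mat_deriv n S S'"
    unfolding S_def using mat_deriv_psd_sqrt[OF B Bpd S'(1)] S'(2) by (simp add: S_def)
  have c: "S 0 \<in> carrier_mat n n" "Si \<in> carrier_mat n n" "Y \<in> carrier_mat n n" "Yi \<in> carrier_mat n n"
    "A 0 \<in> carrier_mat n n" "A' \<in> carrier_mat n n" "S' \<in> carrier_mat n n"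
    using Spd Sinv(1) Ypd Yinv(1) Apd pd_mats_carrier mat_derivD(2)[OF A] S'(1) by auto
  note m = square_mult[where n = n]
  note one = right_mult_one_mat[of _ n n] left_mult_one_mat[of _ n n]
  have cyc: "tr (M * N) = tr (N * M)" if "M \<in> carrier_mat n n" "N \<in> carrier_mat n n" for M N
    using that by (rule tr_mult_comm)
  have YY: "Y * Y = S 0 * A 0 * S 0"
    unfolding Y_def using psd_sqrt_psd(2)[OF pd_mats_imp_psd[OF Xpd]] by (simp add: X_def)
  have AS: "A 0 * S 0 = Si * (Y * Y)"
  proof -
    have "Si * (Y * Y) = (Si * S 0) * (A 0 * S 0)" unfolding YY using c by (simp add: m)
    then show ?thesis using c by (simp add: Sinv one m)
  qed
  have SA: "S 0 * A 0 = Y * Y * Si"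
  proof -
    have "Y * Y * Si = S 0 * A 0 * (S 0 * Si)" unfolding YY using c by (simp add: m)
    then show ?thesis using c by (simp add: Sinv one m)
  qed
  have Jinv: "mat_inv J = S 0 * Yi * S 0"
  proof (rule mat_inv_eqI)
    have "J * (S 0 * Yi * S 0) = Si * (Y * ((Si * S 0) * Yi)) * S 0" unfolding J using c by (simp add: m)
    also have "\<dots> = 1\<^sub>m n" using c by (simp add: Sinv Yinv one)
    finally show "J * (S 0 * Yi * S 0) = 1\<^sub>m n" .
  qed (use Jpd pd_mats_carrier c in \<open>auto simp: m\<close>)
  define X' where "X' = (S' * A 0 + S 0 * A') * S 0 + S 0 * A 0 * S'"
  have "mat_deriv n X X'"
    unfolding X_def X'_def by (rule mat_deriv_mult[OF mat_deriv_mult[OF Sd A] Sd])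
  from tr_psd_sqrt_deriv[OF this Xpd]
  have der: "((\<lambda>t. tr (psd_sqrt (X t))) has_real_derivative 1 / 2 * tr (Yi * X')) (at_right 0)"
    by (simp add: inv_sqrt_def Yi_def Y_def)
  have "Yi * X' = Yi * (S' * (A 0 * S 0)) + Yi * (S 0 * A' * S 0) + Yi * (S 0 * A 0 * S')"
    unfolding X'_def using c
    by (simp add: m mult_add_distrib_mat[of _ n n _ n] add_mult_distrib_mat[of _ n n _ _ n])
  then have "tr (Yi * X') = tr (Yi * (S' * (A 0 * S 0))) + tr (Yi * (S 0 * A' * S 0)) + tr (Yi * (S 0 * A 0 * S'))"
    using c by (simp add: tr_add[of _ n] m)
  also have "tr (Yi * (S' * (A 0 * S 0))) = tr (Si * Y * S')"
  proof -
    have "tr (Yi * (S' * (A 0 * S 0))) = tr ((Yi * S' * Si * Y) * Y)" unfolding AS using c by (simp add: m)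
    also have "\<dots> = tr (Y * (Yi * S' * Si * Y))" using c by (intro cyc) (auto simp: m)
    also have "Y * (Yi * S' * Si * Y) = (Y * Yi) * (S' * (Si * Y))" using c by (simp add: m)
    also have "\<dots> = S' * (Si * Y)" using c by (simp add: Yinv one m)
    also have "tr \<dots> = tr (Si * Y * S')" using c by (intro cyc) (auto simp: m)
    finally show ?thesis .
  qed
  also have "tr (Yi * (S 0 * A' * S 0)) = tr (mat_inv J * A')"
  proof -
    have "tr (Yi * (S 0 * A' * S 0)) = tr ((Yi * S 0 * A') * S 0)" using c by (simp add: m)
    also have "\<dots> = tr (S 0 * (Yi * S 0 * A'))" using c by (intro cyc) (auto simp: m)
    finally show ?thesis unfolding Jinv using c by (simp add: m)
  qed
  also have "Yi * (S 0 * A 0 * S') = Y * Si * S'"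
  proof -
    have "Yi * (S 0 * A 0 * S') = (Yi * Y) * (Y * (Si * S'))" unfolding SA using c by (simp add: m)
    then show ?thesis using c by (simp add: Yinv one m)
  qed
  also have "tr (Si * Y * S') + tr (mat_inv J * A') + tr (Y * Si * S') = tr (J * B') + tr (mat_inv J * A')"
  proof -
    have "J * B' = Si * Y * ((Si * S 0) * S') + (Si * Y * Si * S') * S 0"
      unfolding J S'(2)[symmetric] using c by (simp add: m mult_add_distrib_mat[of _ n n _ n])
    then have "tr (J * B') = tr (Si * Y * S') + tr ((Si * Y * Si * S') * S 0)"
      using c by (simp add: tr_add[of _ n] Sinv one m)
    also have "tr ((Si * Y * Si * S') * S 0) = tr (S 0 * (Si * Y * Si * S'))"
      using c by (intro cyc) (auto simp: m)
    also have "S 0 * (Si * Y * Si * S') = (S 0 * Si) * (Y * Si * S')" using c by (simp add: m)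
    also have "\<dots> = Y * Si * S'" using c by (simp add: Sinv one m)
    finally show ?thesis by simp
  qed
  finally show "((\<lambda>t. tr (psd_sqrt (psd_sqrt (B t) * A t * psd_sqrt (B t)))) has_real_derivative
    1 / 2 * (tr (J * B') + tr (mat_inv J * A'))) (at_right 0)"
    using der by (simp add: X_def S_def)
qed

section \<open>Derivatives of simple eigenvalues\<close>

lemma quad_form_diff_le:
  "quad_form n A f - quad_form n B f
    \<le> (\<Sum>i<n. \<Sum>j<n. \<bar>A $$ (i,j) - B $$ (i,j)\<bar>) * (\<Sum>i<n. (f i)\<^sup>2)"
proof -
  define N where "N = (\<Sum>i<n. (f i)\<^sup>2)"
  have le: "(f i)\<^sup>2 \<le> N" if "i < n" for i unfolding N_def using that by (intro member_le_sum) auto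
  have "quad_form n A f - quad_form n B f = (\<Sum>i<n. \<Sum>j<n. f i * (A $$ (i,j) - B $$ (i,j)) * f j)"
    by (simp add: quad_form_def sum_subtractf algebra_simps)
  also have "\<dots> \<le> (\<Sum>i<n. \<Sum>j<n. \<bar>A $$ (i,j) - B $$ (i,j)\<bar> * N)"
  proof (intro sum_mono)
    fix i j assume "i \<in> {..<n}" "j \<in> {..<n}"
    then have "\<bar>f i\<bar> * \<bar>f j\<bar> \<le> N"
      using sum_squares_bound[of "\<bar>f i\<bar>" "\<bar>f j\<bar>"] le[of i] le[of j] by simp
    then have "\<bar>A $$ (i,j) - B $$ (i,j)\<bar> * (\<bar>f i\<bar> * \<bar>f j\<bar>) \<le> \<bar>A $$ (i,j) - B $$ (i,j)\<bar> * N"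
      by (intro mult_left_mono) auto
    moreover have "f i * (A $$ (i,j) - B $$ (i,j)) * f j \<le> \<bar>f i * (A $$ (i,j) - B $$ (i,j)) * f j\<bar>"
      by simp
    ultimately show "f i * (A $$ (i,j) - B $$ (i,j)) * f j \<le> \<bar>A $$ (i,j) - B $$ (i,j)\<bar> * N"
      by (simp add: abs_mult mult_ac)
  qed
  finally show ?thesis by (simp add: N_def sum_distrib_right)
qed

text \<open>In the eigenbasis of the matrix, the first \<open>k\<close> vectors of any other orthonormal basis spread a total
  weight of \<open>k\<close> over the eigenvalues, with at most 1 on each.\<close>

lemma ky_fan:
  assumes V: "orth_mat n V" and W: "orth_mat n W"
    and dec: "\<And>i j. i \<le> j \<Longrightarrow> j < n \<Longrightarrow> l j \<le> l i" and k: "k \<le> n"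
  shows "(\<Sum>i<k. quad_form n (conj_diag n V l) (\<lambda>r. W $$ (r,i))) \<le> (\<Sum>i<k. l i)"
proof -
  define Q where "Q i m = (\<Sum>r<n. W $$ (r,i) * V $$ (r,m))" for i m
  have rows: "(\<Sum>m<n. (Q i m)\<^sup>2) = 1" if "i < n" for i
    unfolding Q_def parseval[OF V] using orth_mat_cols[OF W that that] by (simp add: power2_eq_square)
  have cols: "(\<Sum>i<n. (Q i m)\<^sup>2) = 1" if "m < n" for m
    unfolding Q_def using parseval[OF W, of "\<lambda>r. V $$ (r,m)"] orth_mat_cols[OF V that that]
    by (simp add: power2_eq_square mult.commute)
  define w where "w m = (\<Sum>i<k. (Q i m)\<^sup>2)" for m
  have "(\<Sum>i<k. quad_form n (conj_diag n V l) (\<lambda>r. W $$ (r,i))) = (\<Sum>i<k. \<Sum>m<n. l m * (Q i m)\<^sup>2)"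
    by (simp add: quad_form_conj_diag[OF orth_mat_carrier[OF V]] Q_def)
  also have "\<dots> = (\<Sum>m<n. w m * l m)"
    by (subst sum.swap) (simp add: w_def sum_distrib_left sum_distrib_right mult.commute)
  also have "\<dots> \<le> (\<Sum>i<k. l i)"
  proof (cases "k < n")
    case True
    have "(\<Sum>m<n. w m) = (\<Sum>i<k. \<Sum>m<n. (Q i m)\<^sup>2)" unfolding w_def by (rule sum.swap)
    also have "\<dots> = k" using rows True by simp
    finally have wk: "(\<Sum>m<n. w m) = k" .
    have "w m \<le> 1" if "m < n" for m
    proof -
      have "w m \<le> (\<Sum>i<n. (Q i m)\<^sup>2)" unfolding w_def using True by (intro sum_mono2) auto
      then show ?thesis using cols[OF that] by simp
    qed
    moreover have "0 \<le> w m" for m by (simp add: w_def sum_nonneg)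
    ultimately show ?thesis using dec True wk by (intro weighted_sum_le_top_sum) auto
  next
    case False
    then have "k = n" using k by simp
    then show ?thesis using cols by (simp add: w_def)
  qed
  finally show ?thesis .
qed

lemma orth_mat_entry_le:
  assumes "orth_mat n U" "i < n" "j < n"
  shows "\<bar>U $$ (i,j)\<bar> \<le> 1"
proof -
  have "(U $$ (i,j))\<^sup>2 \<le> (\<Sum>k<n. (U $$ (k,j))\<^sup>2)"
    using assms by (intro member_le_sum) auto
  also have "\<dots> = 1" using orth_mat_cols[OF assms(1,3,3)] by (simp add: power2_eq_square)
  finally show ?thesis by (simp add: abs_square_le_1)
qed

context
  fixes n :: nat and A V :: "real \<Rightarrow> real mat" and A' :: "real mat" and l :: "real \<Rightarrow> nat \<Rightarrow> real"
  assumes A: "mat_deriv n A A'"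
    and V: "\<And>t. orth_mat n (V t)" and AV: "\<And>t. A t = conj_diag n (V t) (l t)"
    and dec: "\<And>t i j. i \<le> j \<Longrightarrow> j < n \<Longrightarrow> l t j \<le> l t i"
begin

text \<open>Ky Fan's inequality for \<open>A t\<close> with the eigenbasis of \<open>A 0\<close>, and for \<open>A 0\<close> with the eigenbasis of
  \<open>A t\<close>, encloses the sum of the \<open>k\<close> largest eigenvalues of \<open>A t\<close>.\<close>

lemma top_eigenvalue_sum_tendsto:
  assumes k: "k \<le> n"
  shows "((\<lambda>t. \<Sum>i<k. l t i) \<longlongrightarrow> (\<Sum>i<k. l 0 i)) (at_right 0)"
proof -
  define \<epsilon> where "\<epsilon> s t = (\<Sum>i<n. \<Sum>j<n. \<bar>A s $$ (i,j) - A t $$ (i,j)\<bar>)" for s t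
  have "((\<lambda>t. \<epsilon> t 0) \<longlongrightarrow> (\<Sum>i<n. \<Sum>j<n. \<bar>0\<bar>)) (at_right 0)"
    unfolding \<epsilon>_def by (intro tendsto_intros mat_deriv_diff_tendsto[OF A]) auto
  then have \<epsilon>: "((\<lambda>t. \<epsilon> t 0) \<longlongrightarrow> 0) (at_right 0)" by simp
  have \<epsilon>_sym: "\<epsilon> 0 t = \<epsilon> t 0" for t by (simp add: \<epsilon>_def abs_minus_commute)
  have one_sided: "(\<Sum>i<k. l s i) - k * \<epsilon> s t \<le> (\<Sum>i<k. l t i)" for s t
  proof -
    have "(\<Sum>i<k. l s i - \<epsilon> s t) \<le> (\<Sum>i<k. quad_form n (A t) (\<lambda>r. V s $$ (r,i)))"
    proof (intro sum_mono)
      fix i assume "i \<in> {..<k}"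
      then have i: "i < n" using k by simp
      let ?v = "\<lambda>r. V s $$ (r,i)"
      have "(\<Sum>r<n. (?v r)\<^sup>2) = 1"
        using orth_mat_cols[OF V i i] by (simp add: power2_eq_square)
      then have "quad_form n (A s) ?v - quad_form n (A t) ?v \<le> \<epsilon> s t"
        using quad_form_diff_le[of n "A s" ?v "A t"] by (simp add: \<epsilon>_def)
      then show "l s i - \<epsilon> s t \<le> quad_form n (A t) ?v"
        using quad_form_conj_diag_col[OF V[of s] i, of "l s"] by (simp add: AV[of s])
    qed
    also have "\<dots> \<le> (\<Sum>i<k. l t i)" unfolding AV[of t] by (rule ky_fan[OF V V dec k])
    finally show ?thesis by (simp add: sum_subtractf)
  qed
  have lower: "(\<Sum>i<k. l 0 i) - k * \<epsilon> t 0 \<le> (\<Sum>i<k. l t i)" for t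
    using one_sided[of 0 t] by (simp add: \<epsilon>_sym)
  have upper: "(\<Sum>i<k. l t i) \<le> (\<Sum>i<k. l 0 i) + k * \<epsilon> t 0" for t
    using one_sided[of t 0] by simp
  have lim: "((\<lambda>t. (\<Sum>i<k. l 0 i) - k * \<epsilon> t 0) \<longlongrightarrow> (\<Sum>i<k. l 0 i) - real k * 0) (at_right 0)"
    "((\<lambda>t. (\<Sum>i<k. l 0 i) + k * \<epsilon> t 0) \<longlongrightarrow> (\<Sum>i<k. l 0 i) + real k * 0) (at_right 0)"
    by (intro tendsto_intros \<epsilon>)+
  show ?thesis
    by (rule tendsto_sandwich[OF always_eventually[OF allI[OF lower]] always_eventually[OF allI[OF upper]]])
       (use lim in simp_all)
qed

lemma ordered_eigenvalue_tendsto: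
  assumes i: "i < n"
  shows "((\<lambda>t. l t i) \<longlongrightarrow> l 0 i) (at_right 0)"
proof -
  have "((\<lambda>t. (\<Sum>j<Suc i. l t j) - (\<Sum>j<i. l t j)) \<longlongrightarrow> (\<Sum>j<Suc i. l 0 j) - (\<Sum>j<i. l 0 j)) (at_right 0)"
    using i by (intro tendsto_diff top_eigenvalue_sum_tendsto) auto
  then show ?thesis by simp
qed

text \<open>Let \<open>W\<^sub>j\<^sub>i\<close> be the coordinate, along the eigenvector \<open>j\<close> of \<open>A 0\<close>, of the eigenvector \<open>i\<close> of \<open>A t\<close>.
  The eigenvalue equation reads \<open>(l t i - l 0 j) W\<^sub>j\<^sub>i = o(1)\<close>; the gap forces \<open>W\<^sub>j\<^sub>i\<close> to tend to \<open>0\<close> for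
  \<open>j \<noteq> i\<close>, hence \<open>W\<^sub>i\<^sub>i\<^sup>2\<close> to tend to 1, and the equation for \<open>j = i\<close>, divided by \<open>t\<close>, gives the
  derivative.\<close>

lemma ordered_eigenvalue_deriv:
  assumes i: "i < n" and simple: "\<And>j. j < n \<Longrightarrow> j \<noteq> i \<Longrightarrow> l 0 j \<noteq> l 0 i"
  shows "((\<lambda>t. l t i) has_real_derivative ((V 0)\<^sup>T * A' * V 0) $$ (i,i)) (at_right 0)"
proof -
  have V0c: "V 0 \<in> carrier_mat n n" "(V 0)\<^sup>T \<in> carrier_mat n n" using V[of 0] by (auto simp: orth_mat_def)
  have Ac: "A t \<in> carrier_mat n n" "A' \<in> carrier_mat n n" for t using mat_derivD[OF A] by auto
  note m = square_mult[where n = n]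
  note one = right_mult_one_mat[of _ n n] left_mult_one_mat[of _ n n]
  define B where "B t = (V 0)\<^sup>T * A t * V 0" for t
  define B' where "B' = (V 0)\<^sup>T * A' * V 0"
  have B: "mat_deriv n B B'"
  proof -
    have "mat_deriv n B ((0\<^sub>m n n * A 0 + (V 0)\<^sup>T * A') * V 0 + (V 0)\<^sup>T * A 0 * 0\<^sub>m n n)"
      unfolding B_def by (intro mat_deriv_mult mat_deriv_const A V0c)
    moreover have "(0\<^sub>m n n * A 0 + (V 0)\<^sup>T * A') * V 0 + (V 0)\<^sup>T * A 0 * 0\<^sub>m n n = B'"
    proof -
      have c: "(V 0)\<^sup>T * A' \<in> carrier_mat n n" "(V 0)\<^sup>T * A 0 \<in> carrier_mat n n"
        "(V 0)\<^sup>T * A' * V 0 \<in> carrier_mat n n" using V0c Ac by (auto simp: m)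
      show ?thesis
        unfolding B'_def
        using c Ac(1)[of 0] V0c by simp
    qed
    ultimately show ?thesis by simp
  qed
  define W where "W t = (V 0)\<^sup>T * V t" for t
  have W: "orth_mat n (W t)" for t unfolding W_def by (intro orth_mat_mult orth_mat_transpose V)
  have BW: "B t = conj_diag n (W t) (l t)" for t
    using conj_diag_conj[of "V t" n "(V 0)\<^sup>T" "l t"] V V0c unfolding B_def W_def AV
    by (simp add: orth_mat_def)
  have B0: "B 0 $$ (j,k) = (if j = k then l 0 j else 0)" if "j < n" "k < n" for j k
    unfolding BW using V[of 0] that by (simp add: W_def orth_mat_def conj_diag_one_mat mat_diag_index)
  have eig: "(l t i - l 0 j) * W t $$ (j,i) = (\<Sum>k<n. (B t $$ (j,k) - B 0 $$ (j,k)) * W t $$ (k,i))"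
    if j: "j < n" for t j
  proof -
    have "(\<Sum>k<n. B 0 $$ (j,k) * W t $$ (k,i)) = (\<Sum>k<n. if k = j then l 0 j * W t $$ (j,i) else 0)"
      using j by (intro sum.cong) (auto simp: B0)
    moreover have "(\<Sum>k<n. B t $$ (j,k) * W t $$ (k,i)) = l t i * W t $$ (j,i)"
      unfolding BW by (rule conj_diag_mult_col[OF W j i])
    ultimately show ?thesis using j by (simp add: algebra_simps sum_subtractf)
  qed
  have Wle: "\<bar>W t $$ (j,i)\<bar> \<le> 1" if "j < n" for t j by (rule orth_mat_entry_le[OF W that i])
  have off: "((\<lambda>t. W t $$ (j,i)) \<longlongrightarrow> 0) (at_right 0)" if j: "j < n" "j \<noteq> i" for j
  proof -
    have "((\<lambda>t. \<Sum>k<n. (B t $$ (j,k) - B 0 $$ (j,k)) * W t $$ (k,i)) \<longlongrightarrow> 0) (at_right 0)"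
    proof (intro tendsto_null_sum)
      fix k assume "k \<in> {..<n}"
      then have k: "k < n" by simp
      show "((\<lambda>t. (B t $$ (j,k) - B 0 $$ (j,k)) * W t $$ (k,i)) \<longlongrightarrow> 0) (at_right 0)"
        by (rule tendsto_0_le[OF mat_deriv_diff_tendsto[OF B j(1) k], where K = 1])
           (use Wle[OF k] in \<open>auto simp: abs_mult intro!: always_eventually mult_left_le\<close>)
    qed
    then have "((\<lambda>t. (l t i - l 0 j) * W t $$ (j,i)) \<longlongrightarrow> 0) (at_right 0)" using eig[OF j(1)] by simp
    moreover have gap: "((\<lambda>t. l t i - l 0 j) \<longlongrightarrow> l 0 i - l 0 j) (at_right 0)"
      by (intro tendsto_intros ordered_eigenvalue_tendsto i)
    moreover have gap0: "l 0 i - l 0 j \<noteq> 0" using simple[OF j] by simp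
    ultimately have "((\<lambda>t. (l t i - l 0 j) * W t $$ (j,i) / (l t i - l 0 j)) \<longlongrightarrow> 0 / (l 0 i - l 0 j)) (at_right 0)"
      by (intro tendsto_divide)
    moreover have "\<forall>\<^sub>F t in at_right 0. (l t i - l 0 j) * W t $$ (j,i) / (l t i - l 0 j) = W t $$ (j,i)"
      using tendsto_imp_eventually_ne[OF gap gap0] by eventually_elim simp
    ultimately show ?thesis using tendsto_cong by fastforce
  qed
  have diag: "((\<lambda>t. (W t $$ (i,i))\<^sup>2) \<longlongrightarrow> 1) (at_right 0)"
  proof -
    have "(W t $$ (i,i))\<^sup>2 = 1 - (\<Sum>j\<in>{..<n} - {i}. (W t $$ (j,i))\<^sup>2)" for t
      using orth_mat_cols[OF W[of t] i i] i sum.remove[of "{..<n}" i "\<lambda>j. (W t $$ (j,i))\<^sup>2"]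
      by (simp add: power2_eq_square)
    moreover have "((\<lambda>t. 1 - (\<Sum>j\<in>{..<n} - {i}. (W t $$ (j,i))\<^sup>2)) \<longlongrightarrow> 1 - (\<Sum>j\<in>{..<n} - {i}. 0\<^sup>2)) (at_right 0)"
      by (intro tendsto_intros off) auto
    ultimately show ?thesis by simp
  qed
  define g where "g t = (\<Sum>k<n. (B t $$ (i,k) - B 0 $$ (i,k)) / t * (W t $$ (k,i) * W t $$ (i,i)))" for t
  have "(g \<longlongrightarrow> (\<Sum>k<n. B' $$ (i,k) * (if k = i then 1 else 0))) (at_right 0)"
    unfolding g_def
  proof (intro tendsto_sum tendsto_mult)
    fix k assume "k \<in> {..<n}"
    then have k: "k < n" by simp
    show "((\<lambda>t. (B t $$ (i,k) - B 0 $$ (i,k)) / t) \<longlongrightarrow> B' $$ (i,k)) (at_right 0)"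
      by (rule mat_deriv_quotient[OF B i k])
    show "((\<lambda>t. W t $$ (k,i) * W t $$ (i,i)) \<longlongrightarrow> (if k = i then 1 else 0)) (at_right 0)"
    proof (cases "k = i")
      case True
      then show ?thesis using diag by (simp add: power2_eq_square)
    next
      case False
      have "((\<lambda>t. W t $$ (k,i) * W t $$ (i,i)) \<longlongrightarrow> 0) (at_right 0)"
        by (rule tendsto_0_le[OF off[OF k False], where K = 1])
           (use Wle[OF i] in \<open>auto simp: abs_mult intro!: always_eventually mult_left_le\<close>)
      then show ?thesis using False by simp
    qed
  qed
  then have "(g \<longlongrightarrow> B' $$ (i,i)) (at_right 0)" using i by (simp add: if_distrib cong: if_cong)
  then have "((\<lambda>t. g t / (W t $$ (i,i))\<^sup>2) \<longlongrightarrow> B' $$ (i,i) / 1) (at_right 0)"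
    by (intro tendsto_divide diag) auto
  moreover have "\<forall>\<^sub>F t in at_right 0. g t / (W t $$ (i,i))\<^sup>2 = (l t i - l 0 i) / t"
  proof -
    have "\<forall>\<^sub>F t in at_right 0. (W t $$ (i,i))\<^sup>2 \<noteq> 0"
      by (rule tendsto_imp_eventually_ne[OF diag]) simp
    then show ?thesis
    proof eventually_elim
      case (elim t)
      have "g t = (l t i - l 0 i) * W t $$ (i,i) * W t $$ (i,i) / t"
        unfolding eig[OF i] g_def
        by (simp add: sum_distrib_left sum_distrib_right sum_divide_distrib mult_ac)
      then show ?case using elim by (simp add: power2_eq_square)
    qed
  qed
  ultimately have "((\<lambda>t. (l t i - l 0 i) / t) \<longlongrightarrow> B' $$ (i,i)) (at_right 0)"
    using tendsto_cong by fastforce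
  then show ?thesis by (simp add: has_field_derivative_iff B'_def)
qed

end

lemma pair_root_sum_deriv:
  fixes a b :: "real \<Rightarrow> nat \<Rightarrow> real"
  assumes "\<And>i. i < p \<Longrightarrow> ((\<lambda>t. a t i) has_real_derivative a' i) (at_right 0)"
    and "\<And>i. i < q \<Longrightarrow> ((\<lambda>t. b t i) has_real_derivative b' i) (at_right 0)"
    and "\<And>i. i < p \<Longrightarrow> 0 < a 0 i" "\<And>i. i < q \<Longrightarrow> 0 < b 0 i"
  shows "((\<lambda>t. pair_root_sum p q (a t) (b t)) has_real_derivative
    (\<Sum>i<q. ((if i < p then a' i else 0) + b' i) / (2 * sqrt ((if i < p then a 0 i else 0) + b 0 i)))) (at_right 0)"
  unfolding pair_root_sum_def
proof (rule DERIV_sum)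
  fix i assume "i \<in> {..<q}"
  then have i: "i < q" by simp
  let ?v = "\<lambda>t. (if i < p then a t i else 0) + b t i"
  have pos: "0 < ?v 0" using assms(3)[of i] assms(4)[OF i] by (auto simp: add_pos_pos)
  have der: "(?v has_real_derivative (if i < p then a' i else 0) + b' i) (at_right 0)"
  proof (cases "i < p")
    case True
    then show ?thesis using DERIV_add[OF assms(1)[OF True] assms(2)[OF i]] by simp
  next
    case False
    then show ?thesis using assms(2)[OF i] by simp
  qed
  have quot: "inverse s / 2 * x = x / (2 * s)" for s x :: real
    by (cases "s = 0") (auto simp: field_simps)
  show "((\<lambda>t. sqrt (?v t)) has_real_derivative
      ((if i < p then a' i else 0) + b' i) / (2 * sqrt (?v 0))) (at_right 0)"
    using DERIV_chain2[where f = sqrt and g = ?v and x = 0, OF DERIV_real_sqrt[OF pos] der]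
    unfolding quot .
qed

section \<open>The coefficients along a path\<close>

lemma inv_sqrt_conj_diag:
  assumes U: "orth_mat n U" and a: "\<And>i. i < n \<Longrightarrow> 0 < a i"
  shows "inv_sqrt (conj_diag n U a) = conj_diag n U (\<lambda>i. 1 / sqrt (a i))"
proof -
  have "psd_sqrt (conj_diag n U a) = conj_diag n U (\<lambda>i. sqrt (a i))"
    by (rule psd_sqrt_conj_diag[OF U less_imp_le[OF a]])
  moreover have "sqrt (a i) \<noteq> 0" if "i < n" for i using a[OF that] by simp
  ultimately show ?thesis unfolding inv_sqrt_def using mat_inv_conj_diag[OF U] by simp
qed

lemma inv_sqrt_mat_diag:
  "(\<And>i. i < n \<Longrightarrow> 0 < a i) \<Longrightarrow> inv_sqrt (mat_diag n a) = mat_diag n (\<lambda>i. 1 / sqrt (a i))"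
  using inv_sqrt_conj_diag[OF orth_mat_one, of n a] by (simp add: conj_diag_one_mat)

lemma inv_sqrt_pd: "A \<in> pd_mats n \<Longrightarrow> inv_sqrt A \<in> pd_mats n"
  unfolding inv_sqrt_def by (intro mat_inv_pd psd_sqrt_pd)

lemma tr_block_diag_mult:
  assumes N: "N1 \<in> carrier_mat p p" "N2 \<in> carrier_mat q q" and K: "K \<in> carrier_mat (p + q) (p + q)"
  shows "tr (block_diag N1 N2 * K) = tr (N1 * ul_block p K) + tr (N2 * lr_block p K)"
  using block_diag_index[OF N]
  by (simp add: tr_mult[OF block_diag_carrier[OF N] K] tr_mult[OF N(1) ul_block_carrier]
      tr_mult[OF N(2) lr_block_carrier[OF K]] sum_split_add ul_block_index lr_block_index[OF K])

lemma tr_conj_diag_mult: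
  assumes U: "orth_mat n U" and K: "K \<in> carrier_mat n n"
  shows "tr (conj_diag n U l * K) = (\<Sum>i<n. l i * (U\<^sup>T * K * U) $$ (i,i))"
proof -
  have c: "U \<in> carrier_mat n n" "U\<^sup>T \<in> carrier_mat n n" using U by (auto simp: orth_mat_def)
  note m = square_mult[where n = n]
  have M: "U\<^sup>T * K * U \<in> carrier_mat n n" using c K by (simp add: m)
  have "tr (conj_diag n U l * K) = tr (U * (mat_diag n l * (U\<^sup>T * K)))"
    unfolding conj_diag_def using c K by (simp add: m)
  also have "\<dots> = tr (mat_diag n l * (U\<^sup>T * K) * U)"
    using c K by (intro tr_mult_comm[of _ n n]) (auto simp: m)
  also have "mat_diag n l * (U\<^sup>T * K) * U = mat_diag n l * (U\<^sup>T * K * U)"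
    using c K by (simp add: m)
  finally show ?thesis
    unfolding mat_diag_mult_left[OF M] by (simp add: tr_carrier[of _ n n])
qed

lemma mat_deriv_ul_block:
  assumes "mat_deriv (p + q) A A'"
  shows "mat_deriv p (\<lambda>t. ul_block p (A t)) (ul_block p A')"
  unfolding mat_deriv_def
  using mat_derivD(3)[OF assms] by (auto simp: ul_block_carrier ul_block_index)

lemma mat_deriv_lr_block:
  assumes "mat_deriv (p + q) A A'"
  shows "mat_deriv q (\<lambda>t. lr_block p (A t)) (lr_block p A')"
  unfolding mat_deriv_def
proof (intro conjI allI impI)
  note c = mat_derivD(1,2)[OF assms]
  show "lr_block p (A t) \<in> carrier_mat q q" for t by (rule lr_block_carrier[OF c(1)])
  show "lr_block p A' \<in> carrier_mat q q" by (rule lr_block_carrier[OF c(2)])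
  fix i j assume ij: "i < q" "j < q"
  then show "((\<lambda>t. lr_block p (A t) $$ (i,j)) has_real_derivative lr_block p A' $$ (i,j)) (at_right 0)"
    unfolding lr_block_index[OF c(1) ij] lr_block_index[OF c(2) ij]
    by (intro mat_derivD(3)[OF assms]) auto
qed

lemma block_diag_part_index:
  assumes A: "A \<in> carrier_mat (p + q) (p + q)" and ij: "i < p + q" "j < p + q"
  shows "block_diag_part p A $$ (i,j) = (if i < p \<and> j < p \<or> p \<le> i \<and> p \<le> j then A $$ (i,j) else 0)"
  unfolding block_diag_part_def block_diag_index[OF ul_block_carrier lr_block_carrier[OF A] ij]
  using ij by (auto simp: ul_block_index lr_block_index[OF A])

lemma block_diag_part_carrier:
  "A \<in> carrier_mat (p + q) (p + q) \<Longrightarrow> block_diag_part p A \<in> carrier_mat (p + q) (p + q)"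
  unfolding block_diag_part_def by (intro block_diag_carrier ul_block_carrier lr_block_carrier)

lemma mat_deriv_block_diag_part:
  assumes "mat_deriv (p + q) A A'"
  shows "mat_deriv (p + q) (\<lambda>t. block_diag_part p (A t)) (block_diag_part p A')"
proof -
  note c = mat_derivD(1,2)[OF assms]
  have "((\<lambda>t. block_diag_part p (A t) $$ (i,j)) has_real_derivative block_diag_part p A' $$ (i,j)) (at_right 0)"
    if ij: "i < p + q" "j < p + q" for i j
    using mat_derivD(3)[OF assms ij]
    unfolding block_diag_part_index[OF c(1) ij] block_diag_part_index[OF c(2) ij]
    by (cases "i < p \<and> j < p \<or> p \<le> i \<and> p \<le> j") (simp_all only: if_True if_False simp_thms DERIV_const)
  then show ?thesis using c by (simp add: mat_deriv_def block_diag_part_carrier)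
qed

text \<open>The transport map \<open>J\<close> is paired with the derivative of the block-diagonal part, which only sees the
  diagonal blocks of \<open>J\<close>.\<close>

lemma tr_mult_block_diag_part:
  assumes M: "M \<in> carrier_mat (p + q) (p + q)" and K: "K \<in> carrier_mat (p + q) (p + q)"
  shows "tr (M * block_diag_part p K) = tr (block_diag_part p M * K)"
  unfolding tr_mult[OF M block_diag_part_carrier[OF K]] tr_mult[OF block_diag_part_carrier[OF M] K]
  by (intro sum.cong refl) (simp add: block_diag_part_index[OF M] block_diag_part_index[OF K])

lemma sqrt_add_less: "0 < x \<Longrightarrow> 0 < y \<Longrightarrow> sqrt (x + y) < sqrt x + sqrt (y::real)"
  by (rule real_less_lsqrt) (auto simp: power2_sum add_pos_pos)

text \<open>Strict subadditivity of the square root makes the denominators of both coefficients positive; at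
  least one pair of positive eigenvalues is needed.\<close>

lemma pair_root_sum_less:
  assumes "1 \<le> p" "p \<le> q" and a: "\<And>i. i < p \<Longrightarrow> 0 < a i" and b: "\<And>i. i < q \<Longrightarrow> 0 < b i"
  shows "pair_root_sum p q a b < (\<Sum>i<p. sqrt (a i)) + (\<Sum>i<q. sqrt (b i))"
proof -
  have "pair_root_sum p q a b < (\<Sum>i<q. (if i < p then sqrt (a i) else 0) + sqrt (b i))"
    unfolding pair_root_sum_def
  proof (rule sum_strict_mono_ex1)
    show "\<forall>i\<in>{..<q}. sqrt ((if i < p then a i else 0) + b i) \<le> (if i < p then sqrt (a i) else 0) + sqrt (b i)"
      using sqrt_add_less[OF a b] by (auto intro: less_imp_le)
    show "\<exists>i\<in>{..<q}. sqrt ((if i < p then a i else 0) + b i) < (if i < p then sqrt (a i) else 0) + sqrt (b i)"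
      using assms(1,2) sqrt_add_less[OF a b] by (intro bexI[of _ 0]) auto
  qed simp
  also have "\<dots> = (\<Sum>i<q. if i < p then sqrt (a i) else 0) + (\<Sum>i<q. sqrt (b i))"
    by (simp add: sum.distrib)
  also have "(\<Sum>i<q. if i < p then sqrt (a i) else 0) = (\<Sum>i<p. sqrt (a i))"
    using \<open>p \<le> q\<close> by (intro sum.mono_neutral_cong_right) auto
  finally show ?thesis .
qed

text \<open>The quotient rule in the shape of the matrices \<open>M\<close>: the coefficient itself reappears as \<open>f 0 / g 0\<close>.\<close>

lemma quotient_deriv:
  assumes "(f has_real_derivative f') (at_right 0)" "(g has_real_derivative g') (at_right 0)" "g 0 \<noteq> 0"
  shows "((\<lambda>t. f t / g t) has_real_derivative (f' - f 0 / g 0 * g') / g 0) (at_right 0)"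
proof -
  have "((\<lambda>t. f t / g t) has_real_derivative (f' * g 0 - f 0 * g') / (g 0 * g 0)) (at_right 0)"
    by (rule DERIV_divide[OF assms])
  moreover have "(f' * g 0 - f 0 * g') / (g 0 * g 0) = (f' - f 0 / g 0 * g') / g 0"
    using assms(3) by (simp add: divide_simps)
  ultimately show ?thesis by simp
qed

lemma sym_mats_smult:
  assumes A: "A \<in> sym_mats n"
  shows "c \<cdot>\<^sub>m A \<in> sym_mats n"
proof (rule sym_matsI)
  fix i j assume "i < n" "j < n"
  then show "(c \<cdot>\<^sub>m A) $$ (i,j) = (c \<cdot>\<^sub>m A) $$ (j,i)"
    using sym_mats_entry[OF A, of i j] sym_mats_carrier[OF A] by simp
qed (use sym_mats_carrier[OF A] in simp)

lemma sym_mats_add: "A \<in> sym_mats n \<Longrightarrow> B \<in> sym_mats n \<Longrightarrow> A + B \<in> sym_mats n"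
  by (auto simp: sym_mats_def transpose_add)

lemma sym_mats_uminus:
  assumes A: "A \<in> sym_mats n"
  shows "- A \<in> sym_mats n"
proof (rule sym_matsI)
  fix i j assume "i < n" "j < n"
  then show "(- A) $$ (i,j) = (- A) $$ (j,i)"
    using sym_mats_entry[OF A, of i j] sym_mats_carrier[OF A] by simp
qed (use sym_mats_carrier[OF A] in simp)

text \<open>The choice of eigenvectors need not be continuous in \<open>t\<close>; only its value at \<open>0\<close> is prescribed, because
  the derivative formulas refer to the given eigenvectors there.\<close>

lemma sym_path_eigenbases:
  assumes A: "\<And>t::real. A t \<in> sym_mats n" and U: "orth_mat n U" "A 0 = conj_diag n U l"
    and dec: "\<And>i j. i \<le> j \<Longrightarrow> j < n \<Longrightarrow> l j \<le> l i"
  obtains V m where "\<And>t. orth_mat n (V t)" "\<And>t. A t = conj_diag n (V t) (m t)"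
    "\<And>t i j. i \<le> j \<Longrightarrow> j < n \<Longrightarrow> m t j \<le> m t i" "V 0 = U" "m 0 = l"
proof -
  have "\<exists>W k. orth_mat n W \<and> A t = conj_diag n W k \<and> (\<forall>i j. i \<le> j \<and> j < n \<longrightarrow> k j \<le> k i)
      \<and> (t = 0 \<longrightarrow> W = U \<and> k = l)" for t
    using U dec sym_mat_decompose[OF A[of t]] by (cases "t = 0") auto
  then obtain V m where "\<And>t. orth_mat n (V t) \<and> A t = conj_diag n (V t) (m t)
      \<and> (\<forall>i j. i \<le> j \<and> j < n \<longrightarrow> m t j \<le> m t i) \<and> (t = 0 \<longrightarrow> V t = U \<and> m t = l)"
    by metis
  then show ?thesis by (intro that[of V m]) auto
qed

locale block_eigen_path =
  fixes p q :: nat and A Ut Vt :: "real \<Rightarrow> real mat" and A' :: "real mat" and ea eb :: "real \<Rightarrow> nat \<Rightarrow> real"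
  assumes pq: "1 \<le> p" "p \<le> q"
    and path: "mat_deriv (p + q) A A'" and pd: "\<And>t. A t \<in> pd_mats (p + q)"
    and Ut: "\<And>t. orth_mat p (Ut t)" "\<And>t. ul_block p (A t) = conj_diag p (Ut t) (ea t)"
    and Vt: "\<And>t. orth_mat q (Vt t)" "\<And>t. lr_block p (A t) = conj_diag q (Vt t) (eb t)"
    and ea_dec: "\<And>t i j. i \<le> j \<Longrightarrow> j < p \<Longrightarrow> ea t j \<le> ea t i" and ea_inj: "inj_on (ea 0) {..<p}"
    and eb_dec: "\<And>t i j. i \<le> j \<Longrightarrow> j < q \<Longrightarrow> eb t j \<le> eb t i" and eb_inj: "inj_on (eb 0) {..<q}"
begin

abbreviation "U \<equiv> Ut 0"
abbreviation "V \<equiv> Vt 0"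
abbreviation "a \<equiv> ea 0"
abbreviation "b \<equiv> eb 0"
abbreviation "d \<equiv> p + q"
abbreviation "L1 \<equiv> mat_diag p a"
abbreviation "L2 \<equiv> mat_diag q b"

lemma Ac: "A t \<in> carrier_mat d d" using pd by (rule pd_mats_carrier)

lemma A'c: "A' \<in> carrier_mat d d" using path by (rule mat_derivD)

lemmas U = Ut[of 0] and V = Vt[of 0]

lemma ab_pos: "i < p \<Longrightarrow> 0 < a i" "j < q \<Longrightarrow> 0 < b j"
  by (rule block_eigenvalues_pos[OF pd[of 0] pq(2) U V ea_dec eb_dec]; assumption)+

text \<open>Derivatives of the ordered eigenvalues of the two diagonal blocks.\<close>

definition \<alpha> :: "nat \<Rightarrow> real" where "\<alpha> i = (U\<^sup>T * ul_block p A' * U) $$ (i,i)"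
definition \<beta> :: "nat \<Rightarrow> real" where "\<beta> i = (V\<^sup>T * lr_block p A' * V) $$ (i,i)"

lemma eigenvalue_path_derivs:
  "i < p \<Longrightarrow> ((\<lambda>t. ea t i) has_real_derivative \<alpha> i) (at_right 0)"
  "j < q \<Longrightarrow> ((\<lambda>t. eb t j) has_real_derivative \<beta> j) (at_right 0)"
  unfolding \<alpha>_def \<beta>_def
  using ordered_eigenvalue_deriv[OF mat_deriv_ul_block[OF path] Ut ea_dec, of i] inj_onD[OF ea_inj, of _ i]
    ordered_eigenvalue_deriv[OF mat_deriv_lr_block[OF path] Vt eb_dec, of j] inj_onD[OF eb_inj, of _ j]
  by auto

lemma L2_blocks: "ul_block p L2 = mat_diag p b" "lr_block p L2 = mat_diag (q - p) (\<lambda>i. b (p + i))"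
proof -
  have "L2 \<in> carrier_mat (p + (q - p)) (p + (q - p))" using pq by (metis le_add_diff_inverse mat_diag_dim)
  from lr_block_index[OF this] lr_block_carrier[OF this]
  show "lr_block p L2 = mat_diag (q - p) (\<lambda>i. b (p + i))"
    by (intro eq_matI) (auto simp: mat_diag_index)
  show "ul_block p L2 = mat_diag p b"
    using pq ul_block_carrier[of p L2] by (intro eq_matI) (auto simp: ul_block_index mat_diag_index)
qed

lemma mat_diag_add: "mat_diag n f + mat_diag n g = mat_diag n (\<lambda>i. f i + g i :: real)"
  by (rule eq_matI) (auto simp: mat_diag_index)

lemma block_diag_pair: "block_diag (mat_diag p f) (mat_diag (q - p) (\<lambda>i. g (p + i)))
    = mat_diag q (\<lambda>i. if i < p then f i else g i)"
proof -
  have "block_diag (mat_diag p f) (mat_diag (q - p) (\<lambda>i. g (p + i)))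
      = mat_diag (p + (q - p)) (join_at p f (\<lambda>i. g (p + i)))"
    by (rule block_diag_mat_diag)
  also have "p + (q - p) = q" using pq by simp
  finally show ?thesis by (simp add: join_at_def cong: mat_diag_cong) (rule mat_diag_cong, simp)
qed

abbreviation "\<nu> i \<equiv> (if i < p then a i else 0) + b i"

lemma Upsilon1_eq: "Upsilon1 p U L1 V L2
    = block_diag (conj_diag p U (\<lambda>i. 1 / sqrt (\<nu> i))) (conj_diag q V (\<lambda>i. 1 / sqrt (\<nu> i)))"
proof -
  have D1: "inv_sqrt (L1 + ul_block p L2) = mat_diag p (\<lambda>i. 1 / sqrt (a i + b i))"
    unfolding L2_blocks mat_diag_add using ab_pos pq
    by (intro inv_sqrt_mat_diag add_pos_pos) auto
  have D2: "inv_sqrt (lr_block p L2) = mat_diag (q - p) (\<lambda>i. 1 / sqrt (b (p + i)))"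
    unfolding L2_blocks using ab_pos by (intro inv_sqrt_mat_diag) auto
  have "block_diag (mat_diag p (\<lambda>i. 1 / sqrt (a i + b i))) (mat_diag (q - p) (\<lambda>i. 1 / sqrt (b (p + i))))
      = mat_diag q (\<lambda>i. 1 / sqrt (\<nu> i))"
    unfolding block_diag_pair[of _ "\<lambda>i. 1 / sqrt (b i)"] by (rule mat_diag_cong) simp
  moreover have "mat_diag p (\<lambda>i. 1 / sqrt (a i + b i)) = mat_diag p (\<lambda>i. 1 / sqrt (\<nu> i))"
    by (rule mat_diag_cong) simp
  ultimately show ?thesis
    unfolding Upsilon1_def Let_def D1 D2 conj_diag_def by simp
qed

abbreviation "\<nu>2 i \<equiv> (if i < p then (a i)\<^sup>2 else 0) + (b i)\<^sup>2"

lemma Upsilon2_eq: "Upsilon2 p q U L1 V L2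
    = block_diag (conj_diag p U (\<lambda>i. a i / sqrt (\<nu>2 i))) (conj_diag q V (\<lambda>i. b i / sqrt (\<nu>2 i)))"
proof -
  have D1: "inv_sqrt (L1 * L1 + ul_block p L2 * ul_block p L2) = mat_diag p (\<lambda>i. 1 / sqrt ((a i)\<^sup>2 + (b i)\<^sup>2))"
    unfolding L2_blocks mat_diag_diag mat_diag_add power2_eq_square using ab_pos pq
    by (intro inv_sqrt_mat_diag add_pos_pos mult_pos_pos) auto
  have one: "1\<^sub>m (q - p) = mat_diag (q - p) (\<lambda>i. b (p + i) / sqrt ((b (p + i))\<^sup>2))"
  proof -
    have "b (p + i) / sqrt ((b (p + i))\<^sup>2) = 1" if "i < q - p" for i
      using ab_pos(2)[of "p + i"] that by (simp add: less_diff_conv add.commute)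
    then show ?thesis by (intro eq_matI) (auto simp: mat_diag_index)
  qed
  have "block_diag (mat_diag p (\<lambda>i. 1 / sqrt ((a i)\<^sup>2 + (b i)\<^sup>2) * b i)) (1\<^sub>m (q - p)) = mat_diag q (\<lambda>i. b i / sqrt (\<nu>2 i))"
    unfolding one block_diag_pair[of _ "\<lambda>i. b i / sqrt ((b i)\<^sup>2)"] by (rule mat_diag_cong) simp
  moreover have "mat_diag p (\<lambda>i. 1 / sqrt ((a i)\<^sup>2 + (b i)\<^sup>2) * a i) = mat_diag p (\<lambda>i. a i / sqrt (\<nu>2 i))"
    by (rule mat_diag_cong) simp
  ultimately show ?thesis
    unfolding Upsilon2_def Let_def D1 unfolding L2_blocks mat_diag_diag conj_diag_def by simp
qed

lemma Upsilon_sym: "Upsilon1 p U L1 V L2 \<in> sym_mats d" "Upsilon2 p q U L1 V L2 \<in> sym_mats d"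
  unfolding Upsilon1_eq Upsilon2_eq block_diag_conj_diag[OF U(1) V(1)]
  by (intro conj_diag_sym orth_mat_block_diag U V)+

lemma sum_pair:
  "(\<Sum>i<p. f i) + (\<Sum>i<q. g i) = (\<Sum>i<q. (if i < p then f i else 0) + g i)" for f g :: "nat \<Rightarrow> real"
proof -
  have "(\<Sum>i<q. if i < p then f i else 0) = (\<Sum>i<p. f i)"
    using pq by (intro sum.mono_neutral_cong_right) auto
  then show ?thesis by (simp add: sum.distrib)
qed

lemma tr_conj_blocks:
  "tr (block_diag (conj_diag p U f) (conj_diag q V g) * A')
    = (\<Sum>i<q. (if i < p then f i * \<alpha> i else 0) + g i * \<beta> i)"
  unfolding sum_pair[symmetric]
  using tr_block_diag_mult[OF conj_diag_carrier[OF U(1)] conj_diag_carrier[OF V(1)] A'c]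
  by (simp add: tr_conj_diag_mult[OF U(1) ul_block_carrier] tr_conj_diag_mult[OF V(1) lr_block_carrier[OF A'c]]
      \<alpha>_def \<beta>_def)

lemma R0_inv_sqrt: "inv_sqrt (block_diag_part p (A 0))
    = block_diag (inv_sqrt (ul_block p (A 0))) (inv_sqrt (lr_block p (A 0)))"
proof -
  have "inv_sqrt (block_diag_part p (A 0)) = conj_diag d (block_diag U V) (\<lambda>i. 1 / sqrt (join_at p a b i))"
    unfolding block_diag_part_def U(2) V(2) block_diag_conj_diag[OF U(1) V(1)]
    using ab_pos by (intro inv_sqrt_conj_diag orth_mat_block_diag U V) (auto simp: join_at_def)
  also have "\<dots> = conj_diag d (block_diag U V) (join_at p (\<lambda>i. 1 / sqrt (a i)) (\<lambda>i. 1 / sqrt (b i)))"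
    by (rule conj_diag_cong) (simp add: join_at_def)
  finally show ?thesis
    unfolding U(2) V(2) block_diag_conj_diag[OF U(1) V(1), symmetric]
    by (simp add: inv_sqrt_conj_diag[OF U(1) ab_pos(1)] inv_sqrt_conj_diag[OF V(1) ab_pos(2)])
qed

lemma R0_pd: "block_diag_part p (A t) \<in> pd_mats d"
  by (rule block_diag_part_pd[OF pd pq(2) Ut Vt ea_dec eb_dec])

text \<open>The quotient rule for the closed form; the trace of the root of the block-diagonal part, of the whole
  matrix and of the extremal coupling contribute the three summands of \<open>M\<close>.\<close>

theorem dep_coef1_deriv:
  defines "M \<equiv> M_R1 p q (A 0) U L1 V L2"
  shows "((\<lambda>t. dep_coef1 p q (A t)) has_real_derivative tr (M * A')) (at_right 0)" "M \<in> sym_mats d"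
proof -
  define f where "f t = tr (psd_sqrt (ul_block p (A t))) + tr (psd_sqrt (lr_block p (A t)))" for t
  define G where "G t = pair_root_sum p q (ea t) (eb t)" for t
  have coef: "dep_coef1 p q (A t) = (f t - tr (psd_sqrt (A t))) / (f t - G t)" for t
    unfolding f_def G_def by (rule dep_coef1_eq[OF pd pq(2) Ut Vt ea_dec eb_dec])
  let ?R0 = "block_diag_part p (A 0)"
  let ?Y = "Upsilon1 p U L1 V L2"
  have Yc: "?Y \<in> carrier_mat d d" using Upsilon_sym(1) by (rule sym_mats_carrier)
  have I: "inv_sqrt (A 0) \<in> pd_mats d" "inv_sqrt ?R0 \<in> pd_mats d" by (intro inv_sqrt_pd pd R0_pd)+
  note Ic = I[THEN pd_mats_carrier]
  have f': "(f has_real_derivative 1 / 2 * tr (inv_sqrt ?R0 * A')) (at_right 0)"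
  proof -
    note b1 = blocks_psd_pd(1)[OF Ac pd] and b2 = blocks_psd_pd(2)[OF Ac pd]
    have "(f has_real_derivative 1 / 2 * tr (inv_sqrt (ul_block p (A 0)) * ul_block p A')
        + 1 / 2 * tr (inv_sqrt (lr_block p (A 0)) * lr_block p A')) (at_right 0)"
      unfolding f_def
      by (intro DERIV_add tr_psd_sqrt_deriv[OF mat_deriv_ul_block[OF path] b1]
          tr_psd_sqrt_deriv[OF mat_deriv_lr_block[OF path] b2])
    then show ?thesis
      using tr_block_diag_mult[OF inv_sqrt_pd[OF b1, THEN pd_mats_carrier] inv_sqrt_pd[OF b2, THEN pd_mats_carrier] A'c]
      by (simp add: R0_inv_sqrt algebra_simps)
  qed
  have G': "(G has_real_derivative 1 / 2 * tr (?Y * A')) (at_right 0)"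
  proof -
    have "(G has_real_derivative (\<Sum>i<q. ((if i < p then \<alpha> i else 0) + \<beta> i) / (2 * sqrt (\<nu> i)))) (at_right 0)"
      unfolding G_def
      using pair_root_sum_deriv[of p ea \<alpha> q eb \<beta>, OF eigenvalue_path_derivs] ab_pos by simp
    moreover have "(\<Sum>i<q. ((if i < p then \<alpha> i else 0) + \<beta> i) / (2 * sqrt (\<nu> i))) = 1 / 2 * tr (?Y * A')"
      unfolding Upsilon1_eq tr_conj_blocks sum_distrib_left
      by (intro sum.cong refl) (simp add: add_divide_distrib)
    ultimately show ?thesis by simp
  qed
  have Rm: "tr (psd_sqrt (R_m p q (A 0) U L1 V L2)) = G 0"
    unfolding G_def by (rule tr_psd_sqrt_Rm[OF pd pq(2) U V ea_dec eb_dec])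
  define c where "c = f 0 - G 0"
  have c: "c > 0"
  proof -
    have "f 0 = (\<Sum>i<p. sqrt (a i)) + (\<Sum>i<q. sqrt (b i))"
      unfolding f_def U(2) V(2)
      by (simp add: psd_sqrt_conj_diag[OF U(1) less_imp_le[OF ab_pos(1)]]
          psd_sqrt_conj_diag[OF V(1) less_imp_le[OF ab_pos(2)]] tr_conj_diag[OF U(1)] tr_conj_diag[OF V(1)])
    then show ?thesis
      using pair_root_sum_less[OF pq, of a b] ab_pos by (simp add: c_def G_def)
  qed
  define D where "D = dep_coef1 p q (A 0)"
  have D: "D = (f 0 - tr (psd_sqrt (A 0))) / c" by (simp add: D_def coef c_def)
  have M: "M = (1 / (2 * c)) \<cdot>\<^sub>m (- inv_sqrt (A 0) + (1 - D) \<cdot>\<^sub>m inv_sqrt ?R0 + D \<cdot>\<^sub>m ?Y)"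
    by (simp add: M_def M_R1_def Let_def Rm c_def D_def f_def)
  show "M \<in> sym_mats d"
    unfolding M by (intro sym_mats_smult sym_mats_add sym_mats_uminus Upsilon_sym I[THEN pd_mats_sym])
  let ?r = "tr (inv_sqrt (A 0) * A')" and ?s = "tr (inv_sqrt ?R0 * A')" and ?y = "tr (?Y * A')"
  have trM: "tr (M * A') = 1 / (2 * c) * (- ?r + (1 - D) * ?s + D * ?y)"
  proof -
    have "M * A' = (1 / (2 * c)) \<cdot>\<^sub>m (- (inv_sqrt (A 0) * A') + (1 - D) \<cdot>\<^sub>m (inv_sqrt ?R0 * A') + D \<cdot>\<^sub>m (?Y * A'))"
      unfolding M using Ic Yc A'c
      by (simp add: mult_smult_assoc_mat[of _ d d _ d] add_mult_distrib_mat[of _ d d _ _ d]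
          square_mult[where n = d] uminus_carrier_mat assoc_add_mat[of _ d d])
    moreover have "tr (k \<cdot>\<^sub>m (- X + e \<cdot>\<^sub>m Y + f \<cdot>\<^sub>m Z)) = k * (- tr X + e * tr Y + f * tr Z)"
      if "X \<in> carrier_mat d d" "Y \<in> carrier_mat d d" "Z \<in> carrier_mat d d" for X Y Z and k e f :: real
      using that carrier_matD[OF that(1)] carrier_matD[OF that(2)] carrier_matD[OF that(3)]
      by (simp add: tr_def sum.distrib sum_subtractf sum_negf flip: sum_distrib_left)
    ultimately show ?thesis
      using Ic Yc A'c by (simp only: square_mult(2)[where n = d])
  qed
  have "((\<lambda>t. (f t - tr (psd_sqrt (A t))) / (f t - G t)) has_real_derivative
      ((1 / 2 * ?s - 1 / 2 * ?r) - (f 0 - tr (psd_sqrt (A 0))) / (f 0 - G 0) * (1 / 2 * ?s - 1 / 2 * ?y))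
        / (f 0 - G 0)) (at_right 0)"
    using c by (intro quotient_deriv DERIV_diff f' G' tr_psd_sqrt_deriv[OF path pd]) (simp add: c_def)
  also have "((1 / 2 * ?s - 1 / 2 * ?r) - (f 0 - tr (psd_sqrt (A 0))) / (f 0 - G 0) * (1 / 2 * ?s - 1 / 2 * ?y))
        / (f 0 - G 0) = tr (M * A')"
    unfolding trM c_def[symmetric] D[symmetric] using c by (simp add: field_simps)
  finally show "((\<lambda>t. dep_coef1 p q (A t)) has_real_derivative tr (M * A')) (at_right 0)"
    unfolding coef .
qed

text \<open>Here the numerator is the trace minus the fidelity with the block-diagonal part, whose two arguments
  both move; they contribute \<open>J\<^sup>-\<^sup>1\<close> and \<open>J\<^sub>0\<close>.\<close>

theorem dep_coef2_deriv:
  defines "M \<equiv> M_R2 p q (A 0) U L1 V L2"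
  shows "((\<lambda>t. dep_coef2 p q (A t)) has_real_derivative tr (M * A')) (at_right 0)" "M \<in> sym_mats d"
proof -
  define B where "B t = block_diag_part p (A t)" for t
  define F where "F t = tr (psd_sqrt (psd_sqrt (B t) * A t * psd_sqrt (B t)))" for t
  define G where "G t = pair_root_sum p q (\<lambda>i. (ea t i)\<^sup>2) (\<lambda>i. (eb t i)\<^sup>2)" for t
  have coef: "dep_coef2 p q (A t) = (tr (A t) - F t) / (tr (A t) - G t)" for t
    unfolding F_def G_def B_def by (rule dep_coef2_eq[OF pd pq(2) Ut Vt ea_dec eb_dec])
  define J where "J = inv_sqrt (B 0) * psd_sqrt (psd_sqrt (B 0) * A 0 * psd_sqrt (B 0)) * inv_sqrt (B 0)"
  define J0 where "J0 = block_diag_part p J"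
  let ?Y = "Upsilon2 p q U L1 V L2"
  have Yc: "?Y \<in> carrier_mat d d" using Upsilon_sym(2) by (rule sym_mats_carrier)
  have Bpd: "B t \<in> pd_mats d" for t unfolding B_def by (rule R0_pd)
  have Bd: "mat_deriv d B (block_diag_part p A')"
    unfolding B_def by (rule mat_deriv_block_diag_part[OF path])
  note fid = tr_fidelity_deriv[OF path Bd pd Bpd, folded J_def]
  have Jc: "J \<in> carrier_mat d d" using fid(2) by (rule pd_mats_carrier)
  have Jsym: "mat_inv J \<in> sym_mats d" "J0 \<in> sym_mats d"
  proof -
    show "mat_inv J \<in> sym_mats d" by (rule pd_mats_sym[OF mat_inv_pd(1)[OF fid(2)]])
    show "J0 \<in> sym_mats d"
      unfolding J0_def
      by (rule sym_matsI[OF block_diag_part_carrier[OF Jc]])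
         (auto simp: block_diag_part_index[OF Jc] sym_mats_entry[OF pd_mats_sym[OF fid(2)]])
  qed
  note Jsc = Jsym[THEN sym_mats_carrier]
  have F': "(F has_real_derivative 1 / 2 * (tr (J0 * A') + tr (mat_inv J * A'))) (at_right 0)"
    using fid(1) unfolding F_def tr_mult_block_diag_part[OF Jc A'c] J0_def .
  have G': "(G has_real_derivative tr (?Y * A')) (at_right 0)"
  proof -
    have sq: "((\<lambda>t. (h t)\<^sup>2) has_real_derivative 2 * h 0 * h') (at_right 0)"
      if "(h has_real_derivative h') (at_right 0)" for h :: "real \<Rightarrow> real" and h'
      using DERIV_mult[OF that that] by (simp add: power2_eq_square mult_ac)
    have "(G has_real_derivative (\<Sum>i<q. ((if i < p then 2 * ea 0 i * \<alpha> i else 0) + 2 * eb 0 i * \<beta> i)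
        / (2 * sqrt ((if i < p then (ea 0 i)\<^sup>2 else 0) + (eb 0 i)\<^sup>2)))) (at_right 0)"
      unfolding G_def
    proof (rule pair_root_sum_deriv)
      show "0 < (ea 0 i)\<^sup>2" if "i < p" for i using ab_pos(1)[OF that] by simp
      show "0 < (eb 0 i)\<^sup>2" if "i < q" for i using ab_pos(2)[OF that] by simp
    qed (intro sq eigenvalue_path_derivs; assumption)+
    moreover have "(\<Sum>i<q. ((if i < p then 2 * ea 0 i * \<alpha> i else 0) + 2 * eb 0 i * \<beta> i)
        / (2 * sqrt ((if i < p then (ea 0 i)\<^sup>2 else 0) + (eb 0 i)\<^sup>2))) = tr (?Y * A')"
      unfolding Upsilon2_eq tr_conj_blocks
    proof (intro sum.cong refl)
      fix i
      have half: "(2 * x) / (2 * s) = x / s" for x s :: real by simp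
      have "((if i < p then 2 * a i * \<alpha> i else 0) + 2 * b i * \<beta> i)
          = 2 * ((if i < p then a i * \<alpha> i else 0) + b i * \<beta> i)" by simp
      then have "((if i < p then 2 * a i * \<alpha> i else 0) + 2 * b i * \<beta> i) / (2 * sqrt (\<nu>2 i))
          = ((if i < p then a i * \<alpha> i else 0) + b i * \<beta> i) / sqrt (\<nu>2 i)" by (simp only: half)
      then show "((if i < p then 2 * a i * \<alpha> i else 0) + 2 * b i * \<beta> i) / (2 * sqrt (\<nu>2 i))
          = (if i < p then a i / sqrt (\<nu>2 i) * \<alpha> i else 0) + b i / sqrt (\<nu>2 i) * \<beta> i"
        by (simp add: add_divide_distrib)
    qed
    ultimately show ?thesis by simp
  qed
  have Rm: "tr (psd_sqrt (psd_sqrt (B 0) * R_m p q (A 0) U L1 V L2 * psd_sqrt (B 0))) = G 0"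
    unfolding G_def B_def by (rule tr_psd_sqrt_weighted_Rm[OF pd pq(2) U V ea_dec eb_dec])
  define c where "c = tr (A 0) - G 0"
  have c: "c > 0"
  proof -
    have "pair_root_sum p q (\<lambda>i. (a i)\<^sup>2) (\<lambda>i. (b i)\<^sup>2) < (\<Sum>i<p. sqrt ((a i)\<^sup>2)) + (\<Sum>i<q. sqrt ((b i)\<^sup>2))"
      by (intro pair_root_sum_less pq zero_less_power ab_pos)
    also have "\<dots> = (\<Sum>i<p. a i) + (\<Sum>i<q. b i)"
      using ab_pos by (intro arg_cong2[of _ _ _ _ "(+)"] sum.cong refl) (auto simp: less_imp_le)
    also have "\<dots> = tr (A 0)"
      by (simp add: tr_blocks[OF Ac] U(2) V(2) tr_conj_diag[OF U(1)] tr_conj_diag[OF V(1)])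
    finally show ?thesis by (simp add: c_def G_def)
  qed
  define D where "D = dep_coef2 p q (A 0)"
  have D: "D = (tr (A 0) - F 0) / c" by (simp add: D_def coef c_def)
  have M: "M = (1 / c) \<cdot>\<^sub>m ((- (1 / 2)) \<cdot>\<^sub>m (J0 + mat_inv J) + (1 - D) \<cdot>\<^sub>m 1\<^sub>m d + D \<cdot>\<^sub>m ?Y)"
    by (simp add: M_def M_R2_def Let_def Rm[unfolded B_def] c_def D_def J0_def J_def B_def)
  show "M \<in> sym_mats d"
    unfolding M by (intro sym_mats_smult sym_mats_add Upsilon_sym Jsym) (simp add: sym_mats_def)
  let ?j = "tr (J0 * A')" and ?k = "tr (mat_inv J * A')" and ?y = "tr (?Y * A')"
  have trM: "tr (M * A') = 1 / c * (- (1 / 2) * (?j + ?k) + (1 - D) * tr A' + D * ?y)"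
  proof -
    have "M * A' = (1 / c) \<cdot>\<^sub>m ((- (1 / 2)) \<cdot>\<^sub>m (J0 * A' + mat_inv J * A') + (1 - D) \<cdot>\<^sub>m A' + D \<cdot>\<^sub>m (?Y * A'))"
      unfolding M using Jsc Yc A'c
      by (simp add: mult_smult_assoc_mat[of _ d d _ d] add_mult_distrib_mat[of _ d d _ _ d] square_mult[where n = d])
    then show ?thesis
      using Jsc Yc A'c by (simp add: tr_smult[where n = d] tr_add[where n = d] square_mult[where n = d])
  qed
  have "((\<lambda>t. (tr (A t) - F t) / (tr (A t) - G t)) has_real_derivative
      ((tr A' - 1 / 2 * (?j + ?k)) - (tr (A 0) - F 0) / (tr (A 0) - G 0) * (tr A' - ?y))
        / (tr (A 0) - G 0)) (at_right 0)"
    using c by (intro quotient_deriv DERIV_diff F' G' mat_deriv_tr[OF path]) (simp add: c_def)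
  also have "((tr A' - 1 / 2 * (?j + ?k)) - (tr (A 0) - F 0) / (tr (A 0) - G 0) * (tr A' - ?y))
        / (tr (A 0) - G 0) = tr (M * A')"
    unfolding trM c_def[symmetric] D[symmetric] using c by (simp add: field_simps)
  finally show "((\<lambda>t. dep_coef2 p q (A t)) has_real_derivative tr (M * A')) (at_right 0)"
    unfolding coef .
qed

end

section \<open>Normalisation to a correlation matrix\<close>

lemma pd_diag_pos:
  assumes "S \<in> pd_mats n" "i < n"
  shows "0 < S $$ (i,i)"
proof -
  have "0 < quad_form n S (\<lambda>k. if k = i then 1 else 0)"
    using assms by (auto simp: pd_mats_quad_form)
  also have "\<dots> = S $$ (i,i)"
  proof -
    have "quad_form n S (\<lambda>k. if k = i then 1 else 0)
        = (\<Sum>k<n. \<Sum>j<n. if j = i then (if k = i then S $$ (i,i) else 0) else 0)"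
      unfolding quad_form_def by (intro sum.cong refl) auto
    then show ?thesis using assms(2) by simp
  qed
  finally show ?thesis .
qed

lemma corr_normalize_pd:
  assumes S: "S \<in> pd_mats n"
  shows "corr_normalize S \<in> pd_mats n"
    "i < n \<Longrightarrow> j < n \<Longrightarrow> corr_normalize S $$ (i,j) = S $$ (i,j) / (sqrt (S $$ (i,i)) * sqrt (S $$ (j,j)))"
proof -
  have Sc: "S \<in> carrier_mat n n" using S by (rule pd_mats_carrier)
  define K where "K = mat_diag n (\<lambda>i. 1 / sqrt (S $$ (i,i)))"
  have K: "inv_sqrt (diag_part S) = K"
    unfolding K_def diag_part_def using Sc pd_diag_pos[OF S] by (simp add: inv_sqrt_mat_diag)
  have "K \<in> pd_mats n"
    using conj_diag_pd_iff[OF orth_mat_one, of n] pd_diag_pos[OF S] by (simp add: K_def conj_diag_one_mat)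
  then show "corr_normalize S \<in> pd_mats n"
    unfolding corr_normalize_def K by (rule pd_conj[OF S])
  show "corr_normalize S $$ (i,j) = S $$ (i,j) / (sqrt (S $$ (i,i)) * sqrt (S $$ (j,j)))" if "i < n" "j < n"
  proof -
    have "K * S = Matrix.mat n n (\<lambda>(i,j). 1 / sqrt (S $$ (i,i)) * S $$ (i,j))"
      unfolding K_def by (rule mat_diag_mult_left[OF Sc])
    then show ?thesis
      unfolding corr_normalize_def K using that
      by (simp add: K_def mat_diag_mult_right[of _ n n])
  qed
qed

text \<open>A coercive form with constant \<open>s\<close> stays positive under a perturbation whose entries have absolute
  values of sum less than \<open>s\<close>.\<close>

lemma pd_mats_eventually:
  fixes S :: "real \<Rightarrow> real mat"
  assumes S0: "S0 \<in> pd_mats n" and sym: "\<forall>\<^sub>F t in F. S t \<in> sym_mats n"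
    and lim: "\<And>i j. i < n \<Longrightarrow> j < n \<Longrightarrow> ((\<lambda>t. S t $$ (i,j)) \<longlongrightarrow> S0 $$ (i,j)) F"
  shows "\<forall>\<^sub>F t in F. S t \<in> pd_mats n"
proof -
  obtain s where s: "s > 0" "\<And>f. s * (\<Sum>i<n. (f i)\<^sup>2) \<le> quad_form n S0 f" using pd_coercive[OF S0] by blast
  define \<epsilon> where "\<epsilon> t = (\<Sum>i<n. \<Sum>j<n. \<bar>S0 $$ (i,j) - S t $$ (i,j)\<bar>)" for t
  have "(\<epsilon> \<longlongrightarrow> (\<Sum>i<n. \<Sum>j<n. \<bar>S0 $$ (i,j) - S0 $$ (i,j)\<bar>)) F"
    unfolding \<epsilon>_def by (intro tendsto_intros lim) auto
  then have "(\<epsilon> \<longlongrightarrow> 0) F" by simp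
  then have "\<forall>\<^sub>F t in F. \<epsilon> t < s" using s(1) by (rule order_tendstoD)
  with sym show ?thesis
  proof eventually_elim
    case (elim t)
    have "0 < quad_form n (S t) f" if f: "\<exists>i<n. f i \<noteq> 0" for f
    proof -
      define N where "N = (\<Sum>i<n. (f i)\<^sup>2)"
      obtain k where "k < n" "f k \<noteq> 0" using f by blast
      then have N: "N > 0" unfolding N_def by (intro sum_pos2[of _ k]) auto
      have "quad_form n S0 f - quad_form n (S t) f \<le> \<epsilon> t * N"
        unfolding \<epsilon>_def N_def by (rule quad_form_diff_le)
      also have "\<dots> < s * N" using elim(2) N by simp
      also have "\<dots> \<le> quad_form n S0 f" unfolding N_def by (rule s(2))
      finally show ?thesis by simp
    qed
    then show ?case using elim(1) by (simp add: pd_mats_quad_form)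
  qed
qed

text \<open>The direction \<open>H - (D\<^sub>H R + R D\<^sub>H) / 2\<close> is the derivative of the normalisation at a correlation
  matrix; moving it to the other side of the trace form uses that \<open>M\<close> and \<open>R\<close> are symmetric.\<close>

lemma tr_normalized_direction:
  assumes M: "M \<in> sym_mats n" and R: "R \<in> sym_mats n" and H: "H \<in> carrier_mat n n"
    and K: "K \<in> carrier_mat n n"
      "\<And>i j. i < n \<Longrightarrow> j < n \<Longrightarrow> K $$ (i,j) = H $$ (i,j) - R $$ (i,j) * (H $$ (i,i) + H $$ (j,j)) / 2"
  shows "tr (M * K) = tr ((M - diag_part (M * R)) * H)"
proof -
  have c: "M \<in> carrier_mat n n" "R \<in> carrier_mat n n" using M R sym_mats_carrier by auto
  have MR: "M * R \<in> carrier_mat n n" using c by simp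
  define D where "D = diag_part (M * R)"
  have D: "D \<in> carrier_mat n n" "\<And>i j. i < n \<Longrightarrow> j < n \<Longrightarrow> D $$ (i,j) = (if i = j then (M * R) $$ (i,i) else 0)"
    using MR by (auto simp: D_def diag_part_def mat_diag_index)
  have MRi: "(M * R) $$ (i,i) = (\<Sum>j<n. M $$ (i,j) * R $$ (i,j))" if "i < n" for i
    using index_mult_mat_sum[OF c that that] that sym_mats_entry[OF R] by simp
  have "tr (M * K) = (\<Sum>i<n. \<Sum>j<n. M $$ (i,j) * H $$ (j,i)
      - (1 / 2 * (M $$ (i,j) * R $$ (i,j) * H $$ (i,i)) + 1 / 2 * (M $$ (j,i) * R $$ (j,i) * H $$ (j,j))))"
    unfolding tr_mult[OF c(1) K(1)]
    by (intro sum.cong refl)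
       (simp add: K(2) sym_mats_entry[OF M, of _ j for j] sym_mats_entry[OF R, of _ j for j] field_simps)
  also have "\<dots> = (\<Sum>i<n. \<Sum>j<n. M $$ (i,j) * H $$ (j,i))
      - (1 / 2 * (\<Sum>i<n. \<Sum>j<n. M $$ (i,j) * R $$ (i,j) * H $$ (i,i))
        + 1 / 2 * (\<Sum>i<n. \<Sum>j<n. M $$ (j,i) * R $$ (j,i) * H $$ (j,j)))"
    by (simp only: sum_subtractf sum.distrib sum_distrib_left)
  also have "(\<Sum>i<n. \<Sum>j<n. M $$ (j,i) * R $$ (j,i) * H $$ (j,j))
      = (\<Sum>i<n. \<Sum>j<n. M $$ (i,j) * R $$ (i,j) * H $$ (i,i))"
    by (rule sum.swap)
  also have "(\<Sum>i<n. \<Sum>j<n. M $$ (i,j) * R $$ (i,j) * H $$ (i,i)) = (\<Sum>i<n. (M * R) $$ (i,i) * H $$ (i,i))"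
    by (intro sum.cong refl) (simp only: MRi lessThan_iff sum_distrib_right)
  also have "(\<Sum>i<n. \<Sum>j<n. M $$ (i,j) * H $$ (j,i))
      - (1 / 2 * (\<Sum>i<n. (M * R) $$ (i,i) * H $$ (i,i)) + 1 / 2 * (\<Sum>i<n. (M * R) $$ (i,i) * H $$ (i,i)))
      = (\<Sum>i<n. (\<Sum>j<n. M $$ (i,j) * H $$ (j,i)) - (M * R) $$ (i,i) * H $$ (i,i))"
    by (simp add: sum_subtractf)
  also have "\<dots> = tr ((M - D) * H)"
  proof -
    have MD: "M - D \<in> carrier_mat n n" using D(1) by (rule minus_carrier_mat)
    have "(\<Sum>j<n. (M - D) $$ (i,j) * H $$ (j,i))
        = (\<Sum>j<n. M $$ (i,j) * H $$ (j,i) - (if j = i then (M * R) $$ (i,i) * H $$ (i,i) else 0))" if "i < n" for i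
      using that c(1) D by (intro sum.cong refl) (auto simp: algebra_simps)
    then show ?thesis unfolding tr_mult[OF MD H] by (simp add: sum_subtractf)
  qed
  finally show ?thesis by (simp add: D_def)
qed

lemma inj_on_of_card_spectrum:
  assumes "orth_mat n U" "card (spectrum (conj_diag n U l)) = n"
  shows "inj_on l {..<n}"
  using assms by (intro eq_card_imp_inj_on) (simp_all add: spectrum_conj_diag)

theorem corollary4p5:
  fixes p q d :: nat
    and R U1 L1 U2 L2 H :: "real mat"
    and Ht :: "real \<Rightarrow> real mat"
  assumes "1 \<le> p" and "p \<le> q" and "d = p + q"
    and "R \<in> pd_mats d" and "R \<in> corr_mats d"
    and "card (spectrum (ul_block p R)) = p"
    and "card (spectrum (lr_block p R)) = q"
    and "ordered_eigendecomp p (ul_block p R) U1 L1"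
    and "ordered_eigendecomp q (lr_block p R) U2 L2"
    and "\<And>t. t > 0 \<Longrightarrow> Ht t \<in> sym_mats d" and "H \<in> sym_mats d"
    and "\<And>i j. i < d \<Longrightarrow> j < d \<Longrightarrow> ((\<lambda>t. Ht t $$ (i,j)) \<longlongrightarrow> H $$ (i,j)) (at_right 0)"
  shows "((\<lambda>t. inverse t * (dep_coef1 p q (corr_normalize (R + t \<cdot>\<^sub>m Ht t)) - dep_coef1 p q R))
          \<longlongrightarrow> tr ((M_R1 p q R U1 L1 U2 L2 - diag_part (M_R1 p q R U1 L1 U2 L2 * R)) * H)) (at_right 0) \<and>
         ((\<lambda>t. inverse t * (dep_coef2 p q (corr_normalize (R + t \<cdot>\<^sub>m Ht t)) - dep_coef2 p q R))
          \<longlongrightarrow> tr ((M_R2 p q R U1 L1 U2 L2 - diag_part (M_R2 p q R U1 L1 U2 L2 * R)) * H)) (at_right 0)"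
proof -
  note d = assms(3) and Rpd = assms(4) and Htsym = assms(10) and lim = assms(12)
  have Rc: "R \<in> carrier_mat d d" and Hc: "H \<in> carrier_mat d d"
    using Rpd assms(11) pd_mats_carrier sym_mats_carrier by auto
  have Htc: "Ht t \<in> carrier_mat d d" if "t > 0" for t using Htsym[OF that] by (rule sym_mats_carrier)
  have Rdiag: "R $$ (i,i) = 1" if "i < d" for i using assms(5) that by (simp add: corr_mats_def)
  define a b where "a i = L1 $$ (i,i)" and "b i = L2 $$ (i,i)" for i
  note E1 = ordered_eigendecompD[OF assms(8), folded a_def] and E2 = ordered_eigendecompD[OF assms(9), folded b_def]
  define S where "S t = R + t \<cdot>\<^sub>m Ht t" for t
  have S_entry: "S t $$ (i,j) = R $$ (i,j) + t * Ht t $$ (i,j)" if "t > 0" "i < d" "j < d" for t i j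
    using that Rc Htc[OF that(1)] by (simp add: S_def)
  have pos: "\<forall>\<^sub>F t in at_right 0. (0::real) < t" by (simp add: eventually_at_right_less)
  \<comment> \<open>scalar version of the path, with the value at \<open>0\<close> filled in\<close>
  define r where "r i j t = R $$ (i,j) + (if t = 0 then 0 else t * Ht t $$ (i,j))" for i j t
  have r0: "r i j 0 = R $$ (i,j)" for i j by (simp add: r_def)
  have r': "(r i j has_real_derivative H $$ (i,j)) (at_right 0)" if "i < d" "j < d" for i j
  proof -
    have "\<forall>\<^sub>F t in at_right 0. Ht t $$ (i,j) = (r i j t - r i j 0) / t"
      using pos by eventually_elim (simp add: r_def)
    then have "((\<lambda>t. (r i j t - r i j 0) / t) \<longlongrightarrow> H $$ (i,j)) (at_right 0)"
      using lim[OF that] by (rule Lim_transform_eventually[rotated])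
    then show ?thesis by (simp add: has_field_derivative_iff)
  qed
  have ev_pd: "\<forall>\<^sub>F t in at_right 0. S t \<in> pd_mats d"
  proof (rule pd_mats_eventually[OF Rpd])
    show "\<forall>\<^sub>F t in at_right 0. S t \<in> sym_mats d"
      using pos
    proof eventually_elim
      case (elim t)
      show ?case unfolding S_def
        by (intro sym_mats_add sym_mats_smult Htsym elim pd_mats_sym[OF Rpd])
    qed
    fix i j assume ij: "i < d" "j < d"
    have "(r i j \<longlongrightarrow> R $$ (i,j)) (at_right 0)"
      using DERIV_continuous[OF r'[OF ij]] by (simp add: continuous_within r0)
    moreover have "\<forall>\<^sub>F t in at_right 0. r i j t = S t $$ (i,j)"
      using pos by eventually_elim (simp add: r_def S_entry ij)
    ultimately show "((\<lambda>t. S t $$ (i,j)) \<longlongrightarrow> R $$ (i,j)) (at_right 0)"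
      by (rule Lim_transform_eventually)
  qed
  \<comment> \<open>replacing the path by the constant \<open>R\<close> away from small positive \<open>t\<close> keeps it positive definite\<close>
  define A where "A t = (if 0 < t \<and> S t \<in> pd_mats d then corr_normalize (S t) else R)" for t
  define K where "K = Matrix.mat d d (\<lambda>(i,j). H $$ (i,j) - R $$ (i,j) * (H $$ (i,i) + H $$ (j,j)) / 2)"
  have A0: "A 0 = R" by (simp add: A_def)
  have Apd: "A t \<in> pd_mats d" for t using Rpd corr_normalize_pd(1) by (simp add: A_def)
  have ev_A: "\<forall>\<^sub>F t in at_right 0. A t = corr_normalize (S t)"
    using pos ev_pd by eventually_elim (simp add: A_def)
  have path: "mat_deriv d A K"
    unfolding mat_deriv_def
  proof (intro conjI allI impI)
    show "A t \<in> carrier_mat d d" for t using Apd by (rule pd_mats_carrier)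
    show "K \<in> carrier_mat d d" by (simp add: K_def)
    fix i j assume ij: "i < d" "j < d"
    define g where "g t = r i j t / (sqrt (r i i t) * sqrt (r j j t))" for t
    have root: "((\<lambda>t. sqrt (r k k t)) has_real_derivative H $$ (k,k) / 2) (at_right 0)" if "k < d" for k
      using DERIV_chain2[OF DERIV_real_sqrt r'[OF that that]] Rdiag[OF that] by (simp add: r0)
    have prod: "((\<lambda>t. sqrt (r i i t) * sqrt (r j j t)) has_real_derivative (H $$ (i,i) + H $$ (j,j)) / 2) (at_right 0)"
      using DERIV_mult[OF root[OF ij(1)] root[OF ij(2)]] Rdiag ij by (simp add: r0 add_divide_distrib)
    have "(g has_real_derivative K $$ (i,j)) (at_right 0)"
      using quotient_deriv[OF r'[OF ij] prod] Rdiag ij unfolding g_def by (simp add: r0 K_def)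
    then have "((\<lambda>t. (g t - g 0) / t) \<longlongrightarrow> K $$ (i,j)) (at_right 0)"
      by (simp add: has_field_derivative_iff)
    moreover have "\<forall>\<^sub>F t in at_right 0. (g t - g 0) / t = (A t $$ (i,j) - A 0 $$ (i,j)) / t"
      using pos ev_pd
    proof eventually_elim
      case (elim t)
      then have "A t $$ (i,j) = g t"
        using ij by (simp add: A_def corr_normalize_pd(2) S_entry g_def r_def)
      moreover have "A 0 $$ (i,j) = g 0" using ij Rdiag by (simp add: A0 g_def r0)
      ultimately show ?case by simp
    qed
    ultimately have "((\<lambda>t. (A t $$ (i,j) - A 0 $$ (i,j)) / t) \<longlongrightarrow> K $$ (i,j)) (at_right 0)"
      by (rule Lim_transform_eventually)
    then show "((\<lambda>t. A t $$ (i,j)) has_real_derivative K $$ (i,j)) (at_right 0)"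
      by (simp add: has_field_derivative_iff)
  qed
  have blocks0: "ul_block p (A 0) = conj_diag p U1 a" "lr_block p (A 0) = conj_diag q U2 b"
    using E1(2) E2(2) by (simp_all add: A0)
  have blocks: "ul_block p (A t) \<in> sym_mats p" "lr_block p (A t) \<in> sym_mats q" for t
    using blocks_psd_pd[OF pd_mats_carrier, of "A t" p q] Apd[of t] by (auto simp: d intro: pd_mats_sym)
  obtain Ut ea where UE: "\<And>t. orth_mat p (Ut t)" "\<And>t. ul_block p (A t) = conj_diag p (Ut t) (ea t)"
    "\<And>t i j. i \<le> j \<Longrightarrow> j < p \<Longrightarrow> ea t j \<le> ea t i" "Ut 0 = U1" "ea 0 = a"
    by (rule sym_path_eigenbases[where A = "\<lambda>t. ul_block p (A t)", OF blocks(1) E1(1) blocks0(1)])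
      (erule (1) E1(4), rule that)
  obtain Vt eb where VE: "\<And>t. orth_mat q (Vt t)" "\<And>t. lr_block p (A t) = conj_diag q (Vt t) (eb t)"
    "\<And>t i j. i \<le> j \<Longrightarrow> j < q \<Longrightarrow> eb t j \<le> eb t i" "Vt 0 = U2" "eb 0 = b"
    by (rule sym_path_eigenbases[where A = "\<lambda>t. lr_block p (A t)", OF blocks(2) E2(1) blocks0(2)])
      (erule (1) E2(4), rule that)
  interpret block_eigen_path p q A Ut Vt K ea eb
  proof
    show "inj_on (ea 0) {..<p}" using assms(6) E1(1,2) UE(5) by (metis inj_on_of_card_spectrum)
    show "inj_on (eb 0) {..<q}" using assms(7) E2(1,2) VE(5) by (metis inj_on_of_card_spectrum)
  qed (use assms(1,2) path Apd d UE(1,2,3) VE(1,2,3) in auto)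
  have Ls: "L1 = mat_diag p a" "L2 = mat_diag q b" by (fact E1(3) E2(3))+
  note D1 = dep_coef1_deriv[unfolded A0 UE(4,5) VE(4,5), folded Ls d]
  note D2 = dep_coef2_deriv[unfolded A0 UE(4,5) VE(4,5), folded Ls d]
  have direction: "tr (M * K) = tr ((M - diag_part (M * R)) * H)" if "M \<in> sym_mats d" for M
    by (rule tr_normalized_direction[OF that pd_mats_sym[OF Rpd] Hc]) (simp_all add: K_def)
  have quotient: "((\<lambda>t. inverse t * (f (corr_normalize (R + t \<cdot>\<^sub>m Ht t)) - f R)) \<longlongrightarrow> D) (at_right 0)"
    if "((\<lambda>t. f (A t)) has_real_derivative D) (at_right 0)" for f :: "real mat \<Rightarrow> real" and D
  proof -
    have "((\<lambda>t. (f (A t) - f (A 0)) / t) \<longlongrightarrow> D) (at_right 0)"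
      using that by (simp add: has_field_derivative_iff)
    moreover have "\<forall>\<^sub>F t in at_right 0. (f (A t) - f (A 0)) / t
        = inverse t * (f (corr_normalize (R + t \<cdot>\<^sub>m Ht t)) - f R)"
      using ev_A by eventually_elim (simp add: A0 S_def divide_inverse mult.commute)
    ultimately show ?thesis by (rule Lim_transform_eventually)
  qed
  show ?thesis
    using quotient[OF D1(1)] quotient[OF D2(1)] unfolding direction[OF D1(2)] direction[OF D2(2)] by blast
qed

end
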